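(* Let $G$ be a polynomial semigroup generated by a compact subset $\Gamma$ of $\mathrm{Poly}_{\deg\ge2}$. Suppose that $G\in\mathcal G$ and $\mathrm{int}(\hat K(G))\ne\emptyset$. Let $b\in\mathrm{int}(\hat K(G))$. Moreover, let $d\in\mathbb N$ be any positive integer such that $d\ge2$ and such that $(d,\deg(h))\ne(2,2)$ for each $h\in\Gamma$. Then there exists a number $c>0$ such that for each $a\in\mathbb C$ with $0<|a|<c$, there exists a compact neighborhood $V$ of $g_a(z)=a(z-b)^d+b$ in $\mathrm{Poly}_{\deg\ge2}$ satisfying that for any non-empty subset $V'$ of $V$, the polynomial semigroup $H_{\Gamma,V'}$ generated by the family $\Gamma\cup V'$ belongs to $\mathcal G_{dis}$, $\hat K(H_{\Gamma,V'})=\hat K(G)$, and $(\Gamma\cup V')_{\min}\subset\Gamma$. Moreover, if in addition to these assumptions on $G$, $\Gamma$, $b$ and $d$ the semigroup $G$ is semi-hyperbolic (resp. hyperbolic), then for each $a\in\mathbb C$ with $0<|a|<c$, with $V$ the compact neighborhood of $g_a$ just described, and for any non-empty subset $V'$ of $V$, the polynomial semigroup $H_{\Gamma,V'}$ generated by $\Gamma\cup V'$ is semi-hyperbolic (resp. hyperbolic).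
   Context: $\hat{\mathbb C}$ is the Riemann sphere; $\mathrm{Poly}_{\deg\ge2}$ is the space of polynomial maps of $\hat{\mathbb C}$ of degree $\ge2$ with the topology of uniform convergence in the spherical distance. A polynomial semigroup is a semigroup under composition generated by a family of non-constant polynomials. $F(G)$ is the set of points having a neighborhood on which $G$ is normal, $J(G)=\hat{\mathbb C}\setminus F(G)$, $J(g)=J(\langle g\rangle)$. $P(G)=\overline{\bigcup_{g\in G}\{\text{critical values of }g\}}$, $P^{*}(G)=P(G)\setminus\{\infty\}$. $\mathcal G$: polynomial semigroups with all elements of degree $\ge2$ and $P^{*}(G)$ bounded in $\mathbb C$; $\mathcal G_{dis}$: those $G\in\mathcal G$ with $J(G)$ disconnected. $\hat K(G)=\{z\in\mathbb C:\bigcup_{g\in G}\{g(z)\}\text{ is bounded in }\mathbb C\}$. For connected $K_1,K_2\subset\mathbb C$, $K_1\le K_2$ means $K_1=K_2$ or $K_1$ lies in a bounded component of $\mathbb C\setminus K_2$. For $H\in\mathcal G_{dis}$, $J_{\min}(H)$ is the unique component of $J(H)$ contained in $\mathbb C$ with $J_{\min}(H)\le J$ for every component $J\subset\mathbb C$ of $J(H)$ (it exists). If $H\in\mathcal G_{dis}$ is generated by a set $\Lambda\subset\mathrm{Poly}_{\deg\ge2}$, then $\Lambda_{\min}=\{h\in\Lambda:J(h)\subset J_{\min}(H)\}$. $G$ is hyperbolic if $P(G)\subset F(G)$. $G$ is semi-hyperbolic if there exist $\delta>0$ and $N\in\mathbb N$ such that for each $y\in J(G)$ and $g\in G$, $\deg(g:W\to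 B(y,\delta))\le N$ for each connected component $W$ of $g^{-1}(B(y,\delta))$, where $B(y,\delta)$ is the spherical ball and $\deg$ is the degree of a finite branched covering. *)

theory Defs
  imports "HOL-Analysis.Analysis" "HOL-Computational_Algebra.Polynomial"
begin

section \<open>The Riemann sphere with the spherical distance\<close>

datatype riemann_sphere = Fin complex | Infinity

text \<open>Inverse stereographic projection onto the Euclidean unit sphere; the product type
  \<^typ>\<open>complex \<times> real\<close> carries the Euclidean inner product of three-dimensional space.\<close>

fun sphere_point :: "riemann_sphere \<Rightarrow> complex \<times> real" where
  "sphere_point (Fin z) =
     ((2 / (1 + (cmod z)\<^sup>2)) *\<^sub>R z, ((cmod z)\<^sup>2 - 1) / ((cmod z)\<^sup>2 + 1))"
| "sphere_point Infinity = (0, 1)"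

lemma norm_sphere_point [simp]: "norm (sphere_point x) = 1"
proof (cases x)
  case (Fin z)
  define t where "t = (cmod z)\<^sup>2"
  have "1 + t > 0" by (simp add: t_def add_pos_nonneg)
  then have "(2 / (1 + t))\<^sup>2 * t + ((t - 1) / (t + 1))\<^sup>2 = (4 * t + (t - 1)\<^sup>2) / (1 + t)\<^sup>2"
    by (simp add: power_divide add_divide_distrib add.commute)
  also have "4 * t + (t - 1)\<^sup>2 = (1 + t)\<^sup>2"
    by (simp add: power2_eq_square algebra_simps)
  also have "(1 + t)\<^sup>2 / (1 + t)\<^sup>2 = 1" using \<open>1 + t > 0\<close> by simp
  finally have "(2 / (1 + t))\<^sup>2 * t + ((t - 1) / (t + 1))\<^sup>2 = 1" .
  moreover have "(norm ((2 / (1 + t)) *\<^sub>R z))\<^sup>2 = (2 / (1 + t))\<^sup>2 * t"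
    by (simp only: norm_scaleR power_mult_distrib real_norm_def power2_abs t_def)
  ultimately have "norm ((2 / (1 + t)) *\<^sub>R z, (t - 1) / (t + 1)) = 1"
    by (simp only: norm_Pair real_norm_def power2_abs real_sqrt_one)
  then show ?thesis by (simp only: Fin sphere_point.simps t_def)
qed (simp add: norm_Pair)

lemma inj_sphere_point: "inj sphere_point"
proof (rule injI)
  fix x y assume eq: "sphere_point x = sphere_point y"
  have ne: "((cmod z)\<^sup>2 - 1) / ((cmod z)\<^sup>2 + 1) \<noteq> 1" for z
  proof -
    have "(cmod z)\<^sup>2 + 1 > 0" by (simp add: add_nonneg_pos)
    then show ?thesis by (simp add: divide_eq_eq)
  qed
  show "x = y"
  proof (cases x; cases y)
    fix z w assume xy: "x = Fin z" "y = Fin w"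
    have pos: "1 + (cmod u)\<^sup>2 > 0" for u by (simp add: add_pos_nonneg)
    have "((cmod z)\<^sup>2 - 1) / ((cmod z)\<^sup>2 + 1) = ((cmod w)\<^sup>2 - 1) / ((cmod w)\<^sup>2 + 1)"
      using eq xy by simp
    then have "(cmod z)\<^sup>2 = (cmod w)\<^sup>2"
      using pos[of z] pos[of w] by (simp add: divide_simps add.commute) (simp add: algebra_simps)
    with eq xy pos[of w] show "x = y" by simp
  qed (use eq ne in \<open>auto simp: eq_commute[of 1]\<close>)
qed

lemma abs_inner_sphere_point: "\<bar>sphere_point x \<bullet> sphere_point y\<bar> \<le> 1"
  using Cauchy_Schwarz_ineq2[of "sphere_point x" "sphere_point y"] by simp

lemma arccos_inner_triangle:
  fixes u v w :: "'a::real_inner"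
  assumes "norm u = 1" "norm v = 1" "norm w = 1"
  shows "arccos (u \<bullet> w) \<le> arccos (u \<bullet> v) + arccos (v \<bullet> w)"
proof -
  have bd: "\<bar>x \<bullet> y\<bar> \<le> 1" if "norm x = 1" "norm y = 1" for x y :: 'a
    using Cauchy_Schwarz_ineq2[of x y] that by simp
  define a b where "a = u \<bullet> v" and "b = v \<bullet> w"
  have a: "\<bar>a\<bar> \<le> 1" and b: "\<bar>b\<bar> \<le> 1" and c: "\<bar>u \<bullet> w\<bar> \<le> 1"
    using bd assms by (auto simp: a_def b_def)
  have n: "x \<bullet> x = 1" if "norm x = 1" for x :: 'a
    using that by (simp add: dot_square_norm)
  have pu: "norm (u - a *\<^sub>R v) = sqrt (1 - a\<^sup>2)"
    unfolding norm_eq_sqrt_inner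
    by (rule arg_cong[of _ _ sqrt])
       (simp add: inner_diff_left inner_diff_right n assms a_def inner_commute power2_eq_square)
  have pw: "norm (w - b *\<^sub>R v) = sqrt (1 - b\<^sup>2)"
    unfolding norm_eq_sqrt_inner
    by (rule arg_cong[of _ _ sqrt])
       (simp add: inner_diff_left inner_diff_right n assms b_def inner_commute power2_eq_square)
  have "(u - a *\<^sub>R v) \<bullet> (w - b *\<^sub>R v) = u \<bullet> w - a * b"
    by (simp add: inner_diff_left inner_diff_right n assms a_def b_def inner_commute)
  moreover have "\<bar>(u - a *\<^sub>R v) \<bullet> (w - b *\<^sub>R v)\<bar> \<le> sqrt (1 - a\<^sup>2) * sqrt (1 - b\<^sup>2)"
    using Cauchy_Schwarz_ineq2[of "u - a *\<^sub>R v" "w - b *\<^sub>R v"] by (simp only: pu pw)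
  ultimately have key: "a * b - sqrt (1 - a\<^sup>2) * sqrt (1 - b\<^sup>2) \<le> u \<bullet> w" by linarith
  have "cos (arccos a + arccos b) \<le> u \<bullet> w"
    using key a b by (simp add: cos_add cos_arccos_abs sin_arccos_abs)
  show ?thesis
  proof (cases "arccos a + arccos b \<le> pi")
    case True
    have "0 \<le> arccos a + arccos b"
      using a b by (simp add: arccos_lbound abs_le_iff)
    with True have "arccos (cos (arccos a + arccos b)) = arccos a + arccos b"
      by (simp add: arccos_cos)
    moreover have "arccos (u \<bullet> w) \<le> arccos (cos (arccos a + arccos b))"
      using \<open>cos (arccos a + arccos b) \<le> u \<bullet> w\<close> c by (intro arccos_le_arccos) auto
    ultimately show ?thesis by (simp add: a_def b_def)
  next
    case False
    then show ?thesis using c arccos_ubound[of "u \<bullet> w"] by (simp add: a_def b_def abs_le_iff)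
  qed
qed

text \<open>The metric induced by the line element \<open>2 |dz| / (1 + |z|^2)\<close>, i.e. arc length along great
  circles of the unit sphere.\<close>

instantiation riemann_sphere :: metric_space
begin

definition dist_riemann_sphere :: "riemann_sphere \<Rightarrow> riemann_sphere \<Rightarrow> real" where
  "dist_riemann_sphere x y = arccos (sphere_point x \<bullet> sphere_point y)"

definition uniformity_riemann_sphere :: "(riemann_sphere \<times> riemann_sphere) filter" where
  "uniformity_riemann_sphere = (INF e\<in>{0 <..}. principal {(x, y). dist x y < e})"

definition open_riemann_sphere :: "riemann_sphere set \<Rightarrow> bool" where
  "open_riemann_sphere U =
     (\<forall>x\<in>U. eventually (\<lambda>(x', y). x' = x \<longrightarrow> y \<in> U) uniformity)"

instance
proof
  fix x y z :: riemann_sphere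
  show "dist x y = 0 \<longleftrightarrow> x = y"
  proof
    assume "dist x y = 0"
    then have "sphere_point x \<bullet> sphere_point y = 1"
      using abs_inner_sphere_point[of x y] cos_arccos_abs[of "sphere_point x \<bullet> sphere_point y"]
      by (simp add: dist_riemann_sphere_def)
    moreover have "(norm (sphere_point x - sphere_point y))\<^sup>2
        = 2 - 2 * (sphere_point x \<bullet> sphere_point y)"
      using dot_norm_neg[of "sphere_point x" "sphere_point y"] by simp
    ultimately have "sphere_point x = sphere_point y" by simp
    then show "x = y" using inj_sphere_point by (simp add: inj_eq)
  qed (simp add: dist_riemann_sphere_def dot_square_norm)
  show "dist x y \<le> dist x z + dist y z"
    using arccos_inner_triangle[of "sphere_point x" "sphere_point z" "sphere_point y"]
    by (simp add: dist_riemann_sphere_def inner_commute)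
qed (auto simp: uniformity_riemann_sphere_def open_riemann_sphere_def)

end

lemma dist_riemann_sphere_le_pi: "dist x y \<le> pi" for x y :: riemann_sphere
  using abs_inner_sphere_point[of x y]
  by (simp add: dist_riemann_sphere_def arccos_ubound abs_le_iff)


section \<open>Polynomial maps of the sphere\<close>

text \<open>Polynomial maps are represented by their polynomials; composition of maps is
  \<^const>\<open>pcompose\<close> and the degree of a non-constant map is \<^const>\<open>degree\<close>.\<close>

fun sphere_map :: "complex poly \<Rightarrow> riemann_sphere \<Rightarrow> riemann_sphere" where
  "sphere_map p (Fin z) = Fin (poly p z)"
| "sphere_map p Infinity = (if degree p = 0 then Fin (coeff p 0) else Infinity)"

lemma sphere_map_eq_iff: "(\<forall>x. sphere_map p x = sphere_map q x) \<longleftrightarrow> p = q"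
proof
  assume "\<forall>x. sphere_map p x = sphere_map q x"
  then have "sphere_map p (Fin z) = sphere_map q (Fin z)" for z by blast
  then have "poly p = poly q" by (simp add: fun_eq_iff)
  then show "p = q" by (simp add: poly_eq_poly_eq_iff)
qed simp

definition Poly_ge2 :: "complex poly set" where
  "Poly_ge2 = {p. degree p \<ge> 2}"

definition unif_dist :: "complex poly \<Rightarrow> complex poly \<Rightarrow> real" where
  "unif_dist p q = (SUP x. dist (sphere_map p x) (sphere_map q x))"

lemma bdd_above_unif_dist: "bdd_above (range (\<lambda>x. dist (sphere_map p x) (sphere_map q x)))"
  by (rule bdd_aboveI[of _ pi]) (auto simp: dist_riemann_sphere_le_pi)

lemma dist_le_unif_dist: "dist (sphere_map p x) (sphere_map q x) \<le> unif_dist p q"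
  unfolding unif_dist_def by (rule cSUP_upper[OF _ bdd_above_unif_dist]) simp

interpretation Poly_ge2: Metric_space Poly_ge2 unif_dist
proof
  fix p q r :: "complex poly"
  show "0 \<le> unif_dist p q"
    using dist_le_unif_dist[of p Infinity q] zero_le_dist order_trans by blast
  show "unif_dist p q = unif_dist q p"
    by (simp add: unif_dist_def dist_commute)
  show "unif_dist p q = 0 \<longleftrightarrow> p = q"
  proof
    assume "unif_dist p q = 0"
    then have "\<forall>x. sphere_map p x = sphere_map q x"
      using dist_le_unif_dist[of p _ q] by simp
    then show "p = q" by (simp only: sphere_map_eq_iff)
  qed (simp add: unif_dist_def)
  show "unif_dist p r \<le> unif_dist p q + unif_dist q r"
    unfolding unif_dist_def[of p r]
  proof (rule cSUP_least)
    fix x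
    show "dist (sphere_map p x) (sphere_map r x) \<le> unif_dist p q + unif_dist q r"
      using dist_triangle[of "sphere_map p x" "sphere_map r x" "sphere_map q x"]
        dist_le_unif_dist[of p x q] dist_le_unif_dist[of q x r] by linarith
  qed simp
qed

abbreviation Poly_ge2_topology :: "complex poly topology" where
  "Poly_ge2_topology \<equiv> Poly_ge2.mtopology"


section \<open>Polynomial semigroups\<close>

inductive_set semigroup_generated :: "complex poly set \<Rightarrow> complex poly set"
  for \<Lambda> :: "complex poly set" where
  generator: "h \<in> \<Lambda> \<Longrightarrow> h \<in> semigroup_generated \<Lambda>"
| compose: "\<lbrakk>f \<in> semigroup_generated \<Lambda>; g \<in> semigroup_generated \<Lambda>\<rbrakk>
    \<Longrightarrow> f \<circ>\<^sub>p g \<in> semigroup_generated \<Lambda>"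

definition polynomial_semigroup :: "complex poly set \<Rightarrow> bool" where
  "polynomial_semigroup G \<longleftrightarrow>
     (\<exists>\<Lambda>. \<Lambda> \<noteq> {} \<and> (\<forall>h\<in>\<Lambda>. degree h \<ge> 1) \<and> G = semigroup_generated \<Lambda>)"

text \<open>Normality in the sense of Montel: locally uniform subsequential limits with respect to the
  spherical distance, where the constant map \<^const>\<open>Infinity\<close> is an admissible limit.\<close>

definition normal_on :: "complex poly set \<Rightarrow> riemann_sphere set \<Rightarrow> bool" where
  "normal_on G U \<longleftrightarrow>
     (\<forall>s :: nat \<Rightarrow> complex poly. range s \<subseteq> G \<longrightarrow>
        (\<exists>r f. strict_mono r \<and>
           (\<forall>K. compact K \<and> K \<subseteq> U \<longrightarrow>
              uniform_limit K (\<lambda>n. sphere_map (s (r n))) f sequentially)))"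

definition fatou_set :: "complex poly set \<Rightarrow> riemann_sphere set" where
  "fatou_set G = {z. \<exists>U. open U \<and> z \<in> U \<and> normal_on G U}"

definition julia_set :: "complex poly set \<Rightarrow> riemann_sphere set" where
  "julia_set G = - fatou_set G"

text \<open>Critical points on the sphere: a polynomial of degree at least two is also ramified at
  \<^const>\<open>Infinity\<close>.\<close>

definition critical_points :: "complex poly \<Rightarrow> riemann_sphere set" where
  "critical_points p =
     Fin ` {z. poly (pderiv p) z = 0} \<union> (if degree p \<ge> 2 then {Infinity} else {})"

definition critical_values :: "complex poly \<Rightarrow> riemann_sphere set" where
  "critical_values p = sphere_map p ` critical_points p"

definition postcritical_set :: "complex poly set \<Rightarrow> riemann_sphere set" where
  "postcritical_set G = closure (\<Union>g\<in>G. critical_values g)"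

definition planar_postcritical_set :: "complex poly set \<Rightarrow> complex set" where
  "planar_postcritical_set G = Fin -` (postcritical_set G - {Infinity})"

definition class_G :: "complex poly set set" where
  "class_G = {G. polynomial_semigroup G \<and> (\<forall>g\<in>G. degree g \<ge> 2) \<and>
     bounded (planar_postcritical_set G)}"

definition class_G_dis :: "complex poly set set" where
  "class_G_dis = {G \<in> class_G. \<not> connected (julia_set G)}"

definition K_hat :: "complex poly set \<Rightarrow> complex set" where
  "K_hat G = {z. bounded (\<Union>g\<in>G. {poly g z})}"


section \<open>The surrounding order and the minimal component\<close>

definition surrounded_by :: "complex set \<Rightarrow> complex set \<Rightarrow> bool" where
  "surrounded_by K1 K2 \<longleftrightarrow>
     K1 = K2 \<or> (\<exists>B \<in> components (- K2). bounded B \<and> K1 \<subseteq> B)"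

definition is_J_min :: "complex poly set \<Rightarrow> riemann_sphere set \<Rightarrow> bool" where
  "is_J_min H M \<longleftrightarrow>
     M \<in> components (julia_set H) \<and> Infinity \<notin> M \<and>
     (\<forall>J \<in> components (julia_set H). Infinity \<notin> J \<longrightarrow> surrounded_by (Fin -` M) (Fin -` J))"

definition J_min :: "complex poly set \<Rightarrow> riemann_sphere set" where
  "J_min H = (THE M. is_J_min H M)"

definition min_generators :: "complex poly set \<Rightarrow> complex poly set" where
  "min_generators \<Lambda> =
     {h \<in> \<Lambda>. julia_set (semigroup_generated {h}) \<subseteq> J_min (semigroup_generated \<Lambda>)}"


section \<open>Hyperbolicity and semi-hyperbolicity\<close>

definition hyperbolic :: "complex poly set \<Rightarrow> bool" where
  "hyperbolic G \<longleftrightarrow> postcritical_set G \<subseteq> fatou_set G"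

fun local_degree :: "complex poly \<Rightarrow> riemann_sphere \<Rightarrow> nat" where
  "local_degree p (Fin z) = order z (p - [:poly p z:])"
| "local_degree p Infinity = degree p"

text \<open>The degree of \<open>p : W \<rightarrow> B\<close> as a finite branched covering is the number of preimages in \<open>W\<close>,
  counted with multiplicity, of any point of \<open>B\<close>. It is independent of that point when \<open>p\<close> is
  non-constant, \<open>B\<close> is a ball and \<open>W\<close> is a connected component of the preimage of \<open>B\<close>.\<close>

definition covering_degree :: "complex poly \<Rightarrow> riemann_sphere set \<Rightarrow> riemann_sphere set \<Rightarrow> nat" where
  "covering_degree p W B =
     (THE n. \<forall>y\<in>B. (\<Sum>x\<in>{x \<in> W. sphere_map p x = y}. local_degree p x) = n)"

definition semi_hyperbolic :: "complex poly set \<Rightarrow> bool" where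
  "semi_hyperbolic G \<longleftrightarrow>
     (\<exists>\<delta>>0. \<exists>N. \<forall>y \<in> julia_set G. \<forall>g \<in> G.
        \<forall>W \<in> components (sphere_map g -` ball y \<delta>). covering_degree g W (ball y \<delta>) \<le> N)"

end

(* For small a the map g_a is nearly constant on a large disc around b, while generators of G push the
   outside of a disc of radius t far outwards. With |a| (2t)^d comparable to the inner radius of K_hat(G),
   the annulus t < |z - b| < 2t is sent by the generators from Gamma into the basin of infinity and by
   those from V into a small ball around b inside K_hat(G); hence it lies in the Fatou set and separates
   J(h), h in Gamma, from J(v), v in V. The condition (d, deg h) different from (2, 2) is (d - 1)(deg h - 1) > 1,
   which lets g_a expand where h has pushed the points. A minimal component of the Julia set exists because every
   component surrounds b and nested compact hulls have a common point in the Julia set.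
   For (semi-)hyperbolicity, every word either lies in G or factors as g o v o f with v in V. All
   critical values of v o f lie in the small ball, and the orbit of that ball under G stays away from the
   boundary of K_hat(G): otherwise elements of G would converge there to a constant in the boundary,
   which bounded multiplicity near the boundary forbids. So v o f is injective over a neighbourhood of
   the boundary, and the degree is controlled by that of g. *)
theory Submission
  imports Defs "HOL-Complex_Analysis.Complex_Analysis"
    "HOL-Computational_Algebra.Fundamental_Theorem_Algebra"
begin

section \<open>Topology of the sphere\<close>

text \<open>The degree condition is a count of exponents. With \<open>|a| (2t)^d = r / 4\<close> the
  radius \<open>t\<close> has order \<open>|a|^(-1/d)\<close>. One step of \<open>\<Gamma>\<close>
  from distance \<open>t\<close> reaches at least \<open>\<rho> = m t^k\<close>, where
  \<open>k\<close> bounds the degrees in \<open>\<Gamma>\<close> from below. Elements near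
  \<open>g_a\<close> expand beyond \<rho> once \<open>|a| \<rho>^(d - 1)\<close> is large, and this
  is a multiple of \<open>t^(k (d - 1) - d)\<close>. The exponent equals
  \<open>(k - 1)(d - 1) - 1\<close>; when it is positive, shrinking \<open>a\<close> suffices. Hence
  two escape radii: \<open>t\<close> for \<open>\<Gamma>\<close> alone and \<rho> for the enlarged
  semigroup. The Julia set of a semigroup need not be forward invariant, so a property of one
  component cannot simply be transported to the others. That every component surrounds
  \<open>b\<close> is obtained from the sets \<open>L h g\<close>, preimages under \<open>g\<close>
  of the filled Julia set of \<open>h\<close>: their frontiers are connected, separate
  \<open>b\<close> from infinity and together are dense in the Julia set. The degree of a branched
  covering is given by a definite description, so its independence of the point has to be proved;
  this takes continuity of roots and connectedness of spherical balls.\<close>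

lemma tendsto_sphereI:
  assumes "((\<lambda>x. sphere_point (f x)) \<longlongrightarrow> sphere_point l) F"
  shows "(f \<longlongrightarrow> l) F"
proof -
  have 1: "((\<lambda>x. sphere_point (f x) \<bullet> sphere_point l) \<longlongrightarrow> 1) F"
    using tendsto_inner[OF assms tendsto_const[of "sphere_point l"]] by (simp add: dot_square_norm)
  have 2: "continuous (at 1 within {-1..1}) arccos"
    using continuous_on_arccos' by (auto simp: continuous_on_eq_continuous_within)
  have 3: "\<forall>\<^sub>F x in F. sphere_point (f x) \<bullet> sphere_point l \<in> {-1..1}"
    using abs_inner_sphere_point by (auto simp: abs_le_iff minus_le_iff intro!: always_eventually)
  have "((\<lambda>x. arccos (sphere_point (f x) \<bullet> sphere_point l)) \<longlongrightarrow> arccos 1) F"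
    using 2 3 1 by (rule continuous_within_tendsto_compose)
  then show ?thesis
    by (subst tendsto_dist_iff) (simp add: dist_riemann_sphere_def)
qed

lemma continuous_on_Fin: "continuous_on S Fin"
proof -
  have "1 + (cmod z)\<^sup>2 \<noteq> 0" "(cmod z)\<^sup>2 + 1 \<noteq> 0" for z
    using zero_le_power2[of "cmod z"] by linarith+
  then have "continuous_on S (\<lambda>z. sphere_point (Fin z))"
    by (auto intro!: continuous_intros)
  then show ?thesis
    unfolding continuous_on_def by (blast intro: tendsto_sphereI)
qed

lemma tendsto_Infinity:
  assumes "filterlim f at_infinity F"
  shows "((\<lambda>x. Fin (f x)) \<longlongrightarrow> Infinity) F"
proof (rule tendsto_sphereI)
  define g where "g = (\<lambda>x. cmod (f x))"
  have g: "filterlim g at_top F"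
    using assms unfolding g_def filterlim_at_infinity_conv_norm_at_top .
  have p: "1 + t\<^sup>2 > 0" for t :: real
    by (simp add: add_pos_nonneg)
  have inv: "((\<lambda>t::real. 2 / t) \<longlongrightarrow> 0) at_top"
    by (intro tendsto_divide_0[OF tendsto_const] filterlim_at_top_imp_at_infinity filterlim_ident)
  have "((\<lambda>t::real. 2 / t * (1 / t)) \<longlongrightarrow> 0) at_top"
    using tendsto_mult[OF inv tendsto_divide_0[OF tendsto_const[of 1] filterlim_at_top_imp_at_infinity[OF filterlim_ident]]]
    by simp
  then have "((\<lambda>t::real. 2 / (t\<^sup>2 + 1)) \<longlongrightarrow> 0) at_top"
    by (rule Lim_null_comparison[rotated])
       (auto intro!: eventually_mono[OF eventually_gt_at_top[of 0]] divide_left_mono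
         simp: power2_eq_square add_pos_pos)
  from tendsto_diff[OF tendsto_const[of 1] this]
  have "((\<lambda>t::real. 1 - 2 / (t\<^sup>2 + 1)) \<longlongrightarrow> 1) at_top" by simp
  moreover have "(\<lambda>t::real. 1 - 2 / (t\<^sup>2 + 1)) = (\<lambda>t. (t\<^sup>2 - 1) / (t\<^sup>2 + 1))"
  proof
    fix t :: real
    show "1 - 2 / (t\<^sup>2 + 1) = (t\<^sup>2 - 1) / (t\<^sup>2 + 1)"
      using p[of t] by (simp add: field_simps)
  qed
  ultimately have "((\<lambda>t::real. (t\<^sup>2 - 1) / (t\<^sup>2 + 1)) \<longlongrightarrow> 1) at_top"
    by metis
  from filterlim_compose[OF this g]
  have 1: "((\<lambda>x. ((g x)\<^sup>2 - 1) / ((g x)\<^sup>2 + 1)) \<longlongrightarrow> 1) F" .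
  have "norm (2 / (1 + t\<^sup>2) * t) \<le> 2 / t" if "t > 0" for t :: real
  proof -
    have "2 / (1 + t\<^sup>2) * t \<le> 2 / t"
      using that p[of t] by (simp add: field_simps power2_eq_square)
    then show ?thesis using that p[of t] by simp
  qed
  then have "\<forall>\<^sub>F t in at_top. norm (2 / (1 + t\<^sup>2) * t) \<le> 2 / (t::real)"
    by (rule eventually_mono[OF eventually_gt_at_top[of 0]])
  from Lim_null_comparison[OF this inv]
  have "((\<lambda>t::real. 2 / (1 + t\<^sup>2) * t) \<longlongrightarrow> 0) at_top" .
  from filterlim_compose[OF this g]
  have "((\<lambda>x. 2 / (1 + (g x)\<^sup>2) * g x) \<longlongrightarrow> 0) F" .
  moreover have "(\<lambda>x. 2 / (1 + (g x)\<^sup>2) * g x) = (\<lambda>x. norm ((2 / (1 + (g x)\<^sup>2)) *\<^sub>R f x))"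
    using p by (simp add: g_def fun_eq_iff less_imp_le)
  ultimately have "((\<lambda>x. norm ((2 / (1 + (g x)\<^sup>2)) *\<^sub>R f x)) \<longlongrightarrow> 0) F"
    by metis
  then have "((\<lambda>x. (2 / (1 + (g x)\<^sup>2)) *\<^sub>R f x) \<longlongrightarrow> 0) F"
    by (rule tendsto_norm_zero_cancel)
  from tendsto_Pair[OF this 1]
  show "((\<lambda>x. sphere_point (Fin (f x))) \<longlongrightarrow> sphere_point Infinity) F"
    unfolding sphere_point.simps g_def .
qed

text \<open>The inverse of the coordinate \<open>w = 1 / (z - b)\<close> at infinity, centred at the
  same \<open>b\<close> as the escape estimates, so that exteriors of discs about \<open>b\<close>
  become discs about 0.\<close>

definition inf_chart :: "complex \<Rightarrow> complex \<Rightarrow> riemann_sphere" where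
  "inf_chart b w = (if w = 0 then Infinity else Fin (b + 1 / w))"

lemma inf_chart_eq [simp]:
  "inf_chart b w = Infinity \<longleftrightarrow> w = 0"
  "z \<noteq> b \<Longrightarrow> inf_chart b (1 / (z - b)) = Fin z"
  "inf_chart b 0 = Infinity"
  by (auto simp: inf_chart_def)

lemma inj_inf_chart: "inj (inf_chart b)"
  by (auto simp: inj_def inf_chart_def split: if_splits)

lemma continuous_on_inf_chart: "continuous_on S (inf_chart b)"
proof -
  have "isCont (inf_chart b) w" for w
  proof (cases "w = 0")
    case True
    have "filterlim (\<lambda>w. b + 1 / w) at_infinity (at (0::complex))"
      using filterlim_inverse_at_infinity[where 'a=complex]
      by (intro tendsto_add_filterlim_at_infinity[OF tendsto_const])
         (simp add: inverse_eq_divide[abs_def] del: inverse_eq_divide)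
    then have "((\<lambda>w. Fin (b + 1 / w)) \<longlongrightarrow> Infinity) (at 0)"
      by (rule tendsto_Infinity)
    then have "(inf_chart b \<longlongrightarrow> Infinity) (at 0)"
      by (rule Lim_transform_eventually)
         (auto simp: inf_chart_def eventually_at_filter)
    then show ?thesis
      by (simp add: isCont_def True)
  next
    case False
    have "isCont (\<lambda>w. Fin (b + 1 / w)) w"
      by (rule isCont_o2[where g=Fin])
         (use False continuous_on_Fin[of UNIV] in
           \<open>auto intro!: continuous_intros simp: continuous_on_eq_continuous_at\<close>)
    moreover have "\<forall>\<^sub>F v in nhds w. inf_chart b v = Fin (b + 1 / v)"
      using t1_space_nhds[OF False] by eventually_elim (simp add: inf_chart_def)
    ultimately show ?thesis
      by (simp add: isCont_cong)
  qed
  then show ?thesis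
    by (simp add: continuous_at_imp_continuous_on)
qed

lemma inf_chart_image:
  assumes "R > 0"
  shows "inf_chart b ` cball 0 (1 / R) = - (Fin ` ball b R)"
    and "inf_chart b ` ball 0 (1 / R) = - (Fin ` cball b R)"
proof -
  have *: "x \<in> inf_chart b ` S \<longleftrightarrow> (case x of Fin z \<Rightarrow> z \<noteq> b \<and> 1 / (z - b) \<in> S | Infinity \<Rightarrow> 0 \<in> S)"
    for x S
  proof (cases x)
    case (Fin z)
    show ?thesis
    proof
      assume "x \<in> inf_chart b ` S"
      then show "case x of Fin z \<Rightarrow> z \<noteq> b \<and> 1 / (z - b) \<in> S | Infinity \<Rightarrow> 0 \<in> S"
        using Fin by (auto simp: inf_chart_def split: if_splits)
    next
      assume "case x of Fin z \<Rightarrow> z \<noteq> b \<and> 1 / (z - b) \<in> S | Infinity \<Rightarrow> 0 \<in> S"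
      then show "x \<in> inf_chart b ` S"
        using Fin by (intro image_eqI[of _ _ "1 / (z - b)"]) auto
    qed
  qed (auto simp: inf_chart_def image_iff split: if_splits)
  have 1: "cmod (1 / (z - b)) = 1 / dist b z" for z
    by (simp add: norm_divide dist_norm norm_minus_commute)
  have 2: "z \<noteq> b \<and> 1 / dist b z \<le> 1 / R \<longleftrightarrow> \<not> dist b z < R"
    and 3: "z \<noteq> b \<and> 1 / dist b z < 1 / R \<longleftrightarrow> \<not> dist b z \<le> R" for z
    using assms by (cases "z = b"; simp add: field_simps not_less not_le)+
  show "inf_chart b ` cball 0 (1 / R) = - (Fin ` ball b R)"
  proof (intro set_eqI)
    fix x
    show "x \<in> inf_chart b ` cball 0 (1 / R) \<longleftrightarrow> x \<in> - (Fin ` ball b R)"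
      unfolding * mem_cball_0 1 using assms 2
      by (cases x) (auto simp: image_iff)
  qed
  show "inf_chart b ` ball 0 (1 / R) = - (Fin ` cball b R)"
  proof (intro set_eqI)
    fix x
    show "x \<in> inf_chart b ` ball 0 (1 / R) \<longleftrightarrow> x \<in> - (Fin ` cball b R)"
      unfolding * mem_ball_0 1 using assms 3
      by (cases x) (auto simp: image_iff)
  qed
qed

lemma compact_Fin: "compact S \<Longrightarrow> compact (Fin ` S)"
  by (rule compact_continuous_image[OF continuous_on_Fin])

text \<open>For bounded \<open>S\<close> the complement of the image is compact: the image of a
  compact part of the plane together with a closed disc of the chart at infinity. An unbounded
  \<open>S\<close> is exhausted by its bounded pieces.\<close>

lemma open_Fin:
  assumes "open S" shows "open (Fin ` S)"
proof -
  have *: "open (Fin ` (S \<inter> ball 0 R))" if "R > 0" for R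
  proof -
    have "- (Fin ` (S \<inter> ball 0 R)) = Fin ` (cball 0 R - (S \<inter> ball 0 R)) \<union> inf_chart 0 ` cball 0 (1 / R)"
      unfolding inf_chart_image[OF that] by (auto simp: image_iff) 
    moreover have "compact (cball 0 R - (S \<inter> ball 0 R))"
      by (intro compact_diff compact_cball open_Int assms open_ball)
    ultimately have "compact (- (Fin ` (S \<inter> ball 0 R)))"
      by (simp add: compact_Un compact_Fin compact_continuous_image continuous_on_inf_chart)
    then show ?thesis
      by (simp add: compact_imp_closed open_closed)
  qed
  have "Fin ` S = (\<Union>n::nat. Fin ` (S \<inter> ball 0 (real (Suc n))))"
  proof -
    have "\<exists>n. z \<in> ball 0 (real (Suc n))" for z :: complex
    proof -
      obtain n where "norm z < real n" using reals_Archimedean2 by blast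
      then show ?thesis by (intro exI[of _ n]) simp
    qed
    then show ?thesis by blast
  qed
  then show ?thesis
    using * by (metis open_UN of_nat_0_less_iff zero_less_Suc)
qed

lemma open_compl_Fin:
  assumes "closed S" "bounded S" shows "open (- (Fin ` S))"
  using assms compact_Fin compact_imp_closed compact_eq_bounded_closed open_Compl by blast

lemma open_vimage_Fin: "open U \<Longrightarrow> open (Fin -` U)"
  using continuous_on_Fin[of UNIV] by (rule open_vimage[rotated])

lemma closed_vimage_Fin: "closed U \<Longrightarrow> closed (Fin -` U)"
  by (rule continuous_closed_vimage)
    (use continuous_on_Fin[of UNIV] in \<open>auto simp: continuous_on_eq_continuous_at\<close>)

definition unFin :: "riemann_sphere \<Rightarrow> complex" where
  "unFin x = (case x of Fin z \<Rightarrow> z | Infinity \<Rightarrow> 0)"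

lemma unFin_Fin [simp]: "unFin (Fin z) = z"
  by (simp add: unFin_def)

lemma inj_Fin: "inj_on Fin S"
  by (simp add: inj_on_def)

lemma sphere_minus_Infinity: "x \<noteq> Infinity \<Longrightarrow> x = Fin (unFin x)"
  by (cases x) auto

lemma continuous_on_unFin: 
  assumes "Infinity \<notin> S" shows "continuous_on S unFin"
proof -
  have "continuous_on (Fin ` UNIV) unFin"
    by (rule continuous_on_inverse_open_map[OF continuous_on_Fin])
       (auto simp: open_Fin openin_open_eq open_Fin image_mono)
  moreover have "S \<subseteq> Fin ` UNIV"
    using assms by (metis UNIV_I image_eqI sphere_minus_Infinity subsetI)
  ultimately show ?thesis by (rule continuous_on_subset)
qed

lemma Infinity_nbhd:
  assumes "open U" "Infinity \<in> U"
  obtains R where "R > 0" "\<And>z. cmod z \<ge> R \<Longrightarrow> Fin z \<in> U"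
proof -
  have "open (inf_chart 0 -` U)"
    using continuous_on_inf_chart[of UNIV] assms(1) by (rule open_vimage[rotated])
  moreover have "0 \<in> inf_chart 0 -` U" using assms by simp
  ultimately obtain e where e: "e > 0" "cball 0 e \<subseteq> inf_chart 0 -` U"
    by (meson open_contains_cball)
  show ?thesis
  proof
    show "1 / e > 0" using e by simp
    fix z :: complex assume z: "cmod z \<ge> 1 / e"
    then have "z \<noteq> 0" using e by (auto simp: field_simps)
    with z have "1 / z \<in> cball 0 e"
      using e by (simp add: norm_divide divide_le_eq mult.commute)
    then have "inf_chart 0 (1 / z) \<in> U" using e by auto
    then show "Fin z \<in> U" using \<open>z \<noteq> 0\<close> by (simp add: inf_chart_def)
  qed
qed

lemma open_Infinity_nbhd: "open (- (Fin ` cball b R))"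
  by (rule open_compl_Fin) auto

lemma continuous_on_sphere_map: "continuous_on S (sphere_map p)"
proof -
  have "isCont (sphere_map p) x" for x
  proof (cases "degree p = 0")
    case True
    then obtain c where "p = [:c:]" by (rule degree_eq_zeroE)
    moreover have "sphere_map [:c:] = (\<lambda>x. Fin c)"
    proof
      show "sphere_map [:c:] x = Fin c" for x by (cases x) auto
    qed
    ultimately show ?thesis by simp
  next
    case False
    show ?thesis
    proof (rule continuous_at_open[THEN iffD2], intro allI impI)
      fix U assume U: "open U \<and> sphere_map p x \<in> U"
      show "\<exists>V. open V \<and> x \<in> V \<and> (\<forall>x'\<in>V. sphere_map p x' \<in> U)"
      proof (cases x)
        case (Fin z)
        have "open (poly p -` (Fin -` U))"
          using U by (intro open_vimage open_vimage_Fin continuous_intros) auto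
        then show ?thesis
          using U Fin by (intro exI[of _ "Fin ` (poly p -` (Fin -` U))"]) (auto intro: open_Fin)
      next
        case Infinity
        then have "Infinity \<in> U" using U False by simp
        then obtain R where R: "\<And>z. cmod z \<ge> R \<Longrightarrow> Fin z \<in> U" using U Infinity_nbhd by metis
        obtain a q where "p = pCons a q" "q \<noteq> 0"
          using False by (cases p) (auto split: if_splits)
        then obtain S where S: "\<And>z. cmod z \<ge> S \<Longrightarrow> cmod (poly p z) \<ge> R"
          using poly_infinity[of q R a] by auto
        show ?thesis
        proof (intro exI[of _ "- (Fin ` cball 0 S)"] conjI ballI)
          fix x' assume "x' \<in> - (Fin ` cball 0 S)"
          then show "sphere_map p x' \<in> U"
            using R S \<open>Infinity \<in> U\<close> False by (cases x') (auto simp: image_iff not_le)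
        qed (auto simp: Infinity open_Infinity_nbhd)
      qed
    qed
  qed
  then show ?thesis by (simp add: continuous_at_imp_continuous_on)
qed

section \<open>Comparison of spherical and Euclidean balls\<close>

lemma Fin_ball_subset_ball:
  assumes "compact X" "\<delta> > 0"
  obtains \<epsilon> where "\<epsilon> > 0" "\<And>x y. x \<in> X \<Longrightarrow> dist x y < \<epsilon> \<Longrightarrow> dist (Fin x) (Fin y) < \<delta>"
proof -
  \<comment> \<open>The point \<open>y\<close> need not lie in \<open>X\<close>, so uniform
    continuity is used on the closed 1-neighbourhood of \<open>X\<close>.\<close>
  define Y where "Y = {x + y | x y. x \<in> X \<and> y \<in> cball 0 1}"
  have "compact Y"
    unfolding Y_def by (intro compact_sums assms compact_cball)
  then have "uniformly_continuous_on Y Fin"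
    by (intro compact_uniformly_continuous continuous_on_Fin)
  then obtain e where e: "e > 0" "\<And>x y. x \<in> Y \<Longrightarrow> y \<in> Y \<Longrightarrow> dist y x < e \<Longrightarrow> dist (Fin y) (Fin x) < \<delta>"
    using assms unfolding uniformly_continuous_on_def by blast
  show ?thesis
  proof (rule that[of "min e 1"])
    fix x y assume xy: "x \<in> X" "dist x y < min e 1"
    have "x = x + 0" "y = x + (y - x)" "y - x \<in> cball 0 1" "0 \<in> cball (0::complex) 1"
      using xy by (auto simp: dist_norm norm_minus_commute)
    then have "x \<in> Y" "y \<in> Y"
      unfolding Y_def using xy(1) by blast+
    with e xy show "dist (Fin x) (Fin y) < \<delta>" by (simp add: dist_commute)
  qed (use e in auto)
qed

text \<open>The radius is uniform over the compact set of centres: if it failed along centres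
  converging to \<open>l\<close>, the bad points would also converge to \<open>Fin l\<close> and so
  enter the open image of a small disc about \<open>l\<close>.\<close>

lemma ball_subset_Fin_ball:
  assumes "compact X" "\<epsilon> > 0"
  obtains \<delta> where "\<delta> > 0" "\<And>x. x \<in> X \<Longrightarrow> ball (Fin x) \<delta> \<subseteq> Fin ` ball x \<epsilon>"
proof (cases "X = {}")
  case True then show ?thesis using that[of 1] by auto
next
  case False
  have "\<exists>\<delta>>0. \<forall>x\<in>X. ball (Fin x) \<delta> \<subseteq> Fin ` ball x \<epsilon>"
  proof (rule ccontr)
    assume "\<not> ?thesis"
    then have "\<not> (\<forall>x\<in>X. ball (Fin x) (1 / Suc n) \<subseteq> Fin ` ball x \<epsilon>)" for n
      by (metis of_nat_0_less_iff zero_less_Suc zero_less_divide_1_iff)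
    then have "\<exists>x y. x \<in> X \<and> y \<in> ball (Fin x) (1 / Suc n) \<and> y \<notin> Fin ` ball x \<epsilon>" for n
      by blast
    then obtain x y where xy: "\<And>n. x n \<in> X" "\<And>n. dist (Fin (x n)) (y n) < 1 / Suc n" 
      "\<And>n. y n \<notin> Fin ` ball (x n) \<epsilon>"
      by (simp add: mem_ball) metis
    obtain l r where l: "l \<in> X" "strict_mono r" "(x \<circ> r) \<longlonglongrightarrow> l"
      using assms(1) xy(1) unfolding compact_def by metis
    have a1: "(\<lambda>n. Fin (x (r n))) \<longlonglongrightarrow> Fin l"
      using continuous_on_tendsto_compose[OF continuous_on_Fin[of UNIV] l(3)] by simp
    have a2: "(\<lambda>n. dist (Fin (x (r n))) (y (r n))) \<longlonglongrightarrow> 0"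
    proof (rule Lim_null_comparison)
      show "\<forall>\<^sub>F n in sequentially. norm (dist (Fin (x (r n))) (y (r n))) \<le> 1 / Suc (r n)"
        using xy(2) by (auto simp: less_imp_le intro!: always_eventually)
      show "(\<lambda>n. 1 / real (Suc (r n))) \<longlonglongrightarrow> 0"
        using LIMSEQ_subseq_LIMSEQ[OF LIMSEQ_inverse_real_of_nat l(2)] by (simp add: o_def inverse_eq_divide)
    qed
    from tendsto_add[OF tendsto_dist_iff[THEN iffD1, OF a1] a2]
    have lim: "(\<lambda>n. dist (Fin (x (r n))) (Fin l) + dist (Fin (x (r n))) (y (r n))) \<longlonglongrightarrow> 0"
      by simp
    have "\<forall>\<^sub>F n in sequentially. norm (dist (y (r n)) (Fin l))
        \<le> dist (Fin (x (r n))) (Fin l) + dist (Fin (x (r n))) (y (r n))"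
    proof (intro always_eventually allI)
      fix n
      show "norm (dist (y (r n)) (Fin l)) \<le> dist (Fin (x (r n))) (Fin l) + dist (Fin (x (r n))) (y (r n))"
        using dist_triangle3[of "y (r n)" "Fin l" "Fin (x (r n))"] by simp
    qed
    from Lim_null_comparison[OF this lim]
    have y: "(\<lambda>n. y (r n)) \<longlonglongrightarrow> Fin l"
      by (rule tendsto_dist_iff[THEN iffD2])
    have "open (Fin ` ball l (\<epsilon> / 2))" by (rule open_Fin) auto
    then have "\<forall>\<^sub>F n in sequentially. y (r n) \<in> Fin ` ball l (\<epsilon> / 2)"
      using y assms by (auto elim!: topological_tendstoD)
    moreover have "\<forall>\<^sub>F n in sequentially. dist (x (r n)) l < \<epsilon> / 2"
      using tendstoD[OF l(3), of "\<epsilon> / 2"] assms(2) by (simp only: o_def half_gt_zero)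
    ultimately have "\<forall>\<^sub>F n in sequentially. False"
    proof eventually_elim
      case (elim n)
      then obtain w where w: "y (r n) = Fin w" "dist l w < \<epsilon> / 2" by auto
      have "dist (x (r n)) w < \<epsilon>"
        using elim(2) w(2) dist_triangle[of "x (r n)" w l] by linarith
      then show ?case using xy(3)[of "r n"] w by auto
    qed
    then show False by simp
  qed
  then show ?thesis using that by blast
qed

section \<open>Normal families of polynomials\<close>

text \<open>In the coordinate \<open>w = 1 / (z - b)\<close> the function \<open>1 / (p - b)\<close>
  is \<open>w ^ degree p / inf_poly b p\<close>. Unless \<open>p\<close> is the constant
  \<open>b\<close>, the denominator is nonzero at 0, so the singularity at infinity is
  removed.\<close>

definition inf_poly :: "complex \<Rightarrow> complex poly \<Rightarrow> complex poly" where
  "inf_poly b p = reflect_poly ((p - [:b:]) \<circ>\<^sub>p [:b, 1:])"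

lemma degree_minus_const: "degree (p - [:b:]) = degree (p :: complex poly)"
proof (cases "degree p = 0")
  case True
  then obtain c where "p = [:c:]" by (rule degree_eq_zeroE)
  then show ?thesis by simp
next
  case False
  have "degree (p + [:- b:]) = degree p"
    by (rule degree_add_eq_left) (use False in auto)
  moreover have "p + [:- b:] = p - [:b:]" by simp
  ultimately show ?thesis by (simp only:)
qed

lemma poly_inf_poly:
  assumes "w \<noteq> 0"
  shows "poly (inf_poly b p) w = w ^ degree p * (poly p (b + 1 / w) - b)"
  using assms
  by (simp add: inf_poly_def poly_reflect_poly_nz poly_pcompose degree_pcompose degree_minus_const
      inverse_eq_divide)

lemma poly_inf_poly_0:
  assumes "p \<noteq> [:b:]" shows "poly (inf_poly b p) 0 \<noteq> 0"
proof -
  have "(p - [:b:]) \<circ>\<^sub>p [:b, 1:] \<noteq> 0"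
    using assms by (subst pcompose_eq_0_iff) auto
  then show ?thesis by (simp add: inf_poly_def)
qed

text \<open>The maximum principle on the complement of a disc, in the coordinate \<open>w = 1 / (z - b)\<close>.\<close>

lemma poly_exterior_lower_bound:
  assumes "\<rho> > 0" "c > 0" "k \<le> degree p"
    and ne: "\<And>z. cmod (z - b) \<ge> \<rho> \<Longrightarrow> poly p z \<noteq> b"
    and circ: "\<And>z. cmod (z - b) = \<rho> \<Longrightarrow> cmod (poly p z - b) \<ge> c"
    and z: "cmod (z - b) \<ge> \<rho>"
  shows "cmod (poly p z - b) \<ge> c * (cmod (z - b) / \<rho>) ^ k"
proof -
  define n where "n = degree p"
  define S where "S = inf_poly b p"
  \<comment> \<open>Off 0 this is \<open>(1 / w) ^ k / (p - b)\<close> taken at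
    \<open>b + 1 / w\<close>; \<open>k \<le> n\<close> makes it holomorphic across 0 as well, so
    only the circle of radius \<open>1 / \<rho>\<close> has to be estimated.\<close>
  define F where "F = (\<lambda>w. w ^ (n - k) / poly S w)"
  have "p \<noteq> [:b:]" using ne[of z] z by auto
  then have S0: "poly S 0 \<noteq> 0" by (simp add: S_def poly_inf_poly_0)
  have big: "cmod (b + 1 / w - b) \<ge> \<rho>" if "w \<noteq> 0" "cmod w \<le> 1 / \<rho>" for w
    using that assms(1) by (simp add: norm_divide field_simps)
  have Sn: "poly S w \<noteq> 0" if "cmod w \<le> 1 / \<rho>" for w
    using S0 ne[OF big] that by (cases "w = 0") (auto simp: S_def poly_inf_poly)
  have F: "cmod (F w) = cmod (1 / w) ^ k / cmod (poly p (b + 1 / w) - b)" if "w \<noteq> 0" for w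
  proof -
    have "w ^ n = w ^ (n - k) * w ^ k"
      using assms(3) by (simp add: n_def flip: power_add)
    then have "F w = (1 / w) ^ k / (poly p (b + 1 / w) - b)"
      using that by (simp add: F_def S_def poly_inf_poly flip: n_def) (simp add: field_simps)
    then show ?thesis by (simp add: norm_divide norm_power)
  qed
  have hol: "F holomorphic_on cball 0 (1 / \<rho>)"
    unfolding F_def using Sn by (intro holomorphic_intros) auto
  have "cmod (F w) \<le> \<rho> ^ k / c" if "w \<in> cball 0 (1 / \<rho>)" for w
  proof (rule maximum_modulus_frontier[of F "cball 0 (1 / \<rho>)"])
    show "F holomorphic_on interior (cball 0 (1 / \<rho>))"
      using hol by (rule holomorphic_on_subset) (rule interior_subset)
    show "continuous_on (closure (cball 0 (1 / \<rho>))) F"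
      using holomorphic_on_imp_continuous_on[OF hol] by simp
    fix v assume "v \<in> frontier (cball (0::complex) (1 / \<rho>))"
    then have v: "cmod v = 1 / \<rho>" using assms by (simp add: frontier_cball)
    then have "v \<noteq> 0" using assms by auto
    have "cmod (1 / v) = \<rho>" using v assms by (simp add: norm_divide)
    then have "cmod (poly p (b + 1 / v) - b) \<ge> c" by (intro circ) simp
    then show "cmod (F v) \<le> \<rho> ^ k / c"
      using F[OF \<open>v \<noteq> 0\<close>] \<open>cmod (1 / v) = \<rho>\<close> assms by (simp add: frac_le)
  qed (use that in auto)
  moreover have zb: "z \<noteq> b" using z assms(1) by auto
  moreover have "1 / (z - b) \<in> cball 0 (1 / \<rho>)"
    using z assms(1) by (simp add: norm_divide frac_le)
  moreover have "cmod (F (1 / (z - b))) = cmod (z - b) ^ k / cmod (poly p z - b)"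
    using F[of "1 / (z - b)"] zb by simp
  ultimately have "cmod (z - b) ^ k / cmod (poly p z - b) \<le> \<rho> ^ k / c"
    by metis
  moreover have "cmod (poly p z - b) > 0" using ne[OF z] by simp
  ultimately show ?thesis
    using assms(1,2) by (simp add: power_divide field_simps)
qed

text \<open>Montel's theorem read in a source coordinate \<open>e\<close> and a target coordinate
  \<open>\<Phi>\<close>, so that bounded families, families avoiding a disc and neighbourhoods of
  infinity are all instances. Compactness of \<open>C\<close> makes the inverse of \<open>e\<close>
  continuous, and the bound \<open>B\<close> makes \<open>\<Phi>\<close> uniformly continuous on all
  values involved.\<close>

lemma Montel_chart:
  fixes e \<Phi> :: "complex \<Rightarrow> riemann_sphere"
  assumes "open U" "U \<subseteq> C" "compact C" "continuous_on C e" "inj_on e C" "continuous_on UNIV \<Phi>"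
    and hol: "\<And>n. F n holomorphic_on U"
    and bd: "\<And>n w. w \<in> U \<Longrightarrow> cmod (F n w) \<le> B"
    and eq: "\<And>n w. w \<in> U \<Longrightarrow> sphere_map (s n) (e w) = \<Phi> (F n w)"
  obtains r f where "strict_mono (r :: nat \<Rightarrow> nat)"
    "\<And>K. compact K \<Longrightarrow> K \<subseteq> e ` U \<Longrightarrow> uniform_limit K (\<lambda>n. sphere_map (s (r n))) f sequentially"
proof -
  obtain g r where g: "strict_mono (r :: nat \<Rightarrow> nat)"
    "\<And>x. x \<in> U \<Longrightarrow> (\<lambda>n. F (r n) x) \<longlonglongrightarrow> g x"
    "\<And>K. compact K \<Longrightarrow> K \<subseteq> U \<Longrightarrow> uniform_limit K (F \<circ> r) g sequentially"
  proof (rule Montel[of U "range F" F])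
    show "\<exists>B. \<forall>h\<in>range F. \<forall>z\<in>K. cmod (h z) \<le> B" if "compact K" "K \<subseteq> U" for K
      using bd that by blast
  qed (use assms in auto)
  have gB: "cmod (g w) \<le> B" if "w \<in> U" for w
    using g(2)[OF that] by (rule Lim_norm_ubound[rotated]) (use bd that in auto)
  define e' where "e' = the_inv_into C e"
  have e': "e' (e w) = w" if "w \<in> C" for w
    using that assms(5) by (simp add: e'_def the_inv_into_f_f)
  have cont_e': "continuous_on (e ` C) e'"
    by (rule continuous_on_inv[OF assms(4,3)]) (use e' in auto)
  have uc: "uniformly_continuous_on (cball 0 B) \<Phi>"
    using assms(6) continuous_on_subset by (intro compact_uniformly_continuous) auto
  show ?thesis
  proof (rule that[OF g(1), of "\<lambda>x. \<Phi> (g (e' x))"])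
    fix K assume K: "compact K" "K \<subseteq> e ` U"
    have "compact (e' ` K)"
      using K assms(2) by (intro compact_continuous_image continuous_on_subset[OF cont_e']) auto
    moreover have sub: "e' ` K \<subseteq> U"
  proof
    fix y assume "y \<in> e' ` K"
    then obtain u where "u \<in> U" "y = e' (e u)" using K(2) by auto
    then show "y \<in> U" using e' assms(2) by auto
  qed
    ultimately have lim: "uniform_limit (e' ` K) (F \<circ> r) g sequentially" using g(3) by blast
    show "uniform_limit K (\<lambda>n. sphere_map (s (r n))) (\<lambda>x. \<Phi> (g (e' x))) sequentially"
    proof (rule uniform_limitI)
      fix \<epsilon> :: real assume "\<epsilon> > 0"
      then obtain \<delta> where \<delta>: "\<delta> > 0"
        "\<And>x y. x \<in> cball 0 B \<Longrightarrow> y \<in> cball 0 B \<Longrightarrow> dist y x < \<delta> \<Longrightarrow> dist (\<Phi> y) (\<Phi> x) < \<epsilon>"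
        using uc unfolding uniformly_continuous_on_def by blast
      have "\<forall>\<^sub>F n in sequentially. \<forall>w\<in>e' ` K. dist ((F \<circ> r) n w) (g w) < \<delta>"
        using lim \<delta>(1) by (rule uniform_limitD)
      then show "\<forall>\<^sub>F n in sequentially. \<forall>x\<in>K. dist (sphere_map (s (r n)) x) (\<Phi> (g (e' x))) < \<epsilon>"
      proof eventually_elim
        case (elim n)
        show ?case
        proof
          fix x assume x: "x \<in> K"
          then obtain w where w: "w \<in> U" "x = e w" using K(2) by auto
          then have ew: "e' x = w" using e' assms(2) by auto
          have "dist (F (r n) w) (g w) < \<delta>" using elim x ew by auto
          then have "dist (\<Phi> (F (r n) w)) (\<Phi> (g w)) < \<epsilon>"
            using \<delta>(2) gB bd w(1) by simp
          then show "dist (sphere_map (s (r n)) x) (\<Phi> (g (e' x))) < \<epsilon>"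
            using eq[OF w(1)] w(2) ew by simp
        qed
      qed
    qed
  qed
qed

text \<open>Any sequence has infinitely many members of one kind. For the first kind Montel applies
  to \<open>f - b\<close>, for the second to \<open>1 / (f - b)\<close>, which is bounded by
  \<open>1 / r\<close> and is read in the chart at infinity.\<close>

lemma normal_on_bounded_or_avoiding:
  assumes "open U" "bounded U" "r > 0"
    and G: "\<And>f. f \<in> G \<Longrightarrow> (\<forall>z\<in>U. cmod (poly f z - b) \<le> C) \<or> (\<forall>z\<in>U. r \<le> cmod (poly f z - b))"
  shows "normal_on G (Fin ` U)"
  unfolding normal_on_def
proof (intro allI impI)
  fix s :: "nat \<Rightarrow> complex poly" assume s: "range s \<subseteq> G"
  define A where "A = {n. \<forall>z\<in>U. cmod (poly (s n) z - b) \<le> C}"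
  have CU: "U \<subseteq> closure U" "compact (closure U)" "continuous_on (closure U) Fin" "inj_on Fin (closure U)"
    using assms(2) closure_subset by (auto simp: compact_closure continuous_on_Fin inj_Fin)
  have "infinite A \<or> infinite (- A)"
    using finite_Un[of A "- A"] by auto
  then obtain q F \<Phi> B where q: "strict_mono (q :: nat \<Rightarrow> nat)" and FB:
    "continuous_on UNIV \<Phi>" "\<And>n. F n holomorphic_on U" "\<And>n w. w \<in> U \<Longrightarrow> cmod (F n w) \<le> B"
    "\<And>n w. w \<in> U \<Longrightarrow> sphere_map (s (q n)) (Fin w) = \<Phi> (F n w)"
  proof
    assume "infinite A"
    then obtain q where q: "strict_mono (q :: nat \<Rightarrow> nat)" "\<And>n. q n \<in> A"
      using infinite_enumerate by blast
    show ?thesis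
    proof (rule that[OF q(1), of "\<lambda>w. Fin (w + b)" "\<lambda>n w. poly (s (q n)) w - b" C])
      show "continuous_on UNIV (\<lambda>w. Fin (w + b))"
        by (rule continuous_on_compose2[OF continuous_on_Fin[of UNIV]]) (auto intro!: continuous_intros)
      show "cmod (poly (s (q n)) w - b) \<le> C" if "w \<in> U" for n w
        using q(2)[of n] that by (auto simp: A_def)
    qed (auto intro!: holomorphic_intros)
  next
    assume "infinite (- A)"
    then obtain q where q: "strict_mono (q :: nat \<Rightarrow> nat)" "\<And>n. q n \<in> - A"
      using infinite_enumerate by blast
    have r: "r \<le> cmod (poly (s (q n)) w - b)" if "w \<in> U" for n w
      using G[of "s (q n)"] s q(2)[of n] that by (auto simp: A_def)
    have ne: "poly (s (q n)) w \<noteq> b" if "w \<in> U" for n w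
      using r[OF that, of n] assms(3) by auto
    show ?thesis
    proof (rule that[OF q(1), of "inf_chart b" "\<lambda>n w. 1 / (poly (s (q n)) w - b)" "1 / r"])
      show "cmod (1 / (poly (s (q n)) w - b)) \<le> 1 / r" if "w \<in> U" for n w
        using r[OF that] assms(3) by (simp add: norm_divide frac_le)
    qed (use ne in \<open>auto intro!: holomorphic_intros continuous_on_inf_chart\<close>)
  qed
  obtain r f where r: "strict_mono (r :: nat \<Rightarrow> nat)"
    "\<And>K. compact K \<Longrightarrow> K \<subseteq> Fin ` U \<Longrightarrow> uniform_limit K (\<lambda>n. sphere_map (s (q (r n)))) f sequentially"
    by (rule Montel_chart[where s="\<lambda>n. s (q n)" and F=F and B=B and \<Phi>=\<Phi>, OF assms(1) CU FB]) blast+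
  then show "\<exists>r f. strict_mono r \<and>
           (\<forall>K. compact K \<and> K \<subseteq> Fin ` U \<longrightarrow> uniform_limit K (\<lambda>n. sphere_map (s (r n))) f sequentially)"
    using strict_mono_o[OF q r(1)] by (intro exI[of _ "q \<circ> r"] exI[of _ f]) auto
qed

text \<open>Escape keeps \<open>1 / (f - b)\<close> at most \<open>1 / R\<close> in the chart at
  infinity. Positive degree means that infinity is fixed, so this function extends by 0 and the
  bound holds on the whole disc.\<close>

lemma normal_on_near_Infinity:
  assumes "R > 0" and deg: "\<And>f. f \<in> G \<Longrightarrow> degree f \<ge> 1"
    and G: "\<And>f z. f \<in> G \<Longrightarrow> cmod (z - b) \<ge> R \<Longrightarrow> cmod (poly f z - b) \<ge> cmod (z - b)"
  shows "normal_on G (- (Fin ` cball b R))"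
  unfolding normal_on_def
proof (intro allI impI)
  fix s :: "nat \<Rightarrow> complex poly" assume s: "range s \<subseteq> G"
  define U where "U = ball (0::complex) (1 / R)"
  define S where "S = (\<lambda>n. inf_poly b (s n))"
  define F where "F = (\<lambda>n w. w ^ degree (s n) / poly (S n) w)"
  have deg': "degree (s n) > 0" for n using deg[of "s n"] s by (auto simp: Suc_le_eq)
  have big: "cmod (poly (s n) (b + 1 / w) - b) \<ge> R" if "w \<in> U" "w \<noteq> 0" for n w
  proof -
    have "R \<le> cmod (b + 1 / w - b)"
      using that assms(1) by (simp add: U_def norm_divide field_simps)
    also have "\<dots> \<le> cmod (poly (s n) (b + 1 / w) - b)"
      using s by (intro G) (use calculation in auto)
    finally show ?thesis .
  qed
  have Sn: "poly (S n) w \<noteq> 0" if "w \<in> U" for n w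
  proof (cases "w = 0")
    case True
    then show ?thesis using deg'[of n] by (auto simp: S_def intro!: poly_inf_poly_0)
  next
    case False
    then have "poly (s n) (b + 1 / w) \<noteq> b" using big[OF that False, of n] assms(1) by force
    then show ?thesis using False by (simp add: S_def poly_inf_poly)
  qed
  have F: "F n w = 1 / (poly (s n) (b + 1 / w) - b)" if "w \<noteq> 0" for n w
    using that by (simp add: F_def S_def poly_inf_poly)
  obtain r f where r: "strict_mono (r :: nat \<Rightarrow> nat)"
    "\<And>K. compact K \<Longrightarrow> K \<subseteq> inf_chart b ` U \<Longrightarrow> uniform_limit K (\<lambda>n. sphere_map (s (r n))) f sequentially"
  proof (rule Montel_chart[of U "cball 0 (1 / R)" "inf_chart b" "inf_chart b" F "1 / R" s])
    show "F n holomorphic_on U" for n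
      unfolding F_def using Sn by (intro holomorphic_intros) auto
    show "cmod (F n w) \<le> 1 / R" if "w \<in> U" for n w
    proof (cases "w = 0")
      case True then show ?thesis using deg'[of n] assms(1) by (simp add: F_def zero_power)
    next
      case False then show ?thesis
        using F[OF False] big[OF that False] assms(1) by (simp add: norm_divide frac_le)
    qed
    show "sphere_map (s n) (inf_chart b w) = inf_chart b (F n w)" if "w \<in> U" for n w
    proof (cases "w = 0")
      case True then show ?thesis using deg'[of n] by (simp add: F_def zero_power)
    next
      case False
      then have "poly (s n) (b + 1 / w) \<noteq> b" using big[OF that False, of n] assms(1) by force
      then show ?thesis using F[OF False] False by (simp add: inf_chart_def)
    qed
  qed (auto simp: U_def continuous_on_inf_chart intro: inj_on_subset[OF inj_inf_chart])
  have "inf_chart b ` U = - (Fin ` cball b R)"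
    using inf_chart_image(2)[OF assms(1)] by (simp add: U_def)
  with r show "\<exists>r f. strict_mono r \<and> (\<forall>K. compact K \<and> K \<subseteq> - (Fin ` cball b R) \<longrightarrow>
      uniform_limit K (\<lambda>n. sphere_map (s (r n))) f sequentially)"
    by (metis (no_types))
qed

section \<open>Fatou and Julia sets\<close>

lemma normal_on_subset: "normal_on G U \<Longrightarrow> F \<subseteq> G \<Longrightarrow> V \<subseteq> U \<Longrightarrow> normal_on F V"
  unfolding normal_on_def by (meson order_trans)

lemma julia_set_mono: "F \<subseteq> G \<Longrightarrow> julia_set F \<subseteq> julia_set G"
  unfolding julia_set_def fatou_set_def using normal_on_subset by blast

lemma open_fatou_set: "open (fatou_set G)"
  unfolding fatou_set_def open_subopen[of "Collect _"] by blast

lemma closed_julia_set: "closed (julia_set G)"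
  by (simp add: julia_set_def open_fatou_set closed_Compl)

lemma Fin_in_fatou_set:
  assumes "open U" "z \<in> U" "r > 0"
    and "\<And>f. f \<in> G \<Longrightarrow> (\<forall>z\<in>U. cmod (poly f z - b) \<le> C) \<or> (\<forall>z\<in>U. r \<le> cmod (poly f z - b))"
  shows "Fin z \<in> fatou_set G"
proof -
  have "normal_on G (Fin ` (U \<inter> ball z 1))"
    by (rule normal_on_bounded_or_avoiding[of _ r _ b C])
       (use assms(1,3) in \<open>auto simp: bounded_Int\<close>, use assms(4) in blast)
  moreover have "open (Fin ` (U \<inter> ball z 1))" using assms by (intro open_Fin) auto
  ultimately show ?thesis using assms(2) by (auto simp: fatou_set_def)
qed

lemma exterior_in_fatou_set:
  assumes "R > 0" "\<And>f. f \<in> G \<Longrightarrow> degree f \<ge> 1"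
    and "\<And>f z. f \<in> G \<Longrightarrow> cmod (z - b) \<ge> R \<Longrightarrow> cmod (poly f z - b) \<ge> cmod (z - b)"
  shows "- (Fin ` cball b R) \<subseteq> fatou_set G"
  using normal_on_near_Infinity[OF assms] open_Infinity_nbhd[of b R] by (auto simp: fatou_set_def)

text \<open>A failing sequence of maps, with points tending to \<open>z\<close>, has a subsequence
  converging uniformly near \<open>z\<close>. Its limit is continuous, and three estimates of size
  \<epsilon> / 3 give the contradiction.\<close>

lemma fatou_equicontinuous:
  assumes z: "Fin z \<in> fatou_set G" and "\<epsilon> > 0"
  shows "\<exists>\<delta>>0. \<forall>f\<in>G. \<forall>w\<in>ball z \<delta>. dist (Fin (poly f w)) (Fin (poly f z)) < \<epsilon>"
proof (rule ccontr)
  assume neg: "\<not> ?thesis"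
  have "\<exists>f w. f \<in> G \<and> w \<in> ball z (inverse (Suc n)) \<and> \<not> dist (Fin (poly f w)) (Fin (poly f z)) < \<epsilon>" for n
  proof -
    have "inverse (real (Suc n)) > 0" by simp
    with neg show ?thesis by blast
  qed
  then obtain s w where sw: "\<And>n. s n \<in> G" "\<And>n. dist z (w n) < inverse (real (Suc n))"
    "\<And>n. \<not> dist (Fin (poly (s n) (w n))) (Fin (poly (s n) z)) < \<epsilon>"
    unfolding mem_ball by metis
  obtain U where U: "open U" "Fin z \<in> U" "normal_on G U" using z by (auto simp: fatou_set_def)
  have "open (Fin -` U)" "z \<in> Fin -` U" using U open_vimage_Fin by auto
  then obtain \<rho> where \<rho>: "\<rho> > 0" "cball z \<rho> \<subseteq> Fin -` U" by (meson open_contains_cball)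
  define K where "K = Fin ` cball z \<rho>"
  have K: "compact K" "K \<subseteq> U" using \<rho> by (auto simp: K_def compact_Fin)
  obtain r f where r: "strict_mono (r :: nat \<Rightarrow> nat)"
    "uniform_limit K (\<lambda>n. sphere_map (s (r n))) f sequentially"
    using U(3) K sw(1) unfolding normal_on_def by blast
  have "continuous_on K f"
    by (rule uniform_limit_theorem[OF _ r(2)])
       (auto intro!: always_eventually continuous_on_sphere_map)
  then have "continuous_on (cball z \<rho>) (f \<circ> Fin)"
    unfolding K_def by (intro continuous_on_compose continuous_on_Fin)
  then have contz: "continuous (at z within cball z \<rho>) (\<lambda>x. f (Fin x))"
    using \<rho>(1) by (auto simp: continuous_on_eq_continuous_within o_def)
  have wz: "w \<longlonglongrightarrow> z"
  proof (rule tendsto_dist_iff[THEN iffD2], rule Lim_null_comparison[OF _ LIMSEQ_inverse_real_of_nat])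
    show "\<forall>\<^sub>F n in sequentially. norm (dist (w n) z) \<le> inverse (real (Suc n))"
      using sw(2) by (intro always_eventually) (simp add: dist_commute less_imp_le)
  qed
  then have wr: "(\<lambda>n. w (r n)) \<longlonglongrightarrow> z" using LIMSEQ_subseq_LIMSEQ[OF _ r(1)] by (auto simp: o_def)
  have evb: "\<forall>\<^sub>F n in sequentially. w (r n) \<in> cball z \<rho>"
    using tendstoD[OF wr \<rho>(1)] by eventually_elim (simp add: dist_commute)
  have "(\<lambda>n. f (Fin (w (r n)))) \<longlonglongrightarrow> f (Fin z)"
    by (rule continuous_within_tendsto_compose[OF contz evb wr])
  then have "\<forall>\<^sub>F n in sequentially. dist (f (Fin (w (r n)))) (f (Fin z)) < \<epsilon> / 3"
    by (rule tendstoD) (use assms in auto)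
  moreover have "\<forall>\<^sub>F n in sequentially. \<forall>x\<in>K. dist (sphere_map (s (r n)) x) (f x) < \<epsilon> / 3"
    using r(2) by (rule uniform_limitD) (use assms in auto)
  ultimately have "\<forall>\<^sub>F n in sequentially. False"
    using evb
  proof eventually_elim
    case (elim n)
    have 1: "dist (Fin (poly (s (r n)) (w (r n)))) (f (Fin (w (r n)))) < \<epsilon> / 3"
      using elim(2,3) unfolding K_def by (metis imageI sphere_map.simps(1))
    have 2: "dist (Fin (poly (s (r n)) z)) (f (Fin z)) < \<epsilon> / 3"
      using elim(2) \<rho>(1) unfolding K_def by (metis centre_in_cball imageI less_imp_le sphere_map.simps(1))
    have "dist (Fin (poly (s (r n)) (w (r n)))) (Fin (poly (s (r n)) z)) < \<epsilon>"
      using 1 2 elim(1)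
        dist_triangle[of "Fin (poly (s (r n)) (w (r n)))" "Fin (poly (s (r n)) z)" "f (Fin (w (r n)))"]
        dist_triangle[of "f (Fin (w (r n)))" "Fin (poly (s (r n)) z)" "f (Fin z)"]
        dist_commute[of "f (Fin z)" "Fin (poly (s (r n)) z)"]
      by linarith
    with sw(3) show ?case by blast
  qed
  then show False by simp
qed

text \<open>Equicontinuity passes the bound on the orbit of \<open>z\<close> to nearby points. The
  orbit lies in a fixed compact disc, over which spherical closeness implies Euclidean
  closeness.\<close>

lemma K_hat_inter_fatou_set:
  assumes "z \<in> K_hat G" "Fin z \<in> fatou_set G"
  shows "z \<in> interior (K_hat G)"
proof -
  obtain C where C: "\<And>f. f \<in> G \<Longrightarrow> cmod (poly f z) \<le> C"
    using assms(1) by (auto simp: K_hat_def bounded_iff)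
  obtain \<epsilon> where \<epsilon>: "\<epsilon> > 0" "\<And>x. x \<in> cball 0 C \<Longrightarrow> ball (Fin x) \<epsilon> \<subseteq> Fin ` ball x 1"
    using ball_subset_Fin_ball[of "cball 0 C" 1] by auto
  obtain \<delta> where \<delta>: "\<delta> > 0" "\<And>f w. f \<in> G \<Longrightarrow> w \<in> ball z \<delta> \<Longrightarrow> dist (Fin (poly f w)) (Fin (poly f z)) < \<epsilon>"
    using fatou_equicontinuous[OF assms(2) \<epsilon>(1)] by blast
  have "ball z \<delta> \<subseteq> K_hat G"
  proof
    fix w assume w: "w \<in> ball z \<delta>"
    have "cmod (poly f w) \<le> C + 1" if f: "f \<in> G" for f
    proof -
      have "Fin (poly f w) \<in> ball (Fin (poly f z)) \<epsilon>"
        using \<delta>(2)[OF f w] by (simp add: dist_commute)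
      then have "poly f w \<in> ball (poly f z) 1" using \<epsilon>(2)[of "poly f z"] C[OF f] by auto
      then have "cmod (poly f w - poly f z) < 1" by (simp add: dist_norm norm_minus_commute)
      then show ?thesis using C[OF f] norm_triangle_sub[of "poly f w" "poly f z"] by linarith
    qed
    then show "w \<in> K_hat G" by (auto simp: K_hat_def bounded_iff)
  qed
  then show ?thesis using \<delta>(1) by (meson centre_in_ball interior_maximal open_ball subsetD)
qed

section \<open>Polynomials as covering maps\<close>

definition crit_vals :: "complex poly \<Rightarrow> complex set" where
  "crit_vals p = {poly p z | z. poly (pderiv p) z = 0}"

lemma continuous_on_poly' [continuous_intros]: "continuous_on S (poly (p :: complex poly))"
  by (intro continuous_intros)

lemma holomorphic_on_poly: "poly p holomorphic_on S"
  by (intro holomorphic_intros)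

lemma poly_large:
  assumes "degree (p :: complex poly) \<ge> 1"
  obtains r where "\<And>z. cmod z \<ge> r \<Longrightarrow> cmod (poly p z) \<ge> B"
proof -
  obtain a q where "p = pCons a q" "q \<noteq> 0"
    using assms by (cases p) (auto split: if_splits)
  then show ?thesis using poly_infinity[of q B a] that by auto
qed

lemma bounded_poly_vimage:
  assumes "degree p \<ge> 1" "bounded S"
  shows "bounded (poly p -` S :: complex set)"
proof -
  obtain B where B: "\<And>x. x \<in> S \<Longrightarrow> cmod x \<le> B" using assms(2) by (auto simp: bounded_iff)
  obtain r where r: "\<And>z. cmod z \<ge> r \<Longrightarrow> cmod (poly p z) \<ge> B + 1"
    using poly_large[OF assms(1)] by metis
  have "cmod z \<le> r" if "z \<in> poly p -` S" for z
    using r[of z] B[of "poly p z"] that by force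
  then show ?thesis by (auto simp: bounded_iff)
qed

lemma closed_poly_vimage: "closed S \<Longrightarrow> closed (poly p -` S :: complex set)"
  by (intro continuous_closed_vimage) auto

lemma open_poly_vimage: "open S \<Longrightarrow> open (poly p -` S :: complex set)"
  by (intro open_vimage continuous_on_poly')

lemma compact_poly_vimage:
  "degree p \<ge> 1 \<Longrightarrow> compact S \<Longrightarrow> compact (poly p -` S :: complex set)"
  by (simp add: bounded_poly_vimage closed_poly_vimage compact_eq_bounded_closed)

lemma poly_surj:
  assumes "degree (p :: complex poly) \<ge> 1" shows "\<exists>z. poly p z = w"
proof -
  have "\<not> constant (poly (p - [:w:]))"
    using assms by (simp add: constant_degree degree_minus_const)
  then obtain z where "poly (p - [:w:]) z = 0" using fundamental_theorem_of_algebra by blast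
  then show ?thesis by auto
qed

lemma finite_poly_fibre:
  assumes "degree (p :: complex poly) \<ge> 1" shows "finite {z. poly p z = w}"
proof -
  have "p - [:w:] \<noteq> 0" using assms by (metis degree_minus_const degree_0 not_one_le_zero)
  then have "finite {z. poly (p - [:w:]) z = 0}" by (rule poly_roots_finite)
  then show ?thesis by simp
qed

text \<open>Over a value that is not critical, \<open>p\<close> is injective near each of the
  finitely many preimages; being proper, it has no further sheets over a small
  neighbourhood.\<close>

lemma covering_space_poly:
  assumes deg: "degree p \<ge> 1" and "open T" and crit: "T \<inter> crit_vals p = {}"
  shows "covering_space (poly p -` T) (poly p) T"
proof (rule covering_spaceI)
  show "poly p ` (poly p -` T) = T" using poly_surj[OF deg] by (metis surj_image_vimage_eq surjI)
  fix y assume y: "y \<in> T"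
  define Z where "Z = {z. poly p z = y}"
  have fin: "finite Z" unfolding Z_def by (rule finite_poly_fibre[OF deg])
  have "\<exists>r>0. inj_on (poly p) (ball x r)" if "x \<in> Z" for x
  proof -
    have "poly (pderiv p) x \<noteq> 0" using that y crit by (auto simp: Z_def crit_vals_def)
    moreover have "deriv (poly p) x = poly (pderiv p) x" by (rule DERIV_imp_deriv[OF poly_DERIV])
    ultimately have "deriv (poly p) x \<noteq> 0" by simp
    then show ?thesis
      using has_complex_derivative_locally_injective[OF holomorphic_on_poly, of x UNIV p] by auto
  qed
  then obtain r where r: "\<And>x. x \<in> Z \<Longrightarrow> r x > 0" "\<And>x. x \<in> Z \<Longrightarrow> inj_on (poly p) (ball x (r x))"
    by metis
  have "\<forall>x\<in>Z. \<exists>d>0. \<forall>x'\<in>Z. x' \<noteq> x \<longrightarrow> d \<le> dist x x'"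
    using finite_set_avoid[OF fin] by blast
  then obtain d where d: "\<And>x. x \<in> Z \<Longrightarrow> d x > 0" "\<And>x x'. x \<in> Z \<Longrightarrow> x' \<in> Z \<Longrightarrow> x' \<noteq> x \<Longrightarrow> d x \<le> dist x x'"
    by metis
  define B where "B = (\<lambda>x. ball x (min (r x) (d x / 2)))"
  have inB: "x \<in> B x" if "x \<in> Z" for x using r d that by (simp add: B_def)
  have injB: "inj_on (poly p) (B x)" if "x \<in> Z" for x
    using r(2)[OF that] by (rule inj_on_subset) (auto simp: B_def)
  have disj: "B x \<inter> B x' = {}" if "x \<in> Z" "x' \<in> Z" "x \<noteq> x'" for x x'
  proof (rule ccontr)
    assume "B x \<inter> B x' \<noteq> {}"
    then obtain w where w: "dist x w < d x / 2" "dist x' w < d x' / 2" by (auto simp: B_def)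
    have "dist x x' < d x / 2 + d x' / 2"
      using w dist_triangle[of x x' w] dist_commute[of x' w] by linarith
    moreover have "d x \<le> dist x x'" "d x' \<le> dist x x'"
      using d(2) that by (metis dist_commute)+
    ultimately show False by linarith
  qed
  \<comment> \<open>What lies over the disc but outside the balls \<open>B x\<close> has compact
    image missing \<open>y\<close>; deleting this image from the neighbourhood leaves only the
    sheets in the balls.\<close>
  define C where "C = poly p -` cball y 1 - (\<Union>x\<in>Z. B x)"
  have "open (B x)" for x by (simp add: B_def)
  then have "compact (poly p ` C)"
    unfolding C_def
    by (intro compact_continuous_image continuous_on_poly' compact_diff compact_poly_vimage deg
        compact_cball open_UN) auto
  then have clC: "closed (poly p ` C)" by (rule compact_imp_closed)
  have yC: "y \<notin> poly p ` C" using inB by (auto simp: C_def Z_def)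
  define V where "V = (T \<inter> ball y 1 - poly p ` C) \<inter> (\<Inter>x\<in>Z. poly p ` B x)"
  have openpB: "open (poly p ` B x)" if "x \<in> Z" for x
    by (rule open_mapping_thm3[OF holomorphic_on_poly]) (use injB that in \<open>auto simp: B_def\<close>)
  then have V: "open V" "y \<in> V" "V \<subseteq> T"
    using fin clC yC y inB \<open>open T\<close>
    by (auto simp: V_def Z_def intro!: open_Int open_Diff open_INT)
  have sub: "poly p -` V \<subseteq> (\<Union>x\<in>Z. B x)"
  proof
    fix z assume z: "z \<in> poly p -` V"
    show "z \<in> (\<Union>x\<in>Z. B x)"
    proof (rule ccontr)
      assume "z \<notin> (\<Union>x\<in>Z. B x)"
      then have "z \<in> C" using z by (auto simp: C_def V_def)
      then show False using z by (auto simp: V_def)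
    qed
  qed
  define v where "v = (\<lambda>x. B x \<inter> poly p -` V) ` Z"
  show "\<exists>V. y \<in> V \<and> openin (top_of_set T) V \<and>
       (\<exists>v. \<Union>v = poly p -` T \<inter> poly p -` V \<and> (\<forall>u\<in>v. openin (top_of_set (poly p -` T)) u) \<and>
          pairwise disjnt v \<and> (\<forall>u\<in>v. \<exists>q. homeomorphism u V (poly p) q))"
  proof (intro exI[of _ V] exI[of _ v] conjI ballI)
    show "openin (top_of_set T) V" using V \<open>open T\<close> by (simp add: openin_open_eq)
    show "\<Union> v = poly p -` T \<inter> poly p -` V" using sub V by (auto simp: v_def)
    show "pairwise disjnt v"
      using disj unfolding v_def pairwise_def disjnt_def by blast
    fix u assume "u \<in> v"
    then obtain x where x: "x \<in> Z" and u: "u = B x \<inter> poly p -` V" by (auto simp: v_def)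
    have openu: "open u" unfolding u using V(1) by (intro open_Int open_poly_vimage) (auto simp: B_def)
    moreover have "u \<subseteq> poly p -` T" using V(3) u by auto
    ultimately show "openin (top_of_set (poly p -` T)) u"
      using open_subset by blast
    have "poly p ` u = poly p ` B x \<inter> V" unfolding u by auto
    also have "\<dots> = V" using x by (auto simp: V_def)
    finally have "poly p ` u = V" .
    moreover have "inj_on (poly p) u" using injB[OF x] u inj_on_subset by blast
    ultimately show "\<exists>q. homeomorphism u V (poly p) q"
      using invariance_of_domain_homeomorphism[OF openu continuous_on_poly', of p] by auto
  qed (use V in auto)
qed (rule continuous_on_poly')

text \<open>The covering has a section \<open>g\<close> over \<open>U\<close> with
  \<open>g (poly p a) = a\<close>. On the connected \<open>W\<close> both
  \<open>g \<circ> poly p\<close> and the identity lift \<open>p\<close>, and they agree at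
  \<open>a\<close>; evaluation at \<open>z\<close> gives \<open>z = a\<close>.\<close>

lemma inj_on_over_simply_connected:
  assumes deg: "degree p \<ge> 1" and U: "open U" "simply_connected U" "U \<inter> crit_vals p = {}"
    and W: "connected W" "W \<subseteq> poly p -` U"
  shows "inj_on (poly p) W"
proof (rule inj_onI)
  fix a z assume az: "a \<in> W" "z \<in> W" "poly p a = poly p z"
  note cov = covering_space_poly[OF deg U(1,3)]
  obtain g where g: "continuous_on U g" "g \<in> U \<rightarrow> poly p -` U" "g (poly p a) = a"
    "\<And>y. y \<in> U \<Longrightarrow> poly p (g y) = y"
  proof (rule covering_space_lift_general[OF cov, of a "poly p a" U "\<lambda>x. x"])
    \<comment> \<open>Loops in \<open>U\<close> are null-homotopic, so each is homotopic to the
      image of the constant path at \<open>a\<close>, as the lifting criterion requires.\<close>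
    fix r :: "real \<Rightarrow> complex"
    assume r: "path r" "path_image r \<subseteq> U" "pathstart r = poly p a" "pathfinish r = poly p a"
    then have "homotopic_paths U r (linepath (poly p a) (poly p a))"
      using U(2) unfolding simply_connected_eq_contractible_path by metis
    moreover have "poly p \<circ> linepath a a = linepath (poly p a) (poly p a)"
      by (auto simp: linepath_def fun_eq_iff algebra_simps simp flip: scaleR_add_left)
    moreover have "(\<lambda>x. x) \<circ> r = r" by auto
    ultimately show "\<exists>q. path q \<and> path_image q \<subseteq> poly p -` U \<and> pathstart q = a \<and> pathfinish q = a \<and>
        homotopic_paths U ((\<lambda>x. x) \<circ> r) (poly p \<circ> q)"
      using az W(2) by (intro exI[of _ "linepath a a"]) auto
  qed (use az W U in \<open>auto simp: simply_connected_imp_path_connected open_imp_locally_path_connected\<close>)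
  have "(g \<circ> poly p) z = (\<lambda>x. x) z"
  proof (rule covering_space_lift_unique[OF cov, where T = W and a = a and f = "poly p"])
    show "continuous_on W (g \<circ> poly p)"
      using W(2) by (intro continuous_on_compose continuous_on_poly' continuous_on_subset[OF g(1)]) auto
    show "g \<circ> poly p \<in> W \<rightarrow> poly p -` U" using g(2) W(2) by (auto simp: Pi_iff)
  qed (use g W az in \<open>auto intro: continuous_on_poly'\<close>)
  then show "a = z" using g(3) az(3) by simp
qed

section \<open>Preimages of discs and the maximum principle\<close>

lemma max_modulus_poly_diff:
  assumes "bounded D" "\<And>z. z \<in> frontier D \<Longrightarrow> cmod (poly p z - c) \<le> B" "z \<in> D"
  shows "cmod (poly p z - c) \<le> B"
  by (rule maximum_modulus_frontier[of "\<lambda>z. poly p z - c" D])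
     (use assms in \<open>auto intro!: holomorphic_intros continuous_intros\<close>)

text \<open>A bounded component of the complement would have \<open>|p - c| \<le> R\<close> on its
  frontier and hence inside it. A set with bounded complement has only one unbounded
  component.\<close>

lemma connected_compl_vimage_cball:
  assumes deg: "degree (p :: complex poly) \<ge> 1"
  shows "connected (- (poly p -` cball c R))"
proof -
  define E where "E = - (poly p -` cball c R)"
  have bd: "bounded (- E)" unfolding E_def using bounded_poly_vimage[OF deg] by simp
  have "open E" unfolding E_def using closed_poly_vimage by blast
  have unb: "\<not> bounded D" if D: "D \<in> components E" for D
  proof
    assume "bounded D"
    obtain z where z: "z \<in> D" using D in_components_nonempty by blast
    have "cmod (poly p z - c) \<le> R"
    proof (rule max_modulus_poly_diff[OF \<open>bounded D\<close> _ z])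
      fix w assume "w \<in> frontier D"
      then have "w \<notin> E"
        using frontier_of_components_subset[OF D] D \<open>open E\<close>
        by (metis Diff_iff frontier_def interior_open subsetD)
      then show "cmod (poly p w - c) \<le> R" by (auto simp: E_def dist_norm norm_minus_commute)
    qed
    moreover have "z \<in> E" using z D in_components_subset by blast
    ultimately show False by (auto simp: E_def dist_norm norm_minus_commute)
  qed
  have "connected E"
    unfolding connected_iff_eq_connected_component_set
  proof
    fix x assume x: "x \<in> E"
    have "y \<in> connected_component_set E x" if y: "y \<in> E" for y
    proof -
      have "connected_component_set E x = connected_component_set E y"
        using cobounded_unique_unbounded_components[OF bd, of "connected_component_set E x" "connected_component_set E y"]
          unb x y by (auto simp: components_def)
      then show ?thesis using y by auto
    qed
    then show "connected_component_set E x = E" using connected_component_subset by blast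
  qed
  then show ?thesis by (simp add: E_def)
qed

text \<open>Lifting \<open>exp\<close> through the covering \<open>p\<close> parametrises the level set by a vertical line.\<close>

lemma connected_level_set:
  assumes deg: "degree p \<ge> 1" and R: "R > 0" and crit: "crit_vals p \<subseteq> cball c R" and s: "s > R"
  shows "connected {z. cmod (poly p z - c) = s}"
proof -
  define T where "T = - cball c R"
  define E where "E = poly p -` T"
  define H where "H = {u :: complex. Re u > ln R}"
  have "open T" by (simp add: T_def open_Compl)
  have cov: "covering_space E (poly p) T"
    unfolding E_def by (rule covering_space_poly[OF deg]) (use crit in \<open>auto simp: T_def\<close>)
  have convH: "convex H" unfolding H_def by (rule convex_halfspace_Re_gt)
  have lnR: "ln R < t \<longleftrightarrow> R < exp t" for t
    using R by (metis exp_less_cancel_iff exp_ln)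
  have expH: "c + exp u \<in> T" if "u \<in> H" for u
    using that R by (simp add: T_def H_def dist_norm lnR)
  obtain \<phi> where \<phi>: "continuous_on H \<phi>" "\<phi> \<in> H \<rightarrow> E" "\<And>u. u \<in> H \<Longrightarrow> poly p (\<phi> u) = c + exp u"
  proof (rule covering_space_lift[OF cov, of H "\<lambda>u. c + exp u"])
    show "simply_connected H" "locally path_connected H"
      using convH by (auto simp: convex_imp_simply_connected convex_imp_locally_path_connected)
  qed (use expH in \<open>auto intro!: continuous_intros\<close>)
  have "connected E"
    using connected_compl_vimage_cball[OF deg, of c R] by (simp add: E_def T_def vimage_Compl)
  then have pcE: "path_connected E"
    using open_poly_vimage[OF \<open>open T\<close>] by (simp add: E_def connected_open_path_connected)
  define L where "L = {u :: complex. Re u = ln s}"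
  have LH: "L \<subseteq> H" using R s by (auto simp: L_def H_def)
  have "{z. cmod (poly p z - c) = s} = \<phi> ` L"
  proof
    show "\<phi> ` L \<subseteq> {z. cmod (poly p z - c) = s}"
    proof clarsimp
      fix u assume u: "u \<in> L"
      then have "poly p (\<phi> u) - c = exp u" using \<phi>(3) LH by auto
      then show "cmod (poly p (\<phi> u) - c) = s" using u R s by (simp add: L_def)
    qed
    show "{z. cmod (poly p z - c) = s} \<subseteq> \<phi> ` L"
    proof
      fix z assume "z \<in> {z. cmod (poly p z - c) = s}"
      then have z: "cmod (poly p z - c) = s" by simp
      then have zE: "z \<in> E" using s by (auto simp: E_def T_def dist_norm norm_minus_commute)
      define u0 where "u0 = complex_of_real (ln s)"
      have u0: "u0 \<in> H" using LH by (auto simp: u0_def L_def)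
      then have "\<phi> u0 \<in> E" using \<phi>(2) by auto
      then obtain \<gamma> where \<gamma>: "path \<gamma>" "path_image \<gamma> \<subseteq> E" "pathstart \<gamma> = \<phi> u0" "pathfinish \<gamma> = z"
        using pcE zE unfolding path_connected_def by blast
      have cont\<gamma>: "continuous_on {0..1} \<gamma>" using \<gamma>(1) by (simp add: path_def)
      have \<gamma>E: "\<gamma> t \<in> E" if "t \<in> {0..1}" for t using \<gamma>(2) that by (auto simp: path_image_def)
      have big: "cmod (poly p (\<gamma> t) - c) > R" if "t \<in> {0..1}" for t
        using \<gamma>E[OF that] by (auto simp: E_def T_def dist_norm norm_minus_commute)
      have "continuous_on (cbox 0 1) (\<lambda>t. poly p (\<gamma> t) - c)"
        using cont\<gamma> by (auto intro!: continuous_intros)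
      moreover have "poly p (\<gamma> t) - c \<noteq> 0" if "t \<in> cbox 0 1" for t
        using big[of t] that R by auto
      ultimately obtain g where g: "continuous_on (cbox 0 1) g"
          "\<And>t. t \<in> cbox 0 (1::real) \<Longrightarrow> poly p (\<gamma> t) - c = exp (g t)"
        using continuous_logarithm_on_simply_connected[of "cbox 0 1" "\<lambda>t. poly p (\<gamma> t) - c"]
        by (metis convex_box(1) convex_imp_simply_connected convex_imp_locally_path_connected)
      \<comment> \<open>The logarithm along \<open>\<gamma>\<close> is shifted by a period of
        \<open>exp\<close> so as to start at \<open>u0\<close>; then
        \<open>\<phi> \<circ> \<eta>\<close> and \<open>\<gamma>\<close> lift the same path from the
        same point and must end at the same point.\<close>
      define \<eta> where "\<eta> = (\<lambda>t. g t + (u0 - g 0))"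
      have "exp (g 0) = exp u0"
        using g(2)[of 0] \<gamma>(3) \<phi>(3)[OF u0] by (simp add: pathstart_def)
      then have exp\<eta>: "c + exp (\<eta> t) = poly p (\<gamma> t)" if "t \<in> {0..1}" for t
      proof -
        have "exp (\<eta> t) = poly p (\<gamma> t) - c"
          using g(2)[of t] that \<open>exp (g 0) = exp u0\<close> by (simp add: \<eta>_def exp_add exp_diff)
        then show ?thesis by simp
      qed
      have Re\<eta>: "exp (Re (\<eta> t)) = cmod (poly p (\<gamma> t) - c)" if "t \<in> {0..1}" for t
        using exp\<eta>[OF that] by (metis add_diff_cancel_left' norm_exp_eq_Re)
      have \<eta>H: "\<eta> t \<in> H" if "t \<in> {0..1}" for t
        using Re\<eta>[OF that] big[OF that] by (simp add: H_def lnR)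
      have cont\<eta>: "continuous_on {0..1} \<eta>"
        using g(1) by (auto simp: \<eta>_def intro!: continuous_intros)
      have "(\<phi> \<circ> \<eta>) 1 = \<gamma> 1"
      proof (rule covering_space_lift_unique[OF cov, where T = "{0..1::real}" and a = 0 and f = "\<lambda>t. poly p (\<gamma> t)"])
        show "(\<phi> \<circ> \<eta>) 0 = \<gamma> 0" using \<gamma>(3) by (simp add: \<eta>_def pathstart_def)
        show "continuous_on {0..1} (\<phi> \<circ> \<eta>)"
          using \<eta>H by (intro continuous_on_compose cont\<eta> continuous_on_subset[OF \<phi>(1)]) auto
        show "continuous_on {0..1} (\<lambda>t. poly p (\<gamma> t))" using cont\<gamma> by (auto intro!: continuous_intros)
        show "poly p (\<gamma> x) = poly p ((\<phi> \<circ> \<eta>) x)" if "x \<in> {0..1}" for x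
          using \<phi>(3)[OF \<eta>H[OF that]] exp\<eta>[OF that] by simp
      qed (use \<gamma>E \<eta>H \<phi>(2) cont\<gamma> in \<open>auto simp: E_def Pi_iff\<close>)
      then have "z = \<phi> (\<eta> 1)" using \<gamma>(4) by (simp add: pathfinish_def)
      moreover have "\<eta> 1 \<in> L"
        using Re\<eta>[of 1] \<gamma>(4) z by (simp add: L_def pathfinish_def) (metis ln_exp)
      ultimately show "z \<in> \<phi> ` L" by blast
    qed
  qed
  moreover have "convex L"
  proof -
    have "L = {u. Re u \<le> ln s} \<inter> {u. Re u \<ge> ln s}" by (auto simp: L_def)
    then show ?thesis by (simp add: convex_Int convex_halfspace_Re_le convex_halfspace_Re_ge)
  qed
  ultimately show ?thesis
    using \<phi>(1) LH by (simp add: connected_continuous_image continuous_on_subset convex_connected)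
qed

text \<open>For \<open>s > R\<close> the closure of every component of the open preimage reaches the
  level set, which is connected. Critical values may lie on the circle of radius \<open>R\<close>
  itself, so \<open>R\<close> is reached only as a nested intersection.\<close>

lemma connected_vimage_cball:
  assumes deg: "degree p \<ge> 1" and R: "R > 0" and crit: "crit_vals p \<subseteq> cball c R"
  shows "connected (poly p -` cball c R)"
proof -
  have *: "connected (poly p -` cball c s)" if s: "s > R" for s
  proof -
    define Q where "Q = poly p -` cball c s"
    define L where "L = {z. cmod (poly p z - c) = s}"
    have "connected L" unfolding L_def by (rule connected_level_set[OF deg R crit s])
    have LQ: "L \<subseteq> Q" by (auto simp: L_def Q_def dist_norm norm_minus_commute)
    have to_L: "\<exists>w\<in>L. connected_component Q z w" if z: "z \<in> Q" for z
    proof (cases "z \<in> L")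
      case True then show ?thesis using z by (intro bexI[of _ z]) auto
    next
      case False
      define O' where "O' = poly p -` ball c s"
      have zO: "z \<in> O'" using z False by (auto simp: Q_def L_def O'_def dist_norm norm_minus_commute)
      have "open O'" unfolding O'_def by (intro open_poly_vimage) auto
      define D where "D = connected_component_set O' z"
      have D: "D \<in> components O'" "z \<in> D" using zO by (auto simp: D_def components_def)
      have "bounded O'" unfolding O'_def by (rule bounded_poly_vimage[OF deg]) auto
      then have "bounded D" using D in_components_subset bounded_subset by blast
      then have "D \<noteq> UNIV" using not_bounded_UNIV by blast
      then obtain w where w: "w \<in> frontier D" using frontier_not_empty D(2) by blast
      have "closure D \<subseteq> Q"
      proof (rule closure_minimal)
        show "D \<subseteq> Q" using D in_components_subset by (fastforce simp: O'_def Q_def)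
        show "closed Q" unfolding Q_def by (intro closed_poly_vimage) auto
      qed
      moreover have "w \<notin> O'"
        using frontier_of_components_subset[OF D(1)] w \<open>open O'\<close>
        by (metis Diff_iff frontier_def interior_open subsetD)
      moreover have "w \<in> closure D" using w by (simp add: frontier_def)
      ultimately have "w \<in> L" by (auto simp: O'_def Q_def L_def dist_norm norm_minus_commute)
      moreover have "connected_component Q z w"
        unfolding connected_component_def
        using \<open>closure D \<subseteq> Q\<close> \<open>w \<in> closure D\<close> D closure_subset[of D]
        by (intro exI[of _ "closure D"]) (auto intro: connected_imp_connected_closure in_components_connected)
      ultimately show ?thesis by blast
    qed
    have "connected_component Q x y" if "x \<in> Q" "y \<in> Q" for x y
    proof -
      obtain x' y' where "x' \<in> L" "y' \<in> L" "connected_component Q x x'" "connected_component Q y y'"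
        using to_L \<open>x \<in> Q\<close> \<open>y \<in> Q\<close> by meson
      moreover have "connected_component Q x' y'"
        unfolding connected_component_def using \<open>connected L\<close> LQ calculation by blast
      ultimately show ?thesis by (meson connected_component_sym connected_component_trans)
    qed
    then show ?thesis by (simp add: connected_iff_connected_component Q_def)
  qed
  have "poly p -` cball c R = (\<Inter>n::nat. poly p -` cball c (R + 1 / Suc n))" (is "_ = ?I")
  proof
    show "?I \<subseteq> poly p -` cball c R"
    proof
      fix z assume z: "z \<in> ?I"
      have "(\<lambda>n. R + 1 / real (Suc n)) \<longlonglongrightarrow> R + 0"
        by (intro tendsto_add tendsto_const) (rule LIMSEQ_Suc[OF lim_1_over_n])
      then have "dist c (poly p z) \<le> R"
        using z by (intro tendsto_lowerbound[of "\<lambda>n. R + 1 / real (Suc n)"]) (auto intro!: always_eventually)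
      then show "z \<in> poly p -` cball c R" by simp
    qed
    have "cball c R \<subseteq> cball c (R + 1 / Suc n)" for n :: nat
      by (rule subset_cball) simp
    then show "poly p -` cball c R \<subseteq> ?I" by blast
  qed
  also have "connected ?I"
  proof (rule connected_nest)
    show "poly p -` cball c (R + 1 / Suc n) \<subseteq> poly p -` cball c (R + 1 / Suc m)" if "m \<le> n" for m n
    proof -
      have "1 / real (Suc n) \<le> 1 / real (Suc m)" using that by (simp add: frac_le)
      then show ?thesis by (auto intro: order_trans)
    qed
  qed (use * deg in \<open>auto intro!: compact_poly_vimage\<close>)
  finally show ?thesis .
qed

text \<open>By the maximum principle the region enclosed by a loop in \<open>Q\<close> again maps
  into the disc, hence lies in \<open>Q\<close>; so no loop in \<open>Q\<close> winds around a point
  outside.\<close>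

lemma simply_connected_component_vimage_ball:
  assumes "Q \<in> components (poly p -` ball (c :: complex) e)"
  shows "simply_connected Q"
proof -
  have op: "open Q" using open_components[OF open_poly_vimage[OF open_ball] assms] .
  have Qs: "Q \<subseteq> poly p -` ball c e" "connected Q"
    using assms in_components_subset in_components_connected by auto
  show ?thesis
    unfolding simply_connected_eq_winding_number_zero[OF op]
  proof (intro conjI allI impI Qs(2))
    fix g z assume g: "path g \<and> path_image g \<subseteq> Q \<and> pathfinish g = pathstart g \<and> z \<notin> Q"
    define P where "P = path_image g"
    have P: "compact P" "connected P" "P \<noteq> {}" "P \<subseteq> Q"
      using g by (auto simp: P_def compact_path_image connected_path_image)
    have "z \<notin> inside P"
    proof
      assume z: "z \<in> inside P"
      have "continuous_on P (\<lambda>w. cmod (poly p w - c))"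
        by (intro continuous_intros)
      then obtain m where m: "m \<in> P" "\<And>w. w \<in> P \<Longrightarrow> cmod (poly p w - c) \<le> cmod (poly p m - c)"
        using continuous_attains_sup[OF P(1,3)] by blast
      have lt: "cmod (poly p m - c) < e"
        using m(1) P(4) Qs(1) by (auto simp: dist_norm norm_minus_commute)
      have "cmod (poly p w - c) < e" if "w \<in> inside P" for w
      proof -
        have "cmod (poly p w - c) \<le> cmod (poly p m - c)"
          by (rule max_modulus_poly_diff[of "inside P"])
             (use that P m frontier_inside_subset[of P] in
                \<open>auto simp: bounded_inside compact_imp_bounded compact_imp_closed\<close>)
        then show ?thesis using lt by simp
      qed
      then have "P \<union> inside P \<subseteq> poly p -` ball c e"
        using P(4) Qs(1) by (auto simp: dist_norm norm_minus_commute)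
      moreover have "connected (P \<union> inside P)"
        using P by (intro connected_with_inside) (auto simp: compact_imp_closed)
      ultimately have "P \<union> inside P \<subseteq> Q"
        using components_maximal[OF assms] P(3,4) by blast
      then show False using z g by blast
    qed
    then have "z \<in> outside P"
      using g P(4) inside_Un_outside[of P] by blast
    then show "winding_number g z = 0"
      using g winding_number_zero_in_outside by (simp add: P_def)
  qed
qed

section \<open>Semigroups and filled Julia sets\<close>

lemma dist_cmod: "dist b z = cmod (z - b)"
  by (simp add: dist_norm norm_minus_commute)

lemma semigroup_generated_mono: "A \<subseteq> B \<Longrightarrow> semigroup_generated A \<subseteq> semigroup_generated B"
proof
  fix f assume "A \<subseteq> B" "f \<in> semigroup_generated A"
  from this(2,1) show "f \<in> semigroup_generated B"
    by induction (auto intro: semigroup_generated.intros)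
qed

text \<open>The inductive definition composes arbitrary elements. Peeling off one outermost
  generator relies on associativity, which enters through the strengthened claim that composing with
  \<open>f\<close> on the left preserves \<open>P\<close>.\<close>

lemma semigroup_generated_induct_left [consumes 1, case_names generator compose]:
  assumes "f \<in> semigroup_generated \<Lambda>" "\<And>h. h \<in> \<Lambda> \<Longrightarrow> P h"
    "\<And>h f. h \<in> \<Lambda> \<Longrightarrow> f \<in> semigroup_generated \<Lambda> \<Longrightarrow> P f \<Longrightarrow> P (h \<circ>\<^sub>p f)"
  shows "P f"
proof -
  have "P f \<and> (\<forall>g \<in> semigroup_generated \<Lambda>. P g \<longrightarrow> P (f \<circ>\<^sub>p g))"
    using assms(1)
  proof induction
    case (compose f1 f2)
    then show ?case
      by (auto simp: pcompose_assoc[symmetric] intro: semigroup_generated.compose)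
  qed (use assms in auto)
  then show ?thesis by simp
qed

text \<open>Peels off the generator that is applied first; this form serves where the first step
  decides the fate of a region.\<close>

lemma semigroup_generated_induct_right [consumes 1, case_names generator compose]:
  assumes "f \<in> semigroup_generated \<Lambda>" "\<And>h. h \<in> \<Lambda> \<Longrightarrow> P h"
    "\<And>h f. h \<in> \<Lambda> \<Longrightarrow> f \<in> semigroup_generated \<Lambda> \<Longrightarrow> P f \<Longrightarrow> P (f \<circ>\<^sub>p h)"
  shows "P f"
proof -
  have "P f \<and> (\<forall>g \<in> semigroup_generated \<Lambda>. P g \<longrightarrow> P (g \<circ>\<^sub>p f))"
    using assms(1)
  proof induction
    case (compose f1 f2)
    then show ?case
      by (auto simp: pcompose_assoc intro: semigroup_generated.compose)
  qed (use assms in auto)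
  then show ?thesis by simp
qed

lemma poly_semigroup_invariant:
  assumes "f \<in> semigroup_generated \<Lambda>" "\<And>h z. h \<in> \<Lambda> \<Longrightarrow> z \<in> S \<Longrightarrow> poly h z \<in> S" "z \<in> S"
  shows "poly f z \<in> S"
  using assms(1) by (induction rule: semigroup_generated_induct_left) (use assms in \<open>auto simp: poly_pcompose\<close>)

lemma degree_semigroup:
  assumes "f \<in> semigroup_generated \<Lambda>" "\<And>h. h \<in> \<Lambda> \<Longrightarrow> degree h \<ge> 2"
  shows "degree f \<ge> 2"
  using assms(1)
proof (induction rule: semigroup_generated_induct_left)
  case (compose h f)
  have "2 * 1 \<le> degree h * degree f"
    using compose assms(2)[of h] by (intro mult_le_mono) auto
  then show ?case by (simp add: degree_pcompose)
qed (use assms in auto)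

lemma crit_vals_pcompose: "crit_vals (f \<circ>\<^sub>p g) \<subseteq> poly f ` crit_vals g \<union> crit_vals f"
  by (auto simp: crit_vals_def pderiv_pcompose poly_pcompose)

lemma crit_vals_semigroup:
  assumes "f \<in> semigroup_generated \<Lambda>" "\<And>h z. h \<in> \<Lambda> \<Longrightarrow> z \<in> S \<Longrightarrow> poly h z \<in> S"
    "\<And>h. h \<in> \<Lambda> \<Longrightarrow> crit_vals h \<subseteq> S"
  shows "crit_vals f \<subseteq> S"
  using assms(1)
proof (induction rule: semigroup_generated_induct_left)
  case (compose h f)
  then show ?case using crit_vals_pcompose[of h f] assms(2,3) by blast
qed (use assms in auto)

lemma critical_values_eq:
  assumes "degree p \<ge> 2" shows "critical_values p = insert Infinity (Fin ` crit_vals p)"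
  using assms by (force simp: critical_values_def critical_points_def crit_vals_def)

text \<open>\<open>R\<close> is an escape radius: outside it every generator at least doubles the
  distance to \<open>b\<close>. The locale serves for \<open>\<Gamma>\<close>, for the enlarged
  family and for single generators, with different radii.\<close>

locale escaping =
  fixes \<Lambda> :: "complex poly set" and b :: complex and R :: real
  assumes nonempty: "\<Lambda> \<noteq> {}" and R_pos: "R > 0"
    and deg: "\<And>h. h \<in> \<Lambda> \<Longrightarrow> degree h \<ge> 2"
    and escape: "\<And>h z. h \<in> \<Lambda> \<Longrightarrow> cmod (z - b) \<ge> R \<Longrightarrow> cmod (poly h z - b) \<ge> 2 * cmod (z - b)"
begin

abbreviation "S \<equiv> semigroup_generated \<Lambda>"
abbreviation "K \<equiv> K_hat S"

lemma degS: "f \<in> S \<Longrightarrow> degree f \<ge> 2"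
  by (rule degree_semigroup) (use deg in auto)

lemma escapeS:
  assumes "f \<in> S" "cmod (z - b) \<ge> R"
  shows "cmod (poly f z - b) \<ge> 2 * cmod (z - b)"
  using assms(1)
proof (induction rule: semigroup_generated_induct_left)
  case (compose h f)
  then have "cmod (poly f z - b) \<ge> R" using assms(2) R_pos by linarith
  then show ?case
    using escape[OF compose(1) \<open>cmod (poly f z - b) \<ge> R\<close>] compose(3) norm_ge_zero[of "poly f z - b"]
    unfolding poly_pcompose by linarith
qed (use assms escape in auto)

text \<open>\<open>((\<circ>\<^sub>p) h ^^ n) g\<close> is the \<open>n\<close>-th iterate of
  \<open>h\<close> applied after \<open>g\<close>.\<close>

lemma iterate_in_S: "h \<in> S \<Longrightarrow> g \<in> S \<Longrightarrow> ((\<circ>\<^sub>p) h ^^ n) g \<in> S"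
  by (induction n) (auto intro: semigroup_generated.compose)

lemma iterate_escape:
  assumes "h \<in> S" "cmod (poly (((\<circ>\<^sub>p) h ^^ n) g) z - b) \<ge> R"
  shows "cmod (poly (((\<circ>\<^sub>p) h ^^ (n + m)) g) z - b) \<ge> 2 ^ m * R"
proof (induction m)
  case (Suc m)
  have "1 * R \<le> 2 ^ m * R" using R_pos by (intro mult_right_mono) auto
  then have "cmod (poly (((\<circ>\<^sub>p) h ^^ (n + m)) g) z - b) \<ge> R" using Suc by linarith
  from escapeS[OF assms(1) this] Suc show ?case by (simp add: poly_pcompose)
qed (use assms in simp)

text \<open>Stated for any family \<open>F\<close> containing the iterates of \<open>h\<close> after
  \<open>g\<close>, so that it applies both to the whole semigroup and to the iterates of a single
  element.\<close>

lemma unbounded_iterates: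
  assumes "h \<in> S" "cmod (poly (((\<circ>\<^sub>p) h ^^ n) g) z - b) \<ge> R" "range (\<lambda>n. ((\<circ>\<^sub>p) h ^^ n) g) \<subseteq> F"
  shows "z \<notin> K_hat F"
proof
  assume "z \<in> K_hat F"
  then obtain B where B: "\<And>f. f \<in> F \<Longrightarrow> cmod (poly f z) \<le> B" by (auto simp: K_hat_def bounded_iff)
  obtain m where "(B + cmod b) / R < 2 ^ m" using real_arch_pow[of 2] by auto
  then have "B + cmod b < 2 ^ m * R" using R_pos by (simp add: field_simps)
  moreover have "cmod (poly (((\<circ>\<^sub>p) h ^^ (n + m)) g) z) \<le> B" using assms(3) by (intro B) auto
  ultimately show False
    using iterate_escape[OF assms(1,2), of m] norm_triangle_ineq4[of "poly (((\<circ>\<^sub>p) h ^^ (n + m)) g) z" b]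
    by linarith
qed

text \<open>Leaving \<open>cball b R\<close> once is fatal: repeating the element that did it
  doubles the distance each time. So bounded orbits have the uniform bound \<open>R\<close>.\<close>

lemma K_iff: "z \<in> K \<longleftrightarrow> (\<forall>f\<in>S. cmod (poly f z - b) \<le> R)"
proof
  assume "\<forall>f\<in>S. cmod (poly f z - b) \<le> R"
  then have "cmod (poly f z) \<le> R + cmod b" if "f \<in> S" for f
    using that norm_triangle_sub[of "poly f z" b] by fastforce
  then show "z \<in> K" by (auto simp: K_hat_def bounded_iff)
next
  assume z: "z \<in> K"
  have "cmod (poly f z - b) \<le> R" if f: "f \<in> S" for f
  proof (rule ccontr)
    assume "\<not> ?thesis"
    then have "z \<notin> K"
      by (intro unbounded_iterates[of f 0 f]) (auto intro: f iterate_in_S)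
    with z show False by simp
  qed
  then show "\<forall>f\<in>S. cmod (poly f z - b) \<le> R" by blast
qed

lemma ex_in_S: "\<exists>h. h \<in> \<Lambda> \<and> h \<in> S"
  using nonempty semigroup_generated.generator by blast

lemma K_subset: "K \<subseteq> ball b R"
proof
  fix z assume z: "z \<in> K"
  obtain h where h: "h \<in> S" using ex_in_S by blast
  have "cmod (poly h z - b) \<le> R" using z h K_iff by blast
  then have "\<not> cmod (z - b) \<ge> R" using escapeS[OF h, of z] R_pos by linarith
  then show "z \<in> ball b R" by (simp add: dist_cmod)
qed

lemma closed_K: "closed K"
proof -
  have "K = (\<Inter>f\<in>S. poly f -` cball b R)"
    using K_iff by (auto simp: dist_cmod)
  then show ?thesis by (auto intro!: closed_INT closed_poly_vimage)
qed

lemma compact_K: "compact K"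
  using closed_K K_subset bounded_subset[OF bounded_ball] by (auto simp: compact_eq_bounded_closed)

lemma K_invariant: "f \<in> S \<Longrightarrow> z \<in> K \<Longrightarrow> poly f z \<in> K"
  unfolding K_iff using semigroup_generated.compose by (force simp flip: poly_pcompose)

lemma exterior_fatou: "- (Fin ` cball b R) \<subseteq> fatou_set S"
proof (rule exterior_in_fatou_set[OF R_pos])
  fix f z assume f: "f \<in> S" and "cmod (z - b) \<ge> R"
  from escapeS[OF this] show "cmod (z - b) \<le> cmod (poly f z - b)"
    using norm_ge_zero[of "z - b"] by linarith
qed (use degS in force)

text \<open>The Julia set read in the plane; nothing is lost, since infinity lies in the Fatou
  set.\<close>

definition "X = Fin -` julia_set S"

lemma X_subset: "X \<subseteq> cball b R"
  using exterior_fatou by (auto simp: X_def julia_set_def image_iff)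

lemma julia_eq: "julia_set S = Fin ` X"
proof -
  have "Infinity \<notin> julia_set S" using exterior_fatou by (auto simp: julia_set_def)
  then show ?thesis by (auto simp: X_def image_iff) (metis sphere_minus_Infinity)
qed

lemma compact_X: "compact X"
  using X_subset closed_vimage_Fin[OF closed_julia_set, of S] bounded_subset[OF bounded_cball]
  by (auto simp: compact_eq_bounded_closed X_def[symmetric])

lemma interior_K_fatou: "z \<in> interior K \<Longrightarrow> Fin z \<in> fatou_set S"
  by (rule Fin_in_fatou_set[of "interior K" z 1 S b R]) (use K_iff interior_subset in \<open>auto\<close>)

lemma frontier_K_X: "frontier K \<subseteq> X"
proof
  fix z assume "z \<in> frontier K"
  then have "z \<in> K" "z \<notin> interior K" using closed_K by (auto simp: frontier_def)
  then show "z \<in> X" using K_hat_inter_fatou_set[of z S] by (auto simp: X_def julia_set_def)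
qed

lemma X_inter_interior_K: "X \<inter> interior K = {}"
  using interior_K_fatou by (auto simp: X_def julia_set_def)

lemma K_nonempty_imp_X_nonempty:
  assumes "K \<noteq> {}" shows "X \<noteq> {}"
proof -
  have "K \<noteq> UNIV" using compact_K compact_imp_bounded not_bounded_UNIV by metis
  then show ?thesis using frontier_not_empty[OF assms] frontier_K_X by blast
qed

end

text \<open>Boundedness of the postcritical set in a form that can be checked on generators:
  invariance of \<open>K\<close> spreads the condition on critical values to all words.\<close>

locale pc_bounded = escaping +
  assumes b_int: "b \<in> interior K"
    and crit: "\<And>h. h \<in> \<Lambda> \<Longrightarrow> crit_vals h \<subseteq> K"
begin

lemma critS: "f \<in> S \<Longrightarrow> crit_vals f \<subseteq> K"
  by (rule crit_vals_semigroup[of f \<Lambda>])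
    (use crit K_invariant semigroup_generated.generator in auto)

lemma postcritical_subset: "postcritical_set S \<subseteq> insert Infinity (Fin ` K)"
  unfolding postcritical_set_def
proof (rule closure_minimal)
  show "(\<Union>g\<in>S. critical_values g) \<subseteq> insert Infinity (Fin ` K)"
    using critS degS by (fastforce simp: critical_values_eq)
  show "closed (insert Infinity (Fin ` K))"
    using compact_K by (intro closed_insert compact_imp_closed compact_Fin)
qed

lemma in_class_G: "S \<in> class_G"
proof -
  have "planar_postcritical_set S \<subseteq> K"
    using postcritical_subset by (auto simp: planar_postcritical_set_def)
  then have "bounded (planar_postcritical_set S)"
    using compact_K compact_imp_bounded bounded_subset by blast
  moreover have "polynomial_semigroup S"
    unfolding polynomial_semigroup_def using nonempty deg by (metis le_trans one_le_numeral)
  ultimately show ?thesis using degS by (simp add: class_G_def)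
qed

text \<open>The preimage under \<open>g\<close> of the filled Julia set of \<open>h\<close>.\<close>

definition "L h g = (\<Inter>n. poly (((\<circ>\<^sub>p) h ^^ n) g) -` cball b R)"

lemma L_nest:
  assumes "h \<in> S" "m \<le> n"
  shows "poly (((\<circ>\<^sub>p) h ^^ n) g) -` cball b R \<subseteq> poly (((\<circ>\<^sub>p) h ^^ m) g) -` cball b R"
proof
  fix z assume z: "z \<in> poly (((\<circ>\<^sub>p) h ^^ n) g) -` cball b R"
  show "z \<in> poly (((\<circ>\<^sub>p) h ^^ m) g) -` cball b R"
  proof (rule ccontr)
    assume *: "\<not> ?thesis"
    then have gt: "cmod (poly (((\<circ>\<^sub>p) h ^^ m) g) z - b) > R" by (simp add: dist_cmod)
    show False
    proof (cases "m = n")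
      case False
      then have "n = m + (n - m)" "1 \<le> n - m" using assms(2) by auto
      then have "cmod (poly (((\<circ>\<^sub>p) h ^^ n) g) z - b) \<ge> 2 ^ (n - m) * R"
        using iterate_escape[OF assms(1), of m g z "n - m"] gt by simp
      moreover have "2 * R \<le> 2 ^ (n - m) * R"
        using power_increasing[OF \<open>1 \<le> n - m\<close>, of "2::real"] R_pos by (intro mult_right_mono) auto
      moreover have "cmod (poly (((\<circ>\<^sub>p) h ^^ n) g) z - b) \<le> R" using z by (simp add: dist_cmod)
      ultimately show False using R_pos by linarith
    qed (use * z in simp)
  qed
qed

context
  fixes h g assumes hg: "h \<in> S" "g \<in> S"
begin

lemma iter_deg: "degree (((\<circ>\<^sub>p) h ^^ n) g) \<ge> 1"
  using degS[OF iterate_in_S[OF hg, of n]] by simp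

lemma compact_L: "compact (L h g)"
  unfolding L_def using iter_deg by (intro compact_Inter) (auto intro!: compact_poly_vimage)

lemma K_subset_L: "K \<subseteq> L h g"
  using K_iff iterate_in_S[OF hg] by (auto simp: L_def dist_cmod)

text \<open>The critical values of all words lie in \<open>K\<close> and so in the disc; hence every
  preimage of the disc is connected, and escape makes these preimages nested.\<close>

lemma connected_L: "connected (L h g)"
  unfolding L_def
proof (rule connected_nest)
  fix n
  show "compact (poly (((\<circ>\<^sub>p) h ^^ n) g) -` cball b R)"
    using iter_deg by (intro compact_poly_vimage) auto
  show "connected (poly (((\<circ>\<^sub>p) h ^^ n) g) -` cball b R)"
    using critS[OF iterate_in_S[OF hg, of n]] K_subset
    by (intro connected_vimage_cball iter_deg R_pos) (auto dest!: subsetD)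
qed (rule L_nest[OF hg(1)])

text \<open>The complements of the preimages are connected and increasing; all of them contain the
  first, which is nonempty, so their union is connected.\<close>

lemma connected_compl_L: "connected (- L h g)"
proof -
  have eq: "- L h g = \<Union> (range (\<lambda>n. - (poly (((\<circ>\<^sub>p) h ^^ n) g) -` cball b R)))"
    by (auto simp: L_def)
  have "bounded (poly (((\<circ>\<^sub>p) h ^^ 0) g) -` cball b R)"
    using iter_deg[of 0] by (intro bounded_poly_vimage) auto
  then obtain z where "z \<notin> poly (((\<circ>\<^sub>p) h ^^ 0) g) -` cball b R"
    using not_bounded_UNIV by (metis UNIV_I bounded_subset subsetI)
  then have "z \<in> \<Inter> (range (\<lambda>n. - (poly (((\<circ>\<^sub>p) h ^^ n) g) -` cball b R)))"
    using L_nest[OF hg(1), of 0] by blast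
  then have "\<Inter> (range (\<lambda>n. - (poly (((\<circ>\<^sub>p) h ^^ n) g) -` cball b R))) \<noteq> {}" by blast
  moreover have "connected (- (poly (((\<circ>\<^sub>p) h ^^ n) g) -` cball b R))" for n
    by (rule connected_compl_vimage_cball[OF iter_deg])
  ultimately show ?thesis unfolding eq by (intro connected_Union) auto
qed

text \<open>The subfamily of iterates of \<open>h\<close> after \<open>g\<close> is bounded exactly
  on \<open>L h g\<close>, so a frontier point in its Fatou set would be interior. Julia sets grow
  with the family, which leads from the subfamily to the semigroup.\<close>

lemma frontier_L_X: "frontier (L h g) \<subseteq> X"
proof
  fix z assume z: "z \<in> frontier (L h g)"
  define F where "F = range (\<lambda>n. ((\<circ>\<^sub>p) h ^^ n) g)"
  have FS: "F \<subseteq> S" using iterate_in_S[OF hg] by (auto simp: F_def)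
  have zL: "z \<in> L h g" "z \<notin> interior (L h g)"
    using z compact_L by (auto simp: frontier_def compact_imp_closed closure_closed)
  show "z \<in> X"
  proof (rule ccontr)
    assume "z \<notin> X"
    then have "Fin z \<in> fatou_set F"
      using julia_set_mono[OF FS] by (auto simp: X_def julia_set_def)
    moreover have "cmod (poly f z) \<le> R + cmod b" if "f \<in> F" for f
    proof -
      have "cmod (poly f z - b) \<le> R" using zL(1) that by (auto simp: F_def L_def dist_cmod)
      then show ?thesis using norm_triangle_sub[of "poly f z" b] by linarith
    qed
    then have "z \<in> K_hat F" by (auto simp: K_hat_def bounded_iff)
    ultimately have "z \<in> interior (K_hat F)" by (intro K_hat_inter_fatou_set)
    moreover have "K_hat F \<subseteq> L h g"
    proof
      fix w assume w: "w \<in> K_hat F"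
      show "w \<in> L h g"
      proof (rule ccontr)
        assume "w \<notin> L h g"
        then obtain n where "\<not> cmod (poly (((\<circ>\<^sub>p) h ^^ n) g) w - b) \<le> R"
          by (auto simp: L_def dist_cmod)
        then have "cmod (poly (((\<circ>\<^sub>p) h ^^ n) g) w - b) \<ge> R" by linarith
        from unbounded_iterates[OF hg(1) this] w show False by (auto simp: F_def)
      qed
    qed
    ultimately show False using zL(2) interior_mono by blast
  qed
qed

end

text \<open>Each \<open>g\<close> maps a ball missing all these frontiers either into \<open>cball b R\<close> or off \<open>ball b r\<close>, so
  Montel's theorem applies to it.\<close>

lemma frontier_L_dense:
  assumes h: "h \<in> S" and "open U" "z \<in> U" "z \<in> X"
  shows "\<exists>g\<in>S. U \<inter> frontier (L h g) \<noteq> {}"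
proof (rule ccontr)
  assume neg: "\<not> ?thesis"
  obtain e where e: "e > 0" "ball z e \<subseteq> U" using assms by (meson open_contains_ball)
  obtain r where r: "r > 0" "ball b r \<subseteq> K" using b_int by (meson mem_interior)
  have "Fin z \<in> fatou_set S"
  proof (rule Fin_in_fatou_set[of "ball z e" z r S b R])
    fix g assume g: "g \<in> S"
    have "ball z e \<inter> frontier (L h g) = {}" using neg g e by blast
    then have "ball z e \<inter> L h g = {} \<or> ball z e \<subseteq> L h g"
      using connected_Int_frontier[of "ball z e" "L h g"] by auto
    then show "(\<forall>z\<in>ball z e. cmod (poly g z - b) \<le> R) \<or> (\<forall>z\<in>ball z e. r \<le> cmod (poly g z - b))"
    proof
      assume "ball z e \<subseteq> L h g"
      then have "w \<in> poly (((\<circ>\<^sub>p) h ^^ 0) g) -` cball b R" if "w \<in> ball z e" for w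
        using that unfolding L_def by blast
      then show ?thesis by (auto simp: dist_cmod)
    next
      assume dis: "ball z e \<inter> L h g = {}"
      have "r \<le> cmod (poly g w - b)" if w: "w \<in> ball z e" for w
      proof (rule ccontr)
        assume "\<not> ?thesis"
        then have gw: "poly g w \<in> K" using r by (auto simp: dist_cmod)
        have "poly (((\<circ>\<^sub>p) h ^^ n) g) w \<in> K" for n
          by (induction n) (use gw K_invariant[OF h] in \<open>auto simp: poly_pcompose\<close>)
        then have "poly (((\<circ>\<^sub>p) h ^^ n) g) w \<in> cball b R" for n
          using K_subset ball_subset_cball by blast
        then have "w \<in> L h g" unfolding L_def by blast
        with dis w show False by blast
      qed
      then show ?thesis by blast
    qed
  qed (use e r in auto)
  with assms show False by (simp add: X_def julia_set_def)
qed

text \<open>Otherwise a path from \<open>b\<close> to infinity avoids \<open>J\<close>, and so does a relatively clopen part of the Julia set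
  containing \<open>J\<close>. By density this part contains an entire frontier of some \<open>L h g\<close>, which the path
  has to cross.\<close>

lemma b_inside_component:
  assumes J: "J \<in> components X"
  shows "b \<in> inside J"
proof (rule ccontr)
  assume nin: "b \<notin> inside J"
  have JX: "J \<subseteq> X" "J \<noteq> {}" using J in_components_subset in_components_nonempty by auto
  have compJ: "compact J" using J compact_X compact_components by blast
  have "b \<notin> J" using b_int X_inter_interior_K JX by blast
  define C where "C = connected_component_set (- J) b"
  have unbC: "\<not> bounded C" using nin \<open>b \<notin> J\<close> by (simp add: inside_def C_def)
  then have "\<not> C \<subseteq> cball b R" using bounded_subset bounded_cball by blast
  then have "\<exists>w\<in>C. cmod (w - b) > R" by (simp add: subset_eq dist_cmod not_le)
  then obtain w where w: "w \<in> C" "cmod (w - b) > R" by blast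
  have "open C" unfolding C_def using compJ by (intro open_connected_component) (simp add: compact_imp_closed open_Compl)
  then have "path_connected C" by (simp add: C_def connected_open_path_connected)
  moreover have "b \<in> C" using \<open>b \<notin> J\<close> by (simp add: C_def)
  ultimately obtain \<gamma> where \<gamma>: "path \<gamma>" "path_image \<gamma> \<subseteq> C" "pathstart \<gamma> = b" "pathfinish \<gamma> = w"
    using w(1) unfolding path_connected_def by blast
  define P where "P = path_image \<gamma>"
  have P: "compact P" "connected P" "b \<in> P" "w \<in> P" "P \<inter> J = {}"
    using \<gamma> connected_component_subset[of "- J" b]
    by (auto simp: P_def C_def compact_path_image connected_path_image)
  \<comment> \<open>Sura-Bura: in a compact set a component has relatively clopen neighbourhoods
    inside any given open set around it.\<close>
  obtain N where N: "openin (top_of_set X) N" "compact N" "J \<subseteq> N" "N \<subseteq> - P"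
  proof (rule Sura_Bura_clopen_subset[OF _ J compJ, of "- P"])
    show "locally compact X" using compact_X by (simp add: closed_imp_locally_compact compact_imp_closed)
  qed (use P in \<open>auto simp: compact_imp_closed open_Compl\<close>)
  obtain V where V: "open V" "N = X \<inter> V" using N(1) by (auto simp: openin_open)
  obtain z where z: "z \<in> N" using JX N(3) by blast
  obtain h where h: "h \<in> S" using ex_in_S by blast
  obtain g where g: "g \<in> S" "V \<inter> frontier (L h g) \<noteq> {}"
    using frontier_L_dense[OF h V(1), of z] z V(2) by auto
  define Fr where "Fr = frontier (L h g)"
  have FrX: "Fr \<subseteq> X" unfolding Fr_def by (rule frontier_L_X[OF h g(1)])
  have "connected Fr"
    unfolding Fr_def by (intro connected_frontier_simple connected_L connected_compl_L h g(1))
  moreover have "open (- N)" using N(2) by (simp add: compact_imp_closed open_Compl)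
  moreover have "Fr \<inter> V \<noteq> {}" using g(2) by (auto simp: Fr_def)
  moreover have "Fr \<subseteq> V \<union> - N" "V \<inter> - N \<inter> Fr = {}" using FrX V(2) by auto
  ultimately have "- N \<inter> Fr = {}"
    using V(1) connectedD[of Fr V "- N"] by (metis Int_commute inf_assoc)
  then have "P \<inter> Fr = {}" using N(4) by blast
  moreover have "b \<in> L h g" using b_int K_subset_L[OF h g(1)] interior_subset by blast
  moreover have "w \<notin> L h g"
  proof
    assume "w \<in> L h g"
    then have "w \<in> poly (((\<circ>\<^sub>p) h ^^ 0) g) -` cball b R" unfolding L_def by blast
    then have "cmod (poly g w - b) \<le> R" by (simp add: dist_cmod)
    then show False using escapeS[OF g(1), of w] w(2) R_pos by linarith
  qed
  ultimately show False
    using connected_Int_frontier[OF P(2), of "L h g"] P(3,4) by (auto simp: Fr_def)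
qed

end

section \<open>The minimal component of the Julia set\<close>

text \<open>If \<open>J1\<close> lies outside \<open>J2\<close>, take the component of
  \<open>- J2\<close> containing \<open>b\<close>: its closure together with \<open>J2\<close> is
  connected, contains \<open>b\<close> and misses \<open>J1\<close>. So \<open>J2\<close> lies in
  the bounded component of \<open>- J1\<close> around \<open>b\<close>.\<close>

lemma inside_chain:
  fixes J1 J2 :: "complex set"
  assumes c: "compact J1" "connected J1" "compact J2" "connected J2" and dis: "J1 \<inter> J2 = {}"
    and b: "b \<in> inside J1" "b \<in> inside J2"
  shows "J1 \<subseteq> inside J2 \<or> J2 \<subseteq> inside J1"
proof -
  have cl: "closed J1" "closed J2" using c by (auto simp: compact_imp_closed)
  have "J1 \<subseteq> inside J2 \<or> J1 \<subseteq> outside J2"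
  proof -
    have "J1 \<subseteq> inside J2 \<union> outside J2" using dis by auto
    then have "inside J2 \<inter> J1 = {} \<or> outside J2 \<inter> J1 = {}"
      using connectedD[OF c(2) open_inside[OF cl(2)] open_outside[OF cl(2)]] inside_Int_outside[of J2] by blast
    then show ?thesis using \<open>J1 \<subseteq> inside J2 \<union> outside J2\<close> by blast
  qed
  then show ?thesis
  proof
    assume out: "J1 \<subseteq> outside J2"
    define B where "B = connected_component_set (- J2) b"
    have bB: "b \<in> B" "bounded B" using b(2) by (auto simp: B_def inside_def)
    have Bin: "B \<subseteq> inside J2"
    proof
      fix x assume "x \<in> B"
      then have "connected_component_set (- J2) x = B" "x \<in> - J2"
        using connected_component_eq connected_component_subset unfolding B_def by fastforce+
      then show "x \<in> inside J2" using bB by (simp add: inside_def)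
    qed
    have B: "B \<in> components (- J2)" using b(2) by (auto simp: B_def components_def inside_def)
    have "B \<noteq> UNIV" using bB not_bounded_UNIV by blast
    then obtain x where x: "x \<in> frontier B" using frontier_not_empty bB by blast
    have xJ: "x \<in> J2" using frontier_of_components_closed_complement[OF cl(2) B] x by blast
    have clB: "closure B \<subseteq> B \<union> J2"
      using frontier_of_components_closed_complement[OF cl(2) B] closure_Un_frontier[of B] by blast
    have "connected (closure B \<union> J2)"
      using x xJ c(4) by (intro connected_Un connected_imp_connected_closure)
        (auto simp: B_def frontier_def)
    moreover have "closure B \<union> J2 \<subseteq> - J1" using clB Bin out dis inside_Int_outside[of J2] by blast
    moreover have "b \<in> closure B \<union> J2" using bB closure_subset by blast
    ultimately have sub: "closure B \<union> J2 \<subseteq> connected_component_set (- J1) b"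
      by (intro connected_component_maximal)
    have "J2 \<subseteq> inside J1"
    proof
      fix y assume "y \<in> J2"
      then have y: "y \<in> connected_component_set (- J1) b" using sub by blast
      then have "connected_component_set (- J1) y = connected_component_set (- J1) b" "y \<in> - J1"
        using connected_component_eq connected_component_subset by fastforce+
      then show "y \<in> inside J1" using b(1) by (simp add: inside_def)
    qed
    then show ?thesis ..
  qed simp
qed

lemma components_Fin_image: "components (Fin ` A) = (`) Fin ` components A"
proof -
  have *: "Fin ` D \<in> components (Fin ` A)" if D: "D \<in> components A" for D
    unfolding in_components_maximal
  proof (intro conjI allI impI)
    show "Fin ` D \<noteq> {}" "Fin ` D \<subseteq> Fin ` A" using D in_components_nonempty in_components_subset by blast+
    show "connected (Fin ` D)"
      using D in_components_connected by (intro connected_continuous_image continuous_on_Fin) auto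
    fix E assume E: "E \<noteq> {} \<and> Fin ` D \<subseteq> E \<and> E \<subseteq> Fin ` A \<and> connected E"
    then have c1: "connected (unFin ` E)" by (intro connected_continuous_image continuous_on_unFin) auto
    have c2: "unFin ` E \<subseteq> A" "D \<subseteq> unFin ` E" and c3: "E = Fin ` unFin ` E" using E by force+
    have c4: "unFin ` E \<noteq> {}" using E by blast
    have max: "\<forall>D'. D' \<noteq> {} \<and> D \<subseteq> D' \<and> D' \<subseteq> A \<and> connected D' \<longrightarrow> D' = D"
      using D[unfolded in_components_maximal, THEN conjunct2, THEN conjunct2, THEN conjunct2] .
    have "unFin ` E = D"
      by (rule max[rule_format]) (intro conjI c1 c2 c4)
    then show "E = Fin ` D" using c3 by (simp only:)
  qed
  show ?thesis
  proof
    show "components (Fin ` A) \<subseteq> (`) Fin ` components A"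
    proof
      fix C assume C: "C \<in> components (Fin ` A)"
      then obtain x where x: "Fin x \<in> C" "x \<in> A"
        using in_components_nonempty in_components_subset by fastforce
      define D where "D = connected_component_set A x"
      have D: "D \<in> components A" "x \<in> D" using x(2) by (auto simp: D_def components_def)
      have "Fin ` D = C"
        using components_eq[OF *[OF D(1)] C] x D by blast
      then show "C \<in> (`) Fin ` components A" using D by blast
    qed
  qed (use * in blast)
qed

context pc_bounded
begin

lemma compX:
  assumes "J \<in> components X"
  shows "compact J" "connected J" "J \<noteq> {}" "J \<subseteq> X" "closed J"
proof -
  show "compact J" using compact_X assms by (rule compact_components)
  then show "closed J" by (rule compact_imp_closed)
qed (fact in_components_connected[OF assms] in_components_nonempty[OF assms] in_components_subset[OF assms])+

text \<open>The hull of a component is the component with the bounded regions of its complement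
  filled in. Disjoint components around \<open>b\<close> lie one inside the other, and filling
  respects this.\<close>

lemma hull_chain:
  assumes "J1 \<in> components X" "J2 \<in> components X"
  shows "J1 \<union> inside J1 \<subseteq> J2 \<union> inside J2 \<or> J2 \<union> inside J2 \<subseteq> J1 \<union> inside J1"
proof (cases "J1 = J2")
  case False
  then have "J1 \<inter> J2 = {}" using assms components_nonoverlap by metis
  have "J1 \<subseteq> inside J2 \<or> J2 \<subseteq> inside J1"
    by (rule inside_chain[of J1 J2 b]) (fact compX[OF assms(1)] compX[OF assms(2)]
        \<open>J1 \<inter> J2 = {}\<close> b_inside_component[OF assms(1)] b_inside_component[OF assms(2)])+
  moreover have "inside J1 \<subseteq> inside J2" if "J1 \<subseteq> inside J2"
    by (rule inside_inside_compact_connected) (fact compX[OF assms(1)] compX[OF assms(2)] that)+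
  moreover have "inside J2 \<subseteq> inside J1" if "J2 \<subseteq> inside J1"
    by (rule inside_inside_compact_connected) (fact compX[OF assms(1)] compX[OF assms(2)] that)+
  ultimately show ?thesis by blast
qed simp

lemma X_nonempty: "X \<noteq> {}"
  using K_nonempty_imp_X_nonempty b_int interior_subset by blast

lemma hull_min:
  assumes "finite \<J>" "\<J> \<noteq> {}" "\<J> \<subseteq> components X"
  shows "\<exists>J\<in>\<J>. \<forall>J'\<in>\<J>. J \<union> inside J \<subseteq> J' \<union> inside J'"
  using assms
proof (induction \<J> rule: finite_ne_induct)
  case (insert J \<J>)
  then obtain M where M: "M \<in> \<J>" "\<forall>J'\<in>\<J>. M \<union> inside M \<subseteq> J' \<union> inside J'" by auto
  have "J \<union> inside J \<subseteq> M \<union> inside M \<or> M \<union> inside M \<subseteq> J \<union> inside J"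
    using hull_chain[of J M] insert.prems M(1) by blast
  then show ?case
  proof
    assume *: "J \<union> inside J \<subseteq> M \<union> inside M"
    show ?thesis
    proof (intro bexI[of _ J] ballI)
      fix J' assume "J' \<in> insert J \<J>"
      then show "J \<union> inside J \<subseteq> J' \<union> inside J'" using M(2) * by blast
    qed simp
  next
    assume *: "M \<union> inside M \<subseteq> J \<union> inside J"
    show ?thesis
    proof (intro bexI[of _ M] ballI)
      fix J' assume "J' \<in> insert J \<J>"
      then show "M \<union> inside M \<subseteq> J' \<union> inside J'" using M(2) * by blast
    qed (use M in simp)
  qed
qed simp

text \<open>Hulls are closed, and the least of finitely many contains its own component, a nonempty
  part of \<open>X\<close>; so the hulls have the finite intersection property relative to the
  compact \<open>X\<close>. The component of a common point is disjoint from any other component and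
  therefore lies inside it.\<close>

lemma ex_J_min: "\<exists>M \<in> components X. \<forall>J \<in> components X. surrounded_by M J"
proof -
  define D where "D = (\<lambda>J. J \<union> inside J :: complex set)"
  have "X \<inter> \<Inter> (D ` components X) \<noteq> {}"
  proof (rule compact_imp_fip[OF compact_X])
    fix T assume "T \<in> D ` components X"
    then obtain J where J: "J \<in> components X" "T = D J" by blast
    have "T = - outside J" using J(2) by (simp only: D_def union_with_inside)
    then show "closed T" using open_outside[OF compX(5)[OF J(1)]] by (simp add: closed_Compl)
  next
    fix \<T> assume T: "finite \<T>" "\<T> \<subseteq> D ` components X"
    then obtain \<J> where \<J>: "finite \<J>" "\<J> \<subseteq> components X" "\<T> = D ` \<J>"
      by (meson finite_subset_image)
    show "X \<inter> \<Inter> \<T> \<noteq> {}"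
    proof (cases "\<J> = {}")
      case True then show ?thesis using X_nonempty \<J> by simp
    next
      case False
      then obtain M where M: "M \<in> \<J>" "\<forall>J'\<in>\<J>. M \<union> inside M \<subseteq> J' \<union> inside J'"
        using hull_min[OF \<J>(1) False \<J>(2)] by metis
      have MX: "M \<in> components X" using M(1) \<J>(2) by (rule subsetD[rotated])
      have "M \<subseteq> T" if "T \<in> \<T>" for T
      proof -
        from that have "T \<in> D ` \<J>" unfolding \<J>(3) .
        then obtain J' where J': "T = D J'" "J' \<in> \<J>" by (rule imageE)
        have "M \<union> inside M \<subseteq> T"
          using bspec[OF M(2) J'(2)] unfolding J'(1) D_def .
        then show ?thesis by (rule order_trans[OF Un_upper1])
      qed
      then have "M \<subseteq> \<Inter> \<T>" by (rule Inter_greatest)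
      with compX(3,4)[OF MX] show ?thesis by blast
    qed
  qed
  then obtain x where x1: "x \<in> X" "x \<in> \<Inter> (D ` components X)" by blast
  have "x \<in> J \<union> inside J" if "J \<in> components X" for J
    using INT_D[OF x1(2) that] by (simp only: D_def)
  note x = x1(1) this
  define M where "M = connected_component_set X x"
  have M: "M \<in> components X" "x \<in> M" using x(1) by (auto simp: M_def components_def)
  have "surrounded_by M J" if J: "J \<in> components X" for J
  proof (cases "M = J")
    case False
    then have dis: "M \<inter> J = {}" using M J components_nonoverlap by metis
    then have "x \<in> inside J" using x(2)[OF J] M by blast
    then have "connected_component_set (- J) x \<in> components (- J)" "bounded (connected_component_set (- J) x)"
      by (auto simp: inside_def components_def)
    moreover have "M \<subseteq> connected_component_set (- J) x"
      using dis M compX(2)[OF M(1)] by (intro connected_component_maximal) auto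
    ultimately show ?thesis unfolding surrounded_by_def by blast
  qed (simp add: surrounded_by_def)
  with M show ?thesis by blast
qed

lemma surrounded_inside:
  assumes "surrounded_by M J" "M \<noteq> J" shows "M \<subseteq> inside J"
proof -
  obtain B where B: "B \<in> components (- J)" "bounded B" "M \<subseteq> B" using assms by (auto simp: surrounded_by_def)
  have "x \<in> inside J" if "x \<in> B" for x
  proof -
    obtain y where y: "B = connected_component_set (- J) y" using B(1) by (auto simp: components_def)
    then have "connected_component_set (- J) x = B"
      using that connected_component_eq by metis
    moreover have "x \<in> - J" using that in_components_subset[OF B(1)] by blast
    ultimately show ?thesis using B by (simp add: inside_def)
  qed
  then show ?thesis using B by blast
qed

lemma is_J_min_iff:
  "is_J_min S T \<longleftrightarrow> (\<exists>M \<in> components X. T = Fin ` M \<and> (\<forall>J \<in> components X. surrounded_by M J))"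
proof -
  have inf: "Infinity \<notin> Fin ` A" for A by auto
  have vim: "Fin -` (Fin ` A) = A" for A by (rule inj_vimage_image_eq[OF inj_Fin])
  show ?thesis
  proof
    assume *: "is_J_min S T"
    then have "T \<in> (`) Fin ` components X" by (simp only: is_J_min_def julia_eq components_Fin_image)
    then obtain M where M: "T = Fin ` M" "M \<in> components X" by (rule imageE)
    have "surrounded_by M J" if "J \<in> components X" for J
    proof -
      have "Fin ` J \<in> components (julia_set S)"
        unfolding julia_eq components_Fin_image using that by (rule imageI)
      moreover have "\<forall>J\<in>components (julia_set S). Infinity \<notin> J \<longrightarrow> surrounded_by (Fin -` T) (Fin -` J)"
        using * unfolding is_J_min_def by (elim conjE)
      ultimately have "surrounded_by (Fin -` T) (Fin -` (Fin ` J))" using inf[of J] by blast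
      then show ?thesis by (simp only: M(1) vim)
    qed
    then show "\<exists>M \<in> components X. T = Fin ` M \<and> (\<forall>J \<in> components X. surrounded_by M J)"
      using M by (intro bexI[of _ M] conjI ballI)
  next
    assume "\<exists>M \<in> components X. T = Fin ` M \<and> (\<forall>J \<in> components X. surrounded_by M J)"
    then obtain M where M: "M \<in> components X" "T = Fin ` M" "\<forall>J \<in> components X. surrounded_by M J"
      by (elim bexE conjE)
    show "is_J_min S T"
      unfolding is_J_min_def julia_eq components_Fin_image
    proof (intro conjI ballI impI)
      show "T \<in> (`) Fin ` components X" using M(1,2) by (simp only: imageI)
      show "Infinity \<notin> T" using inf M(2) by (simp only: not_False_eq_True)
      fix J assume "J \<in> (`) Fin ` components X"
      then obtain J' where J': "J = Fin ` J'" "J' \<in> components X" by (rule imageE)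
      show "surrounded_by (Fin -` T) (Fin -` J)"
        using bspec[OF M(3) J'(2)] by (simp only: M(2) J'(1) vim)
    qed
  qed
qed

text \<open>Two minimal components would each lie inside the other and hence inside themselves; so
  the definite description of \<open>J_min\<close> denotes.\<close>

lemma J_min_props: "\<exists>M \<in> components X. J_min S = Fin ` M \<and> (\<forall>J \<in> components X. surrounded_by M J)"
proof -
  have "is_J_min S (J_min S)"
    unfolding J_min_def
  proof (rule theI')
    obtain M where M: "M \<in> components X" "\<forall>J \<in> components X. surrounded_by M J" using ex_J_min by blast
    show "\<exists>!T. is_J_min S T"
    proof
      show "is_J_min S (Fin ` M)" using M is_J_min_iff by blast
      fix T assume "is_J_min S T"
      then obtain N where N: "N \<in> components X" "T = Fin ` N" "\<forall>J \<in> components X. surrounded_by N J"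
        using is_J_min_iff by blast
      have "N = M"
      proof (rule ccontr)
        assume "N \<noteq> M"
        then have NM: "N \<subseteq> inside M" "M \<subseteq> inside N"
          using surrounded_inside M N by blast+
        have "inside M \<subseteq> inside N"
          by (rule inside_inside_compact_connected) (fact NM compX[OF M(1)] compX[OF N(1)])+
        then have "N \<subseteq> inside N" using NM by blast
        then show False using inside_no_overlap[of N] compX(3)[OF N(1)] by blast
      qed
      then show "T = Fin ` M" using N by simp
    qed
  qed
  then show ?thesis using is_J_min_iff by blast
qed

text \<open>The gap confines the component of \<open>z\<close> to the disc, and convexity of the
  disc confines everything this component encloses. The minimal component equals it or lies inside
  it.\<close>

lemma J_min_subset:
  assumes gap: "\<And>z. z \<in> X \<Longrightarrow> \<not> (s1 < cmod (z - b) \<and> cmod (z - b) < s2)" "s1 < s2"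
    and z: "z \<in> X" "cmod (z - b) \<le> s1"
  shows "J_min S \<subseteq> Fin ` cball b s1"
proof -
  define J where "J = connected_component_set X z"
  have J: "J \<in> components X" "z \<in> J" using z(1) by (auto simp: J_def components_def)
  obtain s where s: "s1 < s" "s < s2" using gap(2) dense by blast
  have split: "w \<in> cball b s1 \<or> w \<in> - cball b s" if "w \<in> X" for w
  proof -
    have "cmod (w - b) \<le> s1 \<or> s2 \<le> cmod (w - b)" using gap(1)[OF that] by linarith
    then show ?thesis using s by (auto simp: dist_cmod)
  qed
  have "J \<subseteq> cball b s1"
  proof -
    have "ball b s \<inter> J = {} \<or> - cball b s \<inter> J = {}"
    proof (rule connectedD)
      show "J \<subseteq> ball b s \<union> - cball b s" using split compX(4)[OF J(1)] s by fastforce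
    qed (use compX(2)[OF J(1)] in auto)
    moreover have "z \<in> ball b s" using z s by (simp add: dist_cmod)
    ultimately have "- cball b s \<inter> J = {}" using J by blast
    then show ?thesis using split compX(4)[OF J(1)] by blast
  qed
  then have "inside J \<subseteq> cball b s1"
    using outside_subset_convex[OF convex_cball, of J b s1] inside_Int_outside[of J] by blast
  obtain M where M: "M \<in> components X" "J_min S = Fin ` M" "surrounded_by M J"
    using J_min_props J(1) by blast
  then have "M \<subseteq> cball b s1"
    using surrounded_inside[of M J] \<open>J \<subseteq> cball b s1\<close> \<open>inside J \<subseteq> cball b s1\<close> by blast
  then show ?thesis using M by blast
qed

end

section \<open>Counting preimages\<close>

text \<open>The planar form of the sum inside \<open>covering_degree\<close>.\<close>

definition preimage_count :: "complex poly \<Rightarrow> complex set \<Rightarrow> complex \<Rightarrow> nat" where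
  "preimage_count p W y = (\<Sum>x\<in>{x \<in> W. poly p x = y}. order x (p - [:y:]))"

lemma minus_const_nonzero: "degree (p :: complex poly) \<ge> 1 \<Longrightarrow> p - [:y:] \<noteq> 0"
  by (metis degree_minus_const degree_0 not_one_le_zero)

lemma preimage_count_proots:
  assumes "degree p \<ge> 1"
  shows "preimage_count p W y = size (filter_mset (\<lambda>x. x \<in> W) (proots (p - [:y:])))"
proof -
  define q where "q = p - [:y:]"
  have q: "q \<noteq> 0" unfolding q_def using assms by (rule minus_const_nonzero)
  have "set_mset (filter_mset (\<lambda>x. x \<in> W) (proots q)) = {x \<in> W. poly p x = y}"
    using q by (auto simp: q_def)
  then have "size (filter_mset (\<lambda>x. x \<in> W) (proots q))
      = (\<Sum>x\<in>{x \<in> W. poly p x = y}. count (filter_mset (\<lambda>x. x \<in> W) (proots q)) x)"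
    by (simp only: size_multiset_overloaded_eq)
  also have "\<dots> = (\<Sum>x\<in>{x \<in> W. poly p x = y}. order x q)"
    using q by (intro sum.cong) auto
  finally show ?thesis by (simp add: preimage_count_def q_def)
qed

lemma preimage_count_mono:
  assumes "degree p \<ge> 1" "W \<subseteq> W'"
  shows "preimage_count p W y \<le> preimage_count p W' y"
  unfolding preimage_count_def
proof (rule sum_mono2)
  show "finite {x \<in> W'. poly p x = y}"
    using finite_poly_fibre[OF assms(1), of y] by (rule rev_finite_subset) blast
qed (use assms(2) in auto)

text \<open>Numbering the roots with repetitions turns the count into the size of an index set, a
  form that survives passage to a limit of roots.\<close>

lemma preimage_count_factored:
  fixes d :: nat
  assumes "degree p \<ge> 1" and eq: "smult c (\<Prod>j<d. [:- r j, 1:]) = p - [:y:]"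
  shows "preimage_count p W y = card {j. j < d \<and> r j \<in> W}"
proof -
  have "c \<noteq> 0" using minus_const_nonzero[OF assms(1), of y] eq by auto
  have "proots (p - [:y:]) = (\<Sum>j<d. {#r j#})"
    unfolding eq[symmetric] using \<open>c \<noteq> 0\<close> by (simp add: proots_prod)
  moreover have "size (filter_mset (\<lambda>x. x \<in> W) (\<Sum>j<d. {#r j#})) = card {j. j < d \<and> r j \<in> W}"
  proof (induction d)
    case (Suc d)
    have "{j. j < Suc d \<and> r j \<in> W} = (if r d \<in> W then insert d {j. j < d \<and> r j \<in> W} else {j. j < d \<and> r j \<in> W})"
      by (auto simp: less_Suc_eq)
    then show ?case using Suc by (simp add: size_union)
  qed simp
  ultimately show ?thesis by (simp only: preimage_count_proots[OF assms(1)])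
qed

lemma roots_factored:
  assumes "degree (p :: complex poly) \<ge> 1"
  shows "\<exists>r. smult (lead_coeff p) (\<Prod>j<degree p. [:- r j, 1:]) = p - [:y:]"
proof -
  obtain r where r: "smult (lead_coeff (p - [:y:])) (\<Prod>j<degree (p - [:y:]). [:- r j, 1:]) = p - [:y:]"
    using complex_poly_decompose'[of "p - [:y:]"] by blast
  moreover have "coeff (p - [:y:]) (degree p) = coeff p (degree p)"
    using assms by (simp add: coeff_eq_0)
  ultimately show ?thesis by (metis degree_minus_const)
qed

lemma preimage_count_UNIV:
  assumes "degree p \<ge> 1" shows "preimage_count p UNIV y = degree p"
proof -
  obtain r where "smult (lead_coeff p) (\<Prod>j<degree p. [:- r j, 1:]) = p - [:y:]"
    using roots_factored[OF assms] by blast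
  from preimage_count_factored[OF assms this, of UNIV] show ?thesis by simp
qed

lemma convergent_subsequence_finitely_many:
  fixes r :: "nat \<Rightarrow> nat \<Rightarrow> complex"
  assumes "\<And>n j. j < d \<Longrightarrow> cmod (r n j) \<le> B"
  shows "\<exists>s l. strict_mono s \<and> (\<forall>j<d. (\<lambda>n. r (s n) j) \<longlonglongrightarrow> l j)"
  using assms
proof (induction d)
  case 0
  then show ?case using strict_mono_id by blast
next
  case (Suc d)
  then obtain s l where s: "strict_mono s" "\<forall>j<d. (\<lambda>n. r (s n) j) \<longlonglongrightarrow> l j" by (metis less_Suc_eq)
  have "bounded (range (\<lambda>n. r (s n) d))" using Suc.prems by (auto simp: bounded_iff)
  then obtain m t where t: "strict_mono t" "((\<lambda>n. r (s n) d) \<circ> t) \<longlonglongrightarrow> m"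
    using bounded_imp_convergent_subsequence by blast
  have "(\<lambda>n. r ((s \<circ> t) n) j) \<longlonglongrightarrow> (l(d := m)) j" if "j < Suc d" for j
  proof (cases "j = d")
    case True then show ?thesis using t by (simp add: o_def)
  next
    case False
    then have "j < d" using that by simp
    then have "((\<lambda>n. r (s n) j) \<circ> t) \<longlonglongrightarrow> l j" using s(2) t(1) LIMSEQ_subseq_LIMSEQ by blast
    then show ?thesis using False by (simp add: o_def)
  qed
  moreover have "strict_mono (s \<circ> t)" using s t by (simp add: strict_mono_o)
  ultimately show ?case by blast
qed

text \<open>Continuity of the roots: they converge, after passing to a subsequence, as \<open>y\<close> does.\<close>

lemma preimage_count_locally_constant:
  assumes deg: "degree p \<ge> 1" and "open V" "open V'" "V \<inter> V' = {}"
    and roots: "\<And>x. poly p x = y0 \<Longrightarrow> x \<in> V \<or> x \<in> V'"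
  shows "\<exists>e>0. \<forall>y\<in>ball y0 e. preimage_count p V y = preimage_count p V y0"
proof (rule ccontr)
  assume neg: "\<not> ?thesis"
  have "\<exists>y. y \<in> ball y0 (inverse (Suc n)) \<and> preimage_count p V y \<noteq> preimage_count p V y0" for n
  proof -
    have "inverse (real (Suc n)) > 0" by simp
    with neg show ?thesis by blast
  qed
  then obtain y where y: "\<And>n. dist y0 (y n) < inverse (Suc n)"
    "\<And>n. preimage_count p V (y n) \<noteq> preimage_count p V y0"
    unfolding mem_ball by metis
  have ylim: "y \<longlonglongrightarrow> y0"
  proof (rule tendsto_dist_iff[THEN iffD2], rule Lim_null_comparison[OF _ LIMSEQ_inverse_real_of_nat])
    show "\<forall>\<^sub>F n in sequentially. norm (dist (y n) y0) \<le> inverse (real (Suc n))"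
      using y(1) by (intro always_eventually) (simp add: dist_commute less_imp_le)
  qed
  define d where "d = degree p"
  define c where "c = lead_coeff p"
  have "\<forall>n. \<exists>r. smult c (\<Prod>j<d. [:- r j, 1:]) = p - [:y n:]"
    unfolding c_def d_def by (intro allI roots_factored[OF deg])
  from choice[OF this] obtain r where r: "\<And>n. smult c (\<Prod>j<d. [:- r n j, 1:]) = p - [:y n:]"
    by blast
  have "c \<noteq> 0" using deg unfolding c_def by auto
  have peq: "poly p z - y n = c * (\<Prod>j<d. z - r n j)" for z n
  proof -
    have "poly p z - y n = poly (p - [:y n:]) z" by simp
    also have "\<dots> = poly (smult c (\<Prod>j<d. [:- r n j, 1:])) z" by (simp only: r)
    finally show ?thesis by (simp add: poly_prod)
  qed
  have proot: "poly p (r n j) = y n" if "j < d" for n j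
  proof -
    have "(\<Prod>i<d. r n j - r n i) = 0" using that by (intro prod_zero) auto
    then have "poly p (r n j) - y n = 0" by (simp only: peq mult_zero_right)
    then show ?thesis by simp
  qed
  have "bounded (poly p -` cball y0 1)" by (intro bounded_poly_vimage deg) auto
  then obtain B where B: "\<And>x. x \<in> poly p -` cball y0 1 \<Longrightarrow> cmod x \<le> B" unfolding bounded_iff by blast
  have "cmod (r n j) \<le> B" if "j < d" for n j
  proof (rule B)
    have "inverse (real (Suc n)) \<le> 1" by (simp add: inverse_le_1_iff)
    then show "r n j \<in> poly p -` cball y0 1" using proot[OF that, of n] y(1)[of n] by simp
  qed
  then obtain s l where s: "strict_mono s" and l: "\<And>j. j < d \<Longrightarrow> (\<lambda>n. r (s n) j) \<longlonglongrightarrow> l j"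
    using convergent_subsequence_finitely_many[of d r B] by blast
  have ys: "(\<lambda>n. y (s n)) \<longlonglongrightarrow> y0" using LIMSEQ_subseq_LIMSEQ[OF ylim s] by (simp add: o_def)
  have leqz: "poly p z - y0 = c * (\<Prod>j<d. z - l j)" for z
  proof (rule LIMSEQ_unique)
    show "(\<lambda>n. c * (\<Prod>j<d. z - r (s n) j)) \<longlonglongrightarrow> c * (\<Prod>j<d. z - l j)"
      by (intro tendsto_mult tendsto_prod tendsto_diff tendsto_const) (use l in auto)
    have "(\<lambda>n. poly p z - y (s n)) \<longlonglongrightarrow> poly p z - y0"
      by (intro tendsto_diff tendsto_const ys)
    then show "(\<lambda>n. c * (\<Prod>j<d. z - r (s n) j)) \<longlonglongrightarrow> poly p z - y0"
      by (simp only: peq)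
  qed
  have leq: "smult c (\<Prod>j<d. [:- l j, 1:]) = p - [:y0:]"
  proof (rule poly_eq_poly_eq_iff[THEN iffD1], rule ext)
    show "poly (smult c (\<Prod>j<d. [:- l j, 1:])) z = poly (p - [:y0:]) z" for z
      using leqz[of z] by (simp add: poly_prod)
  qed
  have lroot: "poly p (l j) = y0" if "j < d" for j
  proof -
    have "(\<Prod>i<d. l j - l i) = 0" using that by (intro prod_zero) auto
    then have "poly p (l j) - y0 = 0" by (simp only: leqz mult_zero_right)
    then show ?thesis by simp
  qed
  \<comment> \<open>A limit root lies in one of the disjoint open sets \<open>V\<close> and
    \<open>V'\<close>, so the approximating roots eventually agree with it about membership in
    \<open>V\<close>.\<close>
  have ev: "\<forall>\<^sub>F n in sequentially. r (s n) j \<in> V \<longleftrightarrow> l j \<in> V" if j: "j < d" for j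
  proof (cases "l j \<in> V")
    case True
    then show ?thesis using topological_tendstoD[OF l[OF j] \<open>open V\<close>] by simp
  next
    case False
    then have "l j \<in> V'" using roots lroot[OF j] by blast
    then have "\<forall>\<^sub>F n in sequentially. r (s n) j \<in> V'" using topological_tendstoD[OF l[OF j] \<open>open V'\<close>] by simp
    then show ?thesis using False assms(4) by (auto elim!: eventually_mono)
  qed
  have "\<forall>\<^sub>F n in sequentially. \<forall>j\<in>{..<d}. r (s n) j \<in> V \<longleftrightarrow> l j \<in> V"
    using ev by (intro eventually_ball_finite) auto
  then obtain n where n: "\<forall>j\<in>{..<d}. r (s n) j \<in> V \<longleftrightarrow> l j \<in> V"
    using eventually_happens'[OF sequentially_bot] by blast
  then have "{j. j < d \<and> r (s n) j \<in> V} = {j. j < d \<and> l j \<in> V}" by auto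
  then have "preimage_count p V (y (s n)) = preimage_count p V y0"
    by (simp only: preimage_count_factored[OF deg r] preimage_count_factored[OF deg leq])
  with y(2) show False by blast
qed

section \<open>Spherical balls\<close>

text \<open>Completing the square. The planar part of a spherical ball is given by such a quadratic
  inequality, so up to degenerate cases it is a disc, a half-plane or the exterior of a
  disc.\<close>

lemma quadratic_form_eq:
  fixes z \<zeta> :: complex
  assumes "\<alpha> \<noteq> 0"
  shows "\<alpha> * (cmod z)\<^sup>2 + 2 * (z \<bullet> \<zeta>) + \<beta>
    = \<alpha> * ((cmod (z - (- (1 / \<alpha>) *\<^sub>R \<zeta>)))\<^sup>2 - ((cmod \<zeta>)\<^sup>2 / \<alpha>\<^sup>2 - \<beta> / \<alpha>))"
proof -
  have "(cmod (z + (1 / \<alpha>) *\<^sub>R \<zeta>))\<^sup>2 = (cmod z)\<^sup>2 + 2 / \<alpha> * (z \<bullet> \<zeta>) + (cmod \<zeta>)\<^sup>2 / \<alpha>\<^sup>2"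
    unfolding power2_norm_eq_inner
    by (simp add: inner_add_left inner_add_right inner_commute power2_eq_square)
  then show ?thesis using assms by (simp add: field_simps power2_eq_square)
qed

lemma sublevel_convex:
  assumes "\<alpha> \<ge> 0"
  shows "convex {z :: complex. \<alpha> * (cmod z)\<^sup>2 + 2 * (z \<bullet> \<zeta>) + \<beta> < 0}"
    and "convex {z :: complex. \<alpha> * (cmod z)\<^sup>2 + 2 * (z \<bullet> \<zeta>) + \<beta> \<le> 0}"
proof -
  have dist2: "{z. (cmod (z - w))\<^sup>2 < t} = (if t > 0 then ball w (sqrt t) else {})"
    "{z. (cmod (z - w))\<^sup>2 \<le> t} = (if t \<ge> 0 then cball w (sqrt t) else {})" for w :: complex and t
  proof -
    have "(cmod (z - w))\<^sup>2 < t \<longleftrightarrow> cmod (z - w) < sqrt t" "(cmod (z - w))\<^sup>2 \<le> t \<longleftrightarrow> cmod (z - w) \<le> sqrt t"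
      if "t \<ge> 0" for z
      using that real_less_rsqrt real_le_rsqrt real_sqrt_less_iff real_sqrt_le_iff
      by (metis norm_ge_zero real_sqrt_unique real_sqrt_less_iff, metis norm_ge_zero real_sqrt_unique real_sqrt_le_iff)
    moreover have "\<not> (cmod (z - w))\<^sup>2 < t" if "t \<le> 0" for z using that zero_le_power2[of "cmod (z - w)"] by linarith
    moreover have "\<not> (cmod (z - w))\<^sup>2 \<le> t" if "t < 0" for z using that zero_le_power2[of "cmod (z - w)"] by linarith
    ultimately show "{z. (cmod (z - w))\<^sup>2 < t} = (if t > 0 then ball w (sqrt t) else {})"
      "{z. (cmod (z - w))\<^sup>2 \<le> t} = (if t \<ge> 0 then cball w (sqrt t) else {})"
      by (auto simp: dist_cmod not_less not_le)
  qed
  show "convex {z :: complex. \<alpha> * (cmod z)\<^sup>2 + 2 * (z \<bullet> \<zeta>) + \<beta> < 0}"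
  proof (cases "\<alpha> = 0")
    case True
    have "{z :: complex. 2 * (z \<bullet> \<zeta>) + \<beta> < 0} = {z. \<zeta> \<bullet> z < - \<beta> / 2}" by (auto simp: inner_commute)
    then show ?thesis using True by (simp add: convex_halfspace_lt)
  next
    case False
    then have "\<alpha> > 0" using assms by simp
    then have "\<alpha> * (t - s) < 0 \<longleftrightarrow> t < s" for t s by (simp add: mult_less_0_iff)
    then show ?thesis unfolding quadratic_form_eq[OF False] dist2 by (simp only: dist2) simp
  qed
  show "convex {z :: complex. \<alpha> * (cmod z)\<^sup>2 + 2 * (z \<bullet> \<zeta>) + \<beta> \<le> 0}"
  proof (cases "\<alpha> = 0")
    case True
    have "{z :: complex. 2 * (z \<bullet> \<zeta>) + \<beta> \<le> 0} = {z. \<zeta> \<bullet> z \<le> - \<beta> / 2}" by (auto simp: inner_commute)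
    then show ?thesis using True by (simp add: convex_halfspace_le)
  next
    case False
    then have "\<alpha> > 0" using assms by simp
    then have "\<alpha> * (t - s) \<le> 0 \<longleftrightarrow> t \<le> s" for t s by (simp add: mult_le_0_iff)
    then show ?thesis unfolding quadratic_form_eq[OF False] dist2 by (simp only: dist2) simp
  qed
qed

lemma sublevel_bounded:
  assumes "\<alpha> > 0"
  shows "bounded {z :: complex. \<alpha> * (cmod z)\<^sup>2 + 2 * (z \<bullet> \<zeta>) + \<beta> \<le> 0}"
proof -
  define s where "s = (cmod \<zeta>)\<^sup>2 / \<alpha>\<^sup>2 - \<beta> / \<alpha>"
  define w where "w = - (1 / \<alpha>) *\<^sub>R \<zeta>"
  have "z \<in> cball w (sqrt s)" if "\<alpha> * (cmod z)\<^sup>2 + 2 * (z \<bullet> \<zeta>) + \<beta> \<le> 0" for z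
  proof -
    have "\<alpha> * ((cmod (z - w))\<^sup>2 - s) \<le> 0"
      using that assms quadratic_form_eq[of \<alpha> z \<zeta> \<beta>] by (simp add: s_def w_def)
    then have "(cmod (z - w))\<^sup>2 \<le> s" using assms by (simp add: mult_le_0_iff)
    then have "cmod (z - w) \<le> sqrt s" by (rule real_le_rsqrt)
    then show ?thesis by (simp add: dist_cmod)
  qed
  then show ?thesis by (intro bounded_subset[OF bounded_cball[of w "sqrt s"]]) blast
qed

text \<open>Infinity is a limit point of the image because the complement of \<open>C\<close> is
  bounded, and a set between a connected set and its closure is connected.\<close>

lemma connected_with_Infinity:
  assumes "connected C" "bounded (- C)"
  shows "connected (insert Infinity (Fin ` C))"
proof (rule connected_intermediate_closure)
  show "connected (Fin ` C)" by (intro connected_continuous_image continuous_on_Fin assms)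
  have "Infinity \<in> closure (Fin ` C)"
    unfolding closure_iff_nhds_not_empty
  proof (intro allI impI)
    fix A S assume S: "S \<subseteq> A" "open S" "Infinity \<in> S"
    then obtain \<rho> where \<rho>: "\<And>z. cmod z \<ge> \<rho> \<Longrightarrow> Fin z \<in> S" using Infinity_nbhd by metis
    obtain B where B: "\<And>z. z \<in> - C \<Longrightarrow> cmod z \<le> B" using assms(2) unfolding bounded_iff by blast
    define z where "z = complex_of_real (max (\<bar>\<rho>\<bar>) (\<bar>B\<bar> + 1))"
    have "cmod z \<ge> \<rho>" "cmod z > B" by (auto simp: z_def)
    then have "Fin z \<in> S" "z \<in> C" using \<rho> B by force+
    then show "Fin ` C \<inter> A \<noteq> {}" using S(1) by blast
  qed
  then show "insert Infinity (Fin ` C) \<subseteq> closure (Fin ` C)" by (simp add: closure_subset)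
qed blast

lemma connected_UNIV_sphere: "connected (UNIV :: riemann_sphere set)"
proof -
  have eq: "UNIV = insert Infinity (Fin ` UNIV)" using sphere_minus_Infinity by blast
  show ?thesis by (subst eq) (rule connected_with_Infinity[OF connected_UNIV], simp)
qed

lemma sphere_set_eq:
  shows "Infinity \<notin> A \<Longrightarrow> A = Fin ` (Fin -` A)"
    and "Infinity \<in> A \<Longrightarrow> A = insert Infinity (Fin ` (Fin -` A))"
proof -
  have *: "x \<in> Fin ` (Fin -` A)" if "x \<in> A" "x \<noteq> Infinity" for x
    using that by (cases x) auto
  show "Infinity \<notin> A \<Longrightarrow> A = Fin ` (Fin -` A)" using * by blast
  show "Infinity \<in> A \<Longrightarrow> A = insert Infinity (Fin ` (Fin -` A))" using * by blast
qed

text \<open>Distance below \<delta> means that the inner product exceeds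
  \<open>c = cos \<delta>\<close>. Cleared of the denominator \<open>1 + |z|^2\<close> this is a
  quadratic inequality with leading coefficient \<open>c - h\<close>, where \<open>h\<close> is the
  height of the centre. For \<open>c \<ge> h\<close> the ball is a convex planar set; otherwise it
  contains infinity and omits a bounded convex set.\<close>

lemma connected_sphere_ball: "connected (ball (y :: riemann_sphere) \<delta>)"
proof (cases "\<delta> > pi")
  case True
  then have "dist y x < \<delta>" for x by (rule le_less_trans[OF dist_riemann_sphere_le_pi])
  then have "ball y \<delta> = UNIV" by auto
  then show ?thesis by (simp add: connected_UNIV_sphere)
next
  case False
  show ?thesis
  proof (cases "\<delta> > 0")
    case True
    define c where "c = cos \<delta>"
    obtain \<zeta> h where v: "sphere_point y = (\<zeta>, h)" by (cases "sphere_point y")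
    have ball_iff: "x \<in> ball y \<delta> \<longleftrightarrow> c < sphere_point y \<bullet> sphere_point x" for x
    proof -
      have "arccos (cos \<delta>) = \<delta>" using True False by (intro arccos_cos) auto
      then show ?thesis
        using arccos_less_mono[of "sphere_point y \<bullet> sphere_point x" "cos \<delta>"] abs_inner_sphere_point[of y x]
        by (simp add: dist_riemann_sphere_def c_def abs_cos_le_one)
    qed
    have Fin_iff: "Fin z \<in> ball y \<delta> \<longleftrightarrow> (c - h) * (cmod z)\<^sup>2 + 2 * (z \<bullet> (- \<zeta>)) + (c + h) < 0" for z
    proof -
      define t where "t = (cmod z)\<^sup>2"
      have t: "1 + t > 0" by (simp add: t_def add_pos_nonneg)
      have "sphere_point y \<bullet> sphere_point (Fin z) = (2 * (\<zeta> \<bullet> z) + h * (t - 1)) / (1 + t)"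
        using t by (simp add: v t_def[symmetric] add.commute add_divide_distrib)
      then have "Fin z \<in> ball y \<delta> \<longleftrightarrow> c * (1 + t) < 2 * (\<zeta> \<bullet> z) + h * (t - 1)"
        unfolding ball_iff using t by (simp add: less_divide_eq)
      also have "\<dots> \<longleftrightarrow> (c - h) * t + 2 * (z \<bullet> (- \<zeta>)) + (c + h) < 0"
        by (simp add: inner_commute algebra_simps)
      finally show ?thesis by (simp add: t_def)
    qed
    have inf_iff: "Infinity \<in> ball y \<delta> \<longleftrightarrow> c < h" unfolding ball_iff by (simp add: v)
    show ?thesis
    proof (cases "c < h")
      case False
      define C where "C = {z :: complex. (c - h) * (cmod z)\<^sup>2 + 2 * (z \<bullet> (- \<zeta>)) + (c + h) < 0}"
      have "convex C" unfolding C_def by (rule sublevel_convex) (use False in simp)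
      moreover have "ball y \<delta> = Fin ` C"
      proof -
        have "Fin -` ball y \<delta> = C" using Fin_iff unfolding C_def by blast
        moreover have "Infinity \<notin> ball y \<delta>" using inf_iff False by blast
        ultimately show ?thesis using sphere_set_eq(1) by blast
      qed
      ultimately show ?thesis
        by (simp add: connected_continuous_image continuous_on_Fin convex_connected)
    next
      case True
      define D where "D = {z :: complex. (h - c) * (cmod z)\<^sup>2 + 2 * (z \<bullet> \<zeta>) + (- c - h) \<le> 0}"
      have D: "bounded D" "convex D"
        unfolding D_def using True sublevel_bounded[of "h - c" \<zeta> "- c - h"] sublevel_convex(2)[of "h - c" \<zeta> "- c - h"] by auto
      have "Fin z \<in> ball y \<delta> \<longleftrightarrow> z \<in> - D" for z
        unfolding Fin_iff D_def by (simp add: algebra_simps not_le)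
      then have "Fin -` ball y \<delta> = - D" by blast
      moreover have "Infinity \<in> ball y \<delta>" using inf_iff True by blast
      ultimately have "ball y \<delta> = insert Infinity (Fin ` (- D))" using sphere_set_eq(2)[of "ball y \<delta>"] by metis
      then show ?thesis
        using connected_with_Infinity[of "- D"] connected_complement_bounded_convex[OF D] D by simp
    qed
  qed (simp add: ball_empty)
qed

text \<open>Connected balls make the sphere locally connected. The disjoint open sets
  \<open>W\<close> and \<open>P - W\<close> are the pair that continuity of roots asks for.\<close>

lemma open_components_sphere:
  fixes P :: "riemann_sphere set"
  assumes "open P" "W \<in> components P"
  shows "open W" "open (P - W)"
proof -
  have op: "open W" if "W \<in> components P" for W
    unfolding open_contains_ball
  proof
    fix x assume x: "x \<in> W"
    then have "x \<in> P" using that in_components_subset by blast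
    then obtain e where e: "e > 0" "ball x e \<subseteq> P" using assms(1) by (meson open_contains_ball)
    moreover have "ball x e \<subseteq> W"
      using components_maximal[OF that connected_sphere_ball e(2)] x centre_in_ball[of x e] e(1) by blast
    ultimately show "\<exists>e>0. ball x e \<subseteq> W" by blast
  qed
  then show "open W" using assms(2) by blast
  have "P - W = \<Union> (components P - {W})"
  proof -
    have U: "\<Union> (components P) = P" by (rule Union_components)
    have "C \<inter> W = {}" if "C \<in> components P - {W}" for C
      using that components_nonoverlap[of C P W] assms(2) by simp
    then have 1: "\<Union> (components P - {W}) \<inter> W = {}" by (simp only: Int_Union2) simp
    have "\<Union> (components P) = W \<union> \<Union> (components P - {W})" using assms(2) by blast
    then have 2: "P = W \<union> \<Union> (components P - {W})" by (simp only: U)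
    have "P - W = (W \<union> A) - W" if "P = W \<union> A" for A using that by (rule arg_cong)
    from this[OF 2] have "P - W = \<Union> (components P - {W}) - W" by (simp only: Un_Diff Diff_cancel Un_empty_left)
    also have "\<dots> = \<Union> (components P - {W})" using 1 by (rule Diff_triv)
    finally show ?thesis .
  qed
  then show "open (P - W)" using op by auto
qed

section \<open>The covering degree\<close>

definition sphere_count :: "complex poly \<Rightarrow> riemann_sphere set \<Rightarrow> riemann_sphere \<Rightarrow> nat" where
  "sphere_count p W y = (\<Sum>x\<in>{x \<in> W. sphere_map p x = y}. local_degree p x)"

lemma sphere_count_Fin:
  assumes "degree p \<ge> 1"
  shows "sphere_count p W (Fin y) = preimage_count p (Fin -` W) y"
proof -
  have "{x \<in> W. sphere_map p x = Fin y} = Fin ` {x \<in> Fin -` W. poly p x = y}"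
  proof
    show "{x \<in> W. sphere_map p x = Fin y} \<subseteq> Fin ` {x \<in> Fin -` W. poly p x = y}"
    proof
      fix x assume "x \<in> {x \<in> W. sphere_map p x = Fin y}"
      then show "x \<in> Fin ` {x \<in> Fin -` W. poly p x = y}" using assms by (cases x) auto
    qed
  qed auto
  then show ?thesis
    unfolding sphere_count_def preimage_count_def
    by (simp add: sum.reindex inj_Fin)
qed

lemma sphere_count_Infinity:
  assumes "degree p \<ge> 1"
  shows "sphere_count p W Infinity = (if Infinity \<in> W then degree p else 0)"
proof -
  have "x = Infinity" if "sphere_map p x = Infinity" for x using that by (cases x) auto
  then have "{x \<in> W. sphere_map p x = Infinity} = (if Infinity \<in> W then {Infinity} else {})"
    using assms by auto
  then show ?thesis by (simp add: sphere_count_def)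
qed

lemma preimage_count_empty:
  assumes "\<And>x. poly p x = y \<Longrightarrow> x \<notin> W" shows "preimage_count p W y = 0"
  unfolding preimage_count_def using assms by (metis (mono_tags, lifting) empty_Collect_eq sum.empty)

lemma preimage_count_cong:
  assumes "\<And>x. poly p x = y \<Longrightarrow> x \<in> W \<longleftrightarrow> x \<in> W'" shows "preimage_count p W y = preimage_count p W' y"
  unfolding preimage_count_def using assms by (intro sum.cong) auto

text \<open>At a finite point the roots split between \<open>W\<close> and the rest of the preimage.
  Near infinity all preimages of a point are themselves near infinity, so the count is the full
  degree or 0 according to whether \<open>W\<close> contains infinity.\<close>

lemma sphere_count_locally_constant:
  assumes deg: "degree p \<ge> 1" and B: "open B" "z \<in> B" and W: "W \<in> components (sphere_map p -` B)"
  shows "\<exists>N. open N \<and> z \<in> N \<and> (\<forall>y\<in>N. sphere_count p W y = sphere_count p W z)"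
proof -
  define P where "P = sphere_map p -` B"
  have "open P" unfolding P_def using continuous_on_sphere_map[of UNIV p] B(1) by (intro open_vimage) auto
  then have op: "open W" "open (P - W)" using open_components_sphere W by (auto simp: P_def)
  show ?thesis
  proof (cases z)
    case (Fin y0)
    have "\<exists>e>0. \<forall>y\<in>ball y0 e. preimage_count p (Fin -` W) y = preimage_count p (Fin -` W) y0"
    proof (rule preimage_count_locally_constant[OF deg, of _ "Fin -` (P - W)"])
      fix x assume "poly p x = y0"
      then have "Fin x \<in> P" using B Fin by (simp add: P_def)
      then show "x \<in> Fin -` W \<or> x \<in> Fin -` (P - W)" by auto
    qed (use op open_vimage_Fin in auto)
    then obtain e where e: "e > 0"
      "\<And>y. y \<in> ball y0 e \<Longrightarrow> preimage_count p (Fin -` W) y = preimage_count p (Fin -` W) y0" by blast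
    show ?thesis
    proof (intro exI[of _ "Fin ` ball y0 e"] conjI ballI)
      show "open (Fin ` ball y0 e)" by (rule open_Fin[OF open_ball])
      show "z \<in> Fin ` ball y0 e" using Fin e(1) by simp
      fix y assume "y \<in> Fin ` ball y0 e"
      then obtain w where w: "y = Fin w" "w \<in> ball y0 e" by (rule imageE)
      show "sphere_count p W y = sphere_count p W z"
        unfolding w(1) Fin sphere_count_Fin[OF deg] by (rule e(2)[OF w(2)])
    qed
  next
    case Infinity
    \<comment> \<open>Since \<open>p\<close> is bounded on discs, a point with a large image must
      itself be close to infinity.\<close>
    have ex: "\<exists>\<rho>. \<forall>x. poly p x \<notin> cball 0 \<rho> \<longrightarrow> Fin x \<in> Q" if Q: "open Q" "Infinity \<in> Q" for Q
    proof -
      obtain \<sigma> where \<sigma>: "\<And>x. cmod x \<ge> \<sigma> \<Longrightarrow> Fin x \<in> Q" using Infinity_nbhd[OF Q] by blast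
      have "bounded (poly p ` cball 0 \<sigma>)"
        by (intro compact_imp_bounded compact_continuous_image continuous_on_poly' compact_cball)
      then obtain \<rho> where \<rho>: "\<And>x. x \<in> cball 0 \<sigma> \<Longrightarrow> cmod (poly p x) \<le> \<rho>" unfolding bounded_iff by blast
      show ?thesis
      proof (intro exI[of _ \<rho>] allI impI)
        fix x assume x: "poly p x \<notin> cball 0 \<rho>"
        then have "x \<notin> cball 0 \<sigma>" using \<rho> by auto
        then show "Fin x \<in> Q" by (intro \<sigma>) simp
      qed
    qed
    show ?thesis
    proof (cases "Infinity \<in> W")
      case True
      then obtain \<rho> where \<rho>: "\<And>x. poly p x \<notin> cball 0 \<rho> \<Longrightarrow> Fin x \<in> W" using ex op(1) by blast
      have "sphere_count p W y = degree p" if "y \<in> - (Fin ` cball 0 \<rho>)" for y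
      proof (cases y)
        case (Fin w)
        then have "w \<notin> cball 0 \<rho>" using that by blast
        then have "preimage_count p (Fin -` W) w = preimage_count p UNIV w"
          using \<rho> by (intro preimage_count_cong) auto
        then show ?thesis using Fin deg by (simp add: sphere_count_Fin preimage_count_UNIV)
      qed (use True deg in \<open>simp add: sphere_count_Infinity\<close>)
      moreover have "sphere_count p W z = degree p"
        using True deg Infinity by (simp add: sphere_count_Infinity)
      ultimately show ?thesis
        using Infinity open_Infinity_nbhd[of 0 \<rho>] by (intro exI[of _ "- (Fin ` cball 0 \<rho>)"]) auto
    next
      case False
      have "Infinity \<in> P - W" using False B Infinity deg by (simp add: P_def)
      then obtain \<rho> where \<rho>: "\<And>x. poly p x \<notin> cball 0 \<rho> \<Longrightarrow> Fin x \<in> P - W" using ex op(2) by blast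
      have "sphere_count p W y = 0" if "y \<in> - (Fin ` cball 0 \<rho>)" for y
      proof (cases y)
        case (Fin w)
        then have "w \<notin> cball 0 \<rho>" using that by blast
        then have "preimage_count p (Fin -` W) w = 0"
          using \<rho> by (intro preimage_count_empty) auto
        then show ?thesis using Fin deg by (simp add: sphere_count_Fin)
      qed (use False deg in \<open>simp add: sphere_count_Infinity\<close>)
      moreover have "sphere_count p W z = 0"
        using False deg Infinity by (simp add: sphere_count_Infinity)
      ultimately show ?thesis
        using Infinity open_Infinity_nbhd[of 0 \<rho>] by (intro exI[of _ "- (Fin ` cball 0 \<rho>)"]) auto
    qed
  qed
qed

text \<open>A locally constant count on a connected ball is constant, so the definite description in
  \<open>covering_degree\<close> denotes, and any point of the ball computes it.\<close>

lemma covering_degree_eq: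
  assumes deg: "degree p \<ge> 1" and W: "W \<in> components (sphere_map p -` ball x \<delta>)" and y: "y \<in> ball x \<delta>"
  shows "covering_degree p W (ball x \<delta>) = sphere_count p W y"
proof -
  have const: "sphere_count p W z = sphere_count p W y" if "z \<in> ball x \<delta>" for z
  proof (rule connected_local_const[OF connected_sphere_ball that y], rule ballI)
    fix a assume a: "a \<in> ball x \<delta>"
    obtain N where N: "open N" "a \<in> N" "\<forall>y\<in>N. sphere_count p W y = sphere_count p W a"
      using sphere_count_locally_constant[OF deg open_ball a W] by blast
    then show "\<forall>\<^sub>F b in at a within ball x \<delta>. sphere_count p W a = sphere_count p W b"
      unfolding eventually_at_topological
    proof (intro exI[of _ N] conjI ballI impI)
      fix x assume "x \<in> N"
      then show "sphere_count p W a = sphere_count p W x" by (rule bspec[OF N(3), symmetric])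
    qed (rule N)+
  qed
  show ?thesis
    unfolding covering_degree_def
  proof (rule the_equality)
    show "\<forall>z\<in>ball x \<delta>. (\<Sum>v | v \<in> W \<and> sphere_map p v = z. local_degree p v) = sphere_count p W y"
      unfolding sphere_count_def[symmetric] by (intro ballI const)
    fix n assume "\<forall>z\<in>ball x \<delta>. (\<Sum>v | v \<in> W \<and> sphere_map p v = z. local_degree p v) = n"
    from bspec[OF this y] show "n = sphere_count p W y" by (simp only: sphere_count_def)
  qed
qed

section \<open>Uniformly bounded multiplicity near the boundary\<close>

lemma order_eq_1:
  fixes q :: "complex poly"
  assumes "q \<noteq> 0" "poly q x = 0" "poly (pderiv q) x \<noteq> 0"
  shows "order x q = 1"
  using order_pderiv[OF assms(1,2)] order_0I[OF assms(3)] by simp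

lemma preimage_count_le_1:
  assumes deg: "degree p \<ge> 1" and inj: "inj_on (poly p) W" and y: "y \<notin> crit_vals p"
  shows "preimage_count p W y \<le> 1"
proof (cases "\<exists>x\<in>W. poly p x = y")
  case True
  then obtain x where x: "x \<in> W" "poly p x = y" by blast
  have "{x' \<in> W. poly p x' = y} = {x}"
    using inj_onD[OF inj] x by blast
  then have "preimage_count p W y = order x (p - [:y:])" by (simp add: preimage_count_def)
  also have "\<dots> = 1"
  proof (rule order_eq_1)
    show "p - [:y:] \<noteq> 0" by (rule minus_const_nonzero[OF deg])
    show "poly (pderiv (p - [:y:])) x \<noteq> 0"
      using x y by (auto simp: crit_vals_def pderiv_diff pderiv_pCons)
  qed (use x in simp)
  finally show ?thesis by simp
next
  case False
  then have "preimage_count p W y = 0" by (intro preimage_count_empty) blast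
  then show ?thesis by simp
qed

text \<open>Write \<open>q = (X - a)^k B\<close> with \<open>a = u(x)\<close> and \<open>B\<close>
  nonzero at \<open>a\<close>. An unramified \<open>u\<close> turns \<open>X - a\<close> into a
  polynomial with a simple zero at \<open>x\<close>.\<close>

lemma order_pcompose_unramified:
  fixes q u :: "complex poly"
  assumes q: "q \<noteq> 0" and u: "poly (pderiv u) x \<noteq> 0" and nz: "q \<circ>\<^sub>p u \<noteq> 0"
  shows "order x (q \<circ>\<^sub>p u) = order (poly u x) q"
proof -
  define a where "a = poly u x"
  define k where "k = order a q"
  obtain B where B: "q = [:- a, 1:] ^ k * B" "\<not> [:- a, 1:] dvd B"
    using order_decomp[OF q, of a] unfolding k_def by blast
  define v where "v = u - [:a:]"
  have qu: "q \<circ>\<^sub>p u = v ^ k * (B \<circ>\<^sub>p u)"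
  proof -
    have "[:- a, 1:] \<circ>\<^sub>p u = v" by (simp add: v_def pcompose_pCons)
    moreover have "(f ^ j) \<circ>\<^sub>p u = (f \<circ>\<^sub>p u) ^ j" for f :: "complex poly" and j
      by (induction j) (simp_all add: pcompose_mult pcompose_1)
    ultimately have "([:- a, 1:] ^ k) \<circ>\<^sub>p u = v ^ k" by metis
    moreover have "q \<circ>\<^sub>p u = ([:- a, 1:] ^ k * B) \<circ>\<^sub>p u" by (rule arg_cong[OF B(1)])
    ultimately show ?thesis by (simp only: pcompose_mult)
  qed
  have "pderiv v = pderiv u" by (simp add: v_def pderiv_diff pderiv_pCons)
  then have v0: "v \<noteq> 0" using u by auto
  have "order x v = 1"
    by (rule order_eq_1[OF v0]) (use u \<open>pderiv v = pderiv u\<close> in \<open>auto simp: v_def a_def\<close>)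
  moreover have "order x (v ^ j) = j * order x v" for j
    using v0 by (induction j) (simp_all add: order_mult order_0I)
  moreover have "order x (B \<circ>\<^sub>p u) = 0"
    by (rule order_0I) (use B(2) in \<open>simp add: poly_pcompose a_def[symmetric] poly_eq_0_iff_dvd\<close>)
  ultimately have "order x (q \<circ>\<^sub>p u) = k"
    using nz unfolding qu by (simp add: order_mult)
  then show ?thesis by (simp add: k_def a_def)
qed

text \<open>An injective unramified inner map matches the roots of the composite in \<open>W\<close>
  with the roots of \<open>g\<close> in the image, multiplicities included; in this way a composite
  inherits a bound known for \<open>g\<close>.\<close>

lemma preimage_count_pcompose:
  assumes deg: "degree g \<ge> 1" "degree u \<ge> 1" and inj: "inj_on (poly u) W"
    and unram: "\<And>x. x \<in> W \<Longrightarrow> poly (pderiv u) x \<noteq> 0"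
  shows "preimage_count (g \<circ>\<^sub>p u) W y = preimage_count g (poly u ` W) y"
proof -
  have "degree (g \<circ>\<^sub>p u) \<ge> 1" using deg by (simp add: degree_pcompose Suc_le_eq)
  then have nz: "g \<circ>\<^sub>p u - [:y:] \<noteq> 0" by (rule minus_const_nonzero)
  have eq: "g \<circ>\<^sub>p u - [:y:] = (g - [:y:]) \<circ>\<^sub>p u" by (simp add: pcompose_diff pcompose_pCons)
  define A where "A = {x \<in> W. poly (g \<circ>\<^sub>p u) x = y}"
  have "preimage_count (g \<circ>\<^sub>p u) W y = (\<Sum>x\<in>A. order (poly u x) (g - [:y:]))"
    unfolding preimage_count_def A_def[symmetric]
  proof (rule sum.cong)
    fix x assume "x \<in> A"
    then have "x \<in> W" by (simp add: A_def)
    show "order x (g \<circ>\<^sub>p u - [:y:]) = order (poly u x) (g - [:y:])"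
      unfolding eq
      by (rule order_pcompose_unramified[OF minus_const_nonzero[OF deg(1)] unram[OF \<open>x \<in> W\<close>]])
         (use nz eq in simp)
  qed simp
  also have "\<dots> = (\<Sum>z\<in>poly u ` A. order z (g - [:y:]))"
    by (subst sum.reindex) (auto simp: A_def intro: inj_on_subset[OF inj])
  also have "poly u ` A = {z \<in> poly u ` W. poly g z = y}"
    by (auto simp: A_def poly_pcompose)
  finally show ?thesis by (simp add: preimage_count_def)
qed

text \<open>The identity map \<open>[:0, 1:]\<close> is adjoined to account for the empty word.\<close>

definition bounded_multiplicity :: "complex poly set \<Rightarrow> complex set \<Rightarrow> real \<Rightarrow> nat \<Rightarrow> bool" where
  "bounded_multiplicity F Z \<epsilon> N \<longleftrightarrow> (\<forall>\<zeta>\<in>Z. \<forall>g\<in>insert [:0, 1:] F. \<forall>W y.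
     connected W \<longrightarrow> W \<subseteq> poly g -` ball \<zeta> \<epsilon> \<longrightarrow> y \<in> ball \<zeta> \<epsilon> \<longrightarrow> preimage_count g W y \<le> N)"

lemma preimage_count_id: "preimage_count [:0, 1:] W y \<le> 1"
  by (rule preimage_count_le_1) (auto simp: inj_on_def crit_vals_def pderiv_pCons)

context pc_bounded
begin

lemma frontier_K_subset: "frontier K \<subseteq> K"
  using closed_K by (simp add: frontier_def closure_closed)

lemma compact_frontier_K: "compact (frontier K)"
  using compact_K by (rule compact_frontier)

text \<open>The frontier of \<open>K\<close> is in the Julia set and the postcritical set in the
  Fatou set, so they are a positive distance apart. Discs of that radius contain no critical values,
  and each branch over them is univalent.\<close>

lemma hyperbolic_bounded_multiplicity:
  assumes hyp: "hyperbolic S"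
  shows "\<exists>\<epsilon>>0. bounded_multiplicity S (frontier K) \<epsilon> 1"
proof -
  define P where "P = Fin -` postcritical_set S"
  have "closed P" unfolding P_def by (intro closed_vimage_Fin) (simp add: postcritical_set_def)
  moreover have "frontier K \<inter> P = {}"
    using frontier_K_X hyp unfolding P_def X_def julia_set_def hyperbolic_def by blast
  ultimately obtain \<epsilon> where \<epsilon>: "\<epsilon> > 0" "\<And>x y. x \<in> frontier K \<Longrightarrow> y \<in> P \<Longrightarrow> \<epsilon> \<le> dist x y"
    using separate_compact_closed[OF compact_frontier_K] by metis
  have cv: "crit_vals g \<subseteq> P" if g: "g \<in> S" for g
  proof
    fix y assume "y \<in> crit_vals g"
    then have "Fin y \<in> critical_values g" using critical_values_eq[OF degS[OF g]] by blast
    then show "y \<in> P" unfolding P_def postcritical_set_def using g closure_subset by fastforce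
  qed
  have "preimage_count g W y \<le> 1"
    if \<zeta>: "\<zeta> \<in> frontier K" and g: "g \<in> insert [:0, 1:] S" and W: "connected W" "W \<subseteq> poly g -` ball \<zeta> \<epsilon>"
      and y: "y \<in> ball \<zeta> \<epsilon>" for \<zeta> g W y
  proof (cases "g \<in> S")
    case True
    have dis: "ball \<zeta> \<epsilon> \<inter> crit_vals g = {}"
      using \<epsilon>(2)[OF \<zeta>] cv[OF True] by (force simp: not_less[symmetric])
    have deg: "degree g \<ge> 1" using degS[OF True] by simp
    have "inj_on (poly g) W"
      by (rule inj_on_over_simply_connected[OF deg open_ball _ dis W]) (simp add: convex_imp_simply_connected)
    then show ?thesis using dis y by (intro preimage_count_le_1[OF deg]) auto
  next
    case False
    then show ?thesis using g preimage_count_id by auto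
  qed
  then show ?thesis unfolding bounded_multiplicity_def using \<epsilon>(1) by metis
qed

text \<open>A small Euclidean disc lies in the spherical ball of semi-hyperbolicity, and a connected
  \<open>W\<close> in one component over that ball, whose covering degree dominates the
  count.\<close>

lemma semi_hyperbolic_bounded_multiplicity:
  assumes "semi_hyperbolic S"
  shows "\<exists>\<epsilon>>0. \<exists>N. bounded_multiplicity S (frontier K) \<epsilon> N"
proof -
  obtain \<delta> N where \<delta>: "\<delta> > 0" and N: "\<And>y g W. y \<in> julia_set S \<Longrightarrow> g \<in> S \<Longrightarrow>
      W \<in> components (sphere_map g -` ball y \<delta>) \<Longrightarrow> covering_degree g W (ball y \<delta>) \<le> N"
    using assms unfolding semi_hyperbolic_def by metis
  obtain \<epsilon> where \<epsilon>: "\<epsilon> > 0" "\<And>x y. x \<in> frontier K \<Longrightarrow> dist x y < \<epsilon> \<Longrightarrow> dist (Fin x) (Fin y) < \<delta>"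
    using Fin_ball_subset_ball[OF compact_frontier_K \<delta>] by metis
  \<comment> \<open>The maximum with 1 accounts for the identity map, which is not in
    \<open>S\<close>.\<close>
  have "preimage_count g W y \<le> max N 1"
    if \<zeta>: "\<zeta> \<in> frontier K" and g: "g \<in> insert [:0, 1:] S" and W: "connected W" "W \<subseteq> poly g -` ball \<zeta> \<epsilon>"
      and y: "y \<in> ball \<zeta> \<epsilon>" for \<zeta> g W y
  proof (cases "g \<in> S \<and> W \<noteq> {}")
    case True
    then have gS: "g \<in> S" and "W \<noteq> {}" by auto
    have deg: "degree g \<ge> 1" using degS[OF gS] by simp
    define P where "P = sphere_map g -` ball (Fin \<zeta>) \<delta>"
    have sub: "Fin ` W \<subseteq> P"
    proof
      fix x assume "x \<in> Fin ` W"
      then obtain w where w: "x = Fin w" "w \<in> W" by (rule imageE)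
      then have "dist \<zeta> (poly g w) < \<epsilon>" using W(2) by auto
      from \<epsilon>(2)[OF \<zeta> this] show "x \<in> P" using w(1) by (simp add: P_def)
    qed
    moreover have "connected (Fin ` W)" using W(1) by (intro connected_continuous_image continuous_on_Fin)
    ultimately obtain W' where W': "W' \<in> components P" "Fin ` W \<subseteq> W'"
      using exists_component_superset[of "Fin ` W" P] \<open>W \<noteq> {}\<close> sub by blast
    have "Fin y \<in> ball (Fin \<zeta>) \<delta>" using \<epsilon>(2)[OF \<zeta>] y by simp
    from covering_degree_eq[OF deg W'(1)[unfolded P_def] this]
    have "preimage_count g (Fin -` W') y \<le> N"
      using N[OF _ gS W'(1)[unfolded P_def]] \<zeta> frontier_K_X
      by (auto simp: julia_eq sphere_count_Fin[OF deg])
    moreover have "preimage_count g W y \<le> preimage_count g (Fin -` W') y"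
      by (rule preimage_count_mono[OF deg]) (use W'(2) in blast)
    ultimately show ?thesis by simp
  next
    case False
    then have "g = [:0, 1:] \<or> W = {}" using g by blast
    then show ?thesis using preimage_count_id[of W y] by (auto simp: preimage_count_def)
  qed
  then show ?thesis unfolding bounded_multiplicity_def using \<epsilon>(1) by metis
qed

end

section \<open>Lower bound for polynomials of bounded multiplicity\<close>

lemma frontier_component_vimage_ball:
  assumes D: "D \<in> components (poly p -` ball c s)" and w: "w \<in> frontier D"
  shows "cmod (poly p w - c) = s"
proof -
  have "D \<subseteq> poly p -` cball c s" using in_components_subset[OF D] by auto
  then have "closure D \<subseteq> poly p -` cball c s" by (rule closure_minimal) (intro closed_poly_vimage closed_cball)
  then have "cmod (poly p w - c) \<le> s" using w by (auto simp: frontier_def dist_cmod)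
  moreover have "w \<notin> poly p -` ball c s"
    using frontier_of_components_subset[OF D] w open_poly_vimage[OF open_ball, of p c s]
    by (metis Diff_iff frontier_def interior_open subsetD)
  ultimately show ?thesis by (simp add: dist_cmod)
qed

lemma poly_prod_linear: "poly (\<Prod>x\<in>#M. [:- x, 1:]) z = (\<Prod>x\<in>#M. z - x :: complex)"
  by (induction M) (simp_all add: algebra_simps)

lemma norm_prod_mset: "cmod (\<Prod>x\<in>#M. f x) = (\<Prod>x\<in>#M. cmod (f x))"
  by (induction M) (simp_all add: norm_mult)

lemma prod_mset_upper:
  assumes "\<And>x. x \<in># M \<Longrightarrow> 0 \<le> f x \<and> f x \<le> D" "1 \<le> (D::real)" "size M \<le> N"
  shows "(\<Prod>x\<in>#M. f x) \<le> D ^ N"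
proof -
  have "0 \<le> (\<Prod>x\<in>#M. f x) \<and> (\<Prod>x\<in>#M. f x) \<le> D ^ size M"
    using assms(1)
  proof (induction M)
    case (add x M)
    have "0 \<le> f x" "f x \<le> D" using add.prems[of x] by auto
    moreover have "0 \<le> (\<Prod>x\<in>#M. f x) \<and> (\<Prod>x\<in>#M. f x) \<le> D ^ size M"
      by (rule add.IH) (use add.prems in auto)
    ultimately show ?case using assms(2) by (auto intro!: mult_mono mult_nonneg_nonneg)
  qed simp
  moreover have "D ^ size M \<le> D ^ N" using assms(2,3) by (intro power_increasing)
  ultimately show ?thesis by linarith
qed

lemma prod_mset_lower:
  assumes "\<And>x. x \<in># M \<Longrightarrow> t \<le> f x" "0 \<le> t" "t \<le> (1::real)" "size M \<le> N"
  shows "t ^ N \<le> (\<Prod>x\<in>#M. f x)"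
proof -
  have "t ^ N \<le> t ^ size M" using assms by (intro power_decreasing) auto
  also have "t ^ size M \<le> (\<Prod>x\<in>#M. f x)"
    using assms(1)
  proof (induction M)
    case (add x M)
    have "t \<le> f x" using add.prems[of x] by auto
    moreover have "t ^ size M \<le> (\<Prod>x\<in>#M. f x)" by (rule add.IH) (use add.prems in auto)
    ultimately have "t * t ^ size M \<le> f x * (\<Prod>x\<in>#M. f x)"
      using assms(2) by (intro mult_mono) auto
    then show ?case by simp
  qed simp
  finally show ?thesis .
qed

text \<open>Of \<open>N + 1\<close> equally spaced points on a radius at least one is far from \<open>N\<close> given points.\<close>

lemma point_away_from_finite_set:
  fixes Z :: "complex set"
  assumes "r > 0" "finite Z" "card Z \<le> N"
  shows "\<exists>w\<in>ball b r. \<forall>x\<in>Z. r / (2 * (real N + 1)) \<le> cmod (w - x)"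
proof (rule ccontr)
  assume neg: "\<not> ?thesis"
  define t where "t = r / (real N + 1)"
  have t: "t > 0" using assms(1) by (simp add: t_def)
  define w where "w = (\<lambda>k. b + complex_of_real (t * real k))"
  have wb: "w k \<in> ball b r" if "k \<le> N" for k
  proof -
    have "t * real k < t * (real N + 1)" using that t by (intro mult_strict_left_mono) auto
    also have "\<dots> = r" by (simp add: t_def)
    finally show ?thesis using t by (simp add: w_def dist_cmod norm_mult)
  qed
  have "\<exists>x\<in>Z. cmod (w k - x) < t / 2" if "k \<le> N" for k
  proof -
    have "r / (2 * (real N + 1)) = t / 2" by (simp add: t_def)
    then have "\<not> (\<forall>x\<in>Z. t / 2 \<le> cmod (w k - x))" using neg wb[OF that] by metis
    then show ?thesis by (meson not_le)
  qed
  then obtain x where x: "\<And>k. k \<le> N \<Longrightarrow> x k \<in> Z" "\<And>k. k \<le> N \<Longrightarrow> cmod (w k - x k) < t / 2" by metis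
  have "inj_on x {..N}"
  proof (rule inj_onI, rule ccontr)
    fix i j assume ij: "i \<in> {..N}" "j \<in> {..N}" "x i = x j" "i \<noteq> j"
    have "cmod (w i - w j) \<le> cmod (w i - x i) + cmod (w j - x j)"
      using norm_triangle_ineq4[of "w i - x i" "w j - x j"] ij(3) by simp
    also have "\<dots> < t" using x(2)[of i] x(2)[of j] ij by simp
    finally have "cmod (w i - w j) < t" .
    moreover have "w i - w j = complex_of_real (t * (real i - real j))"
      by (simp add: w_def algebra_simps)
    then have "cmod (w i - w j) = t * \<bar>real i - real j\<bar>"
      using t by (simp add: norm_mult abs_mult del: of_real_mult of_real_diff)
    moreover have "1 \<le> \<bar>real i - real j\<bar>" using ij(4) by linarith
    then have "t * 1 \<le> t * \<bar>real i - real j\<bar>" using t by (intro mult_left_mono) auto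
    ultimately show False by linarith
  qed
  then have "card {..N} \<le> card Z"
    by (rule card_inj_on_le) (use x(1) assms(2) in auto)
  then show False using assms(3) by simp
qed

text \<open>Splitting off the zeros in a component \<open>W\<close>, the minimum principle bounds the rest from below.\<close>

lemma poly_diff_lower_bound:
  assumes deg: "degree g \<ge> 1" and r: "r > 0" and \<epsilon>: "\<epsilon> > 0"
    and sub: "ball b r \<subseteq> poly g -` ball \<zeta> \<epsilon>" and esc: "poly g -` ball \<zeta> \<epsilon> \<subseteq> ball b R'"
    and N: "\<And>W. connected W \<Longrightarrow> W \<subseteq> poly g -` ball \<zeta> \<epsilon> \<Longrightarrow> preimage_count g W \<zeta> \<le> N"
  shows "\<exists>w\<in>ball b r. (min 1 (r / (2 * (real N + 1)))) ^ N * (\<epsilon> / (max 1 (2 * R')) ^ N) \<le> cmod (poly g w - \<zeta>)"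
proof -
  define P where "P = poly g -` ball \<zeta> \<epsilon>"
  define D where "D = max 1 (2 * R')"
  obtain W where W: "W \<in> components P" "ball b r \<subseteq> W"
  proof -
    have "b \<in> ball b r" using r by simp
    then have "P \<noteq> {}" using sub unfolding P_def by blast
    then show thesis
      using exists_component_superset[of "ball b r" P] sub that unfolding P_def by (meson connected_ball)
  qed
  have Wc: "connected W" "W \<subseteq> P"
    using in_components_connected[OF W(1)] in_components_subset[OF W(1)] by auto
  have WR: "W \<subseteq> ball b R'" using Wc(2) esc by (simp add: P_def)
  have "open P" unfolding P_def by (intro open_poly_vimage open_ball)
  then have "open W" using W(1) by (rule open_components)
  define q where "q = g - [:\<zeta>:]"
  have q0: "q \<noteq> 0" unfolding q_def by (rule minus_const_nonzero[OF deg])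
  define M where "M = filter_mset (\<lambda>x. x \<in> W) (proots q)"
  define M' where "M' = filter_mset (\<lambda>x. x \<notin> W) (proots q)"
  have sizeM: "size M \<le> N"
    using N[OF Wc(1)] Wc(2) preimage_count_proots[OF deg, of W \<zeta>] by (simp add: M_def q_def P_def)
  have MW: "x \<in> W" if "x \<in># M" for x using that by (simp add: M_def)
  \<comment> \<open>\<open>A\<close> collects the at most \<open>N\<close> zeros in
    \<open>W\<close>; \<open>B\<close> has no zero on the closure of \<open>W\<close>.\<close>
  define A where "A = (\<lambda>z. \<Prod>x\<in>#M. z - x)"
  define B where "B = (\<lambda>z. lead_coeff q * (\<Prod>x\<in>#M'. z - x))"
  have qAB: "poly q z = A z * B z" for z
  proof -
    have "q = smult (lead_coeff q) (\<Prod>x\<in>#M + M'. [:- x, 1:])"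
      using complex_poly_decompose_multiset[of q] by (simp add: M_def M'_def multiset_partition[symmetric])
    then have "poly q z = lead_coeff q * poly (\<Prod>x\<in>#M + M'. [:- x, 1:]) z" by (metis poly_smult)
    then show ?thesis by (simp add: A_def B_def poly_prod_linear)
  qed
  have B0: "B z \<noteq> 0" if "z \<in> W \<or> poly q z \<noteq> 0" for z
  proof (cases "poly q z = 0")
    case True
    then have "z \<in> W" using that by simp
    then have "z \<notin># M'" by (simp add: M'_def)
    then have "(\<Prod>x\<in>#M'. z - x) \<noteq> 0" by (auto simp: prod_mset_zero_iff)
    then show ?thesis using q0 by (simp add: B_def)
  next
    case False
    then show ?thesis using qAB[of z] by auto
  qed
  have fr: "cmod (poly q z) = \<epsilon>" if "z \<in> frontier W" for z
    using frontier_component_vimage_ball[OF W(1)[unfolded P_def] that] by (simp add: q_def)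
  have Bcl: "B z \<noteq> 0" if "z \<in> closure W" for z
  proof (cases "z \<in> W")
    case False
    then have "z \<in> frontier W" using that closure_Un_frontier[of W] by blast
    then show ?thesis using fr \<epsilon> by (intro B0) force
  qed (rule B0, simp)
  have "B = poly (smult (lead_coeff q) (\<Prod>x\<in>#M'. [:- x, 1:]))"
  proof
    fix z
    show "B z = poly (smult (lead_coeff q) (\<Prod>x\<in>#M'. [:- x, 1:])) z" by (simp add: B_def poly_prod_linear)
  qed
  then have holB: "B holomorphic_on T" for T by (simp only: holomorphic_on_poly)
  have dist2: "cmod (z - x) \<le> D" if "z \<in> closure W" "x \<in> W" for z x
  proof -
    have "closure W \<subseteq> cball b R'" by (rule closure_minimal) (use WR in auto)
    then have "cmod (z - b) \<le> R'" using that(1) by (auto simp: dist_cmod)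
    moreover have "cmod (x - b) \<le> R'" using that(2) WR by (auto simp: dist_cmod)
    ultimately show ?thesis using norm_triangle_ineq4[of "z - b" "x - b"] by (simp add: D_def)
  qed
  have Aup: "cmod (A z) \<le> D ^ N" if "z \<in> closure W" for z
    unfolding A_def norm_prod_mset
    by (rule prod_mset_upper) (use dist2[OF that] MW sizeM in \<open>auto simp: D_def\<close>)
  \<comment> \<open>On the frontier of \<open>W\<close> the product has modulus \<epsilon>, while
    \<open>|A| \<le> D ^ N\<close> because \<open>W\<close> has diameter at most
    \<open>2 R'\<close>. The maximum principle carries the resulting bound for \<open>1 / B\<close>
    inside.\<close>
  have invB: "cmod (1 / B z) \<le> D ^ N / \<epsilon>" if z: "z \<in> W" for z
  proof (rule maximum_modulus_frontier[of "\<lambda>z. 1 / B z" W])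
    have hol: "(\<lambda>z. 1 / B z) holomorphic_on closure W \<union> W"
      by (intro holomorphic_intros holB) (use Bcl closure_subset in auto)
    show "(\<lambda>z. 1 / B z) holomorphic_on interior W"
      using hol by (rule holomorphic_on_subset) (use interior_subset in blast)
    show "continuous_on (closure W) (\<lambda>z. 1 / B z)"
      using holomorphic_on_imp_continuous_on[OF hol] by (rule continuous_on_subset) simp
    show "bounded W" using WR bounded_ball bounded_subset by blast
    fix v assume v: "v \<in> frontier W"
    then have vc: "v \<in> closure W" by (simp add: frontier_def)
    have "cmod (A v) * cmod (B v) = \<epsilon>" using fr[OF v] qAB[of v] by (simp add: norm_mult)
    then have "\<epsilon> \<le> D ^ N * cmod (B v)"
      using mult_right_mono[OF Aup[OF vc] norm_ge_zero[of "B v"]] by linarith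
    then show "cmod (1 / B v) \<le> D ^ N / \<epsilon>"
      using Bcl[OF vc] \<epsilon> by (simp add: norm_divide field_simps)
  qed (rule z)
  \<comment> \<open>Capping at 1 lets a product of fewer than \<open>N\<close> factors be bounded
    below by \<open>t ^ N\<close> as well.\<close>
  define t where "t = min 1 (r / (2 * (real N + 1)))"
  have t: "0 \<le> t" "t \<le> 1" using r by (auto simp: t_def)
  have "card (set_mset M) \<le> N"
  proof -
    have "card (set_mset M'') \<le> size M''" for M'' :: "complex multiset"
      by (induction M'') (auto simp: card_insert_if)
    then show ?thesis using sizeM le_trans by blast
  qed
  then obtain w where w: "w \<in> ball b r" "\<And>x. x \<in># M \<Longrightarrow> r / (2 * (real N + 1)) \<le> cmod (w - x)"
    using point_away_from_finite_set[OF r finite_set_mset, of M N b] by blast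
  have "t ^ N \<le> cmod (A w)"
    unfolding A_def norm_prod_mset
    by (rule prod_mset_lower) (use w(2) t sizeM in \<open>auto simp: t_def min_le_iff_disj\<close>)
  moreover have "\<epsilon> / D ^ N \<le> cmod (B w)"
  proof -
    have "w \<in> W" using w(1) W(2) by blast
    have "D ^ N > 0" by (simp add: D_def)
    then show ?thesis
      using invB[OF \<open>w \<in> W\<close>] B0[of w] \<open>w \<in> W\<close> \<epsilon> by (simp add: norm_divide field_simps)
  qed
  ultimately have "t ^ N * (\<epsilon> / D ^ N) \<le> cmod (A w) * cmod (B w)"
    using t \<epsilon> by (intro mult_mono) (auto simp: D_def)
  also have "\<dots> = cmod (poly g w - \<zeta>)" using qAB[of w] by (simp add: q_def norm_mult)
  finally show ?thesis using w(1) unfolding t_def D_def by blast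
qed

section \<open>Perturbations\<close>

lemma pcompose_id_left: "[:0, 1:] \<circ>\<^sub>p p = (p :: complex poly)"
  by (simp add: pcompose_pCons)

context pc_bounded
begin

text \<open>Otherwise some sequence in the semigroup would converge on \<open>ball b r'\<close> to a constant in the
  boundary of \<open>K\<close>, against the lower bound for polynomials of bounded multiplicity.\<close>

lemma orbit_away_from_frontier:
  assumes bm: "bounded_multiplicity S (frontier K) \<epsilon> N" and \<epsilon>: "\<epsilon> > 0"
    and r: "0 < r" "r < r'" and sub: "ball b r' \<subseteq> K"
  shows "\<exists>\<epsilon>0>0. \<forall>g\<in>insert [:0, 1:] S. \<forall>z\<in>cball b r. \<forall>\<zeta>\<in>frontier K. \<epsilon>0 \<le> dist (poly g z) \<zeta>"
proof (rule ccontr)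
  assume neg: "\<not> ?thesis"
  define F where "F = insert [:0, 1:] S"
  have degF: "degree g \<ge> 1" if "g \<in> F" for g
    using that degS[of g] by (auto simp: F_def)
  have invF: "poly g z \<in> K" if "g \<in> F" "z \<in> K" for g z
    using that K_invariant by (auto simp: F_def)
  have "\<exists>g z \<zeta>. g \<in> F \<and> z \<in> cball b r \<and> \<zeta> \<in> frontier K \<and> dist (poly g z) \<zeta> < inverse (Suc n)" for n
  proof -
    have "inverse (real (Suc n)) > 0" by simp
    with neg show ?thesis unfolding F_def by (meson not_le)
  qed
  then obtain g z \<zeta> where gz: "\<And>n. g n \<in> F" "\<And>n. z n \<in> cball b r" "\<And>n. \<zeta> n \<in> frontier K"
    "\<And>n. dist (poly (g n) (z n)) (\<zeta> n) < inverse (Suc n)"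
    by metis
  \<comment> \<open>Both the points \<open>z n\<close> and the frontier points
    \<open>\<zeta> n\<close> near their images vary with \<open>n\<close>; compactness of the
    product fixes limits of both at once.\<close>
  have "compact (frontier K \<times> cball b r)" by (intro compact_Times compact_frontier_K compact_cball)
  then have sc: "seq_compact (frontier K \<times> cball b r)" by (simp only: compact_eq_seq_compact_metric)
  have "\<forall>n. (\<zeta> n, z n) \<in> frontier K \<times> cball b r" using gz by simp
  with sc obtain lz s where s: "lz \<in> frontier K \<times> cball b r" "strict_mono (s :: nat \<Rightarrow> nat)"
    "((\<lambda>n. (\<zeta> n, z n)) \<circ> s) \<longlonglongrightarrow> lz"
    by (rule seq_compactE)
  obtain l zl where lz: "lz = (l, zl)" by (cases lz)
  have l: "l \<in> frontier K" and zl: "zl \<in> cball b r" using s(1) by (auto simp: lz)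
  have \<zeta>s: "(\<lambda>n. \<zeta> (s n)) \<longlonglongrightarrow> l" and zs: "(\<lambda>n. z (s n)) \<longlonglongrightarrow> zl"
    using tendsto_fst[OF s(3)] tendsto_snd[OF s(3)] by (simp_all add: lz o_def)
  define U where "U = ball b r'"
  have cU: "cball b r \<subseteq> U" using r by (auto simp: U_def)
  obtain h q where h: "h holomorphic_on U" and q: "strict_mono (q :: nat \<Rightarrow> nat)"
    and hpt: "\<And>x. x \<in> U \<Longrightarrow> (\<lambda>n. poly (g (s (q n))) x) \<longlonglongrightarrow> h x"
    and hun: "\<And>T. compact T \<Longrightarrow> T \<subseteq> U \<Longrightarrow> uniform_limit T ((\<lambda>n. poly (g (s n))) \<circ> q) h sequentially"
  proof (rule Montel[of U "range (\<lambda>n. poly (g (s n)))" "\<lambda>n. poly (g (s n))"])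
    show "open U" by (simp add: U_def)
    show "f holomorphic_on U" if "f \<in> range (\<lambda>n. poly (g (s n)))" for f
      using that holomorphic_on_poly by auto
    show "\<exists>B. \<forall>f\<in>range (\<lambda>n. poly (g (s n))). \<forall>x\<in>T. cmod (f x) \<le> B" if "compact T" "T \<subseteq> U" for T
    proof -
      obtain B where B: "\<And>x. x \<in> K \<Longrightarrow> cmod x \<le> B"
        using compact_imp_bounded[OF compact_K] unfolding bounded_iff by blast
      have "cmod (poly (g (s n)) x) \<le> B" if "x \<in> T" for n x
        by (rule B, rule invF[OF gz(1)]) (use that \<open>T \<subseteq> U\<close> sub in \<open>auto simp: U_def\<close>)
      then show ?thesis by blast
    qed
  qed auto
  define G where "G = (\<lambda>n. g (s (q n)))"
  define Z where "Z = (\<lambda>n. z (s (q n)))"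
  have Zl: "Z \<longlonglongrightarrow> zl" using LIMSEQ_subseq_LIMSEQ[OF zs q] by (simp add: Z_def o_def)
  have un: "uniform_limit (cball b r) (\<lambda>n. poly (G n)) h sequentially"
    using hun[OF compact_cball cU] by (simp add: G_def o_def)
  have conth: "continuous_on U h" by (rule holomorphic_on_imp_continuous_on[OF h])
  have hZ: "(\<lambda>n. h (Z n)) \<longlonglongrightarrow> h zl"
    by (rule continuous_on_tendsto_compose[OF conth Zl])
       (use zl cU gz(2) in \<open>auto simp: Z_def intro!: always_eventually\<close>)
  have "(\<lambda>n. poly (G n) (Z n) - h (Z n)) \<longlonglongrightarrow> 0"
  proof (rule tendstoI)
    fix e :: real assume "e > 0"
    with un have "\<forall>\<^sub>F n in sequentially. \<forall>x\<in>cball b r. dist (poly (G n) x) (h x) < e"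
      by (rule uniform_limitD)
    then show "\<forall>\<^sub>F n in sequentially. dist (poly (G n) (Z n) - h (Z n)) 0 < e"
      by eventually_elim (use gz(2) in \<open>simp add: Z_def dist_norm\<close>)
  qed
  from tendsto_add[OF this hZ] have lim1: "(\<lambda>n. poly (G n) (Z n)) \<longlonglongrightarrow> h zl" by simp
  have "(\<lambda>n. poly (g (s n)) (z (s n)) - \<zeta> (s n)) \<longlonglongrightarrow> 0"
  proof (rule Lim_null_comparison)
    show "\<forall>\<^sub>F n in sequentially. norm (poly (g (s n)) (z (s n)) - \<zeta> (s n)) \<le> inverse (real (Suc (s n)))"
      using gz(4) by (intro always_eventually allI) (simp add: dist_norm less_imp_le)
    show "(\<lambda>n. inverse (real (Suc (s n)))) \<longlonglongrightarrow> 0"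
      using LIMSEQ_subseq_LIMSEQ[OF LIMSEQ_inverse_real_of_nat s(2)] by (simp add: o_def)
  qed
  from tendsto_add[OF this \<zeta>s] have "(\<lambda>n. poly (g (s n)) (z (s n))) \<longlonglongrightarrow> l" by simp
  from LIMSEQ_subseq_LIMSEQ[OF this q] have "(\<lambda>n. poly (G n) (Z n)) \<longlonglongrightarrow> l"
    by (simp add: o_def G_def Z_def)
  with lim1 have hl: "h zl = l" by (rule LIMSEQ_unique)
  have hK: "h x \<in> K" if "x \<in> U" for x
    by (rule Lim_in_closed_set[OF closed_K _ sequentially_bot hpt[OF that]])
       (use that sub gz(1) invF in \<open>auto simp: U_def intro!: always_eventually\<close>)
  \<comment> \<open>A nonconstant limit would be an open map of \<open>U\<close> into
    \<open>K\<close>, placing \<open>l\<close> in the interior of \<open>K\<close>.\<close>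
  have "h constant_on U"
  proof (rule ccontr)
    assume "\<not> h constant_on U"
    then have "open (h ` U)"
      by (intro open_mapping_thm[OF h]) (auto simp: U_def)
    moreover have "h ` U \<subseteq> K" using hK by blast
    moreover have "l \<in> h ` U" using hl zl cU by blast
    ultimately have "l \<in> interior K" using interior_maximal by blast
    then show False using l by (simp add: frontier_def)
  qed
  then have hconst: "h x = l" if "x \<in> U" for x
    using that hl zl cU unfolding constant_on_def by (metis subsetD)
  \<comment> \<open>The bound of \<open>poly_diff_lower_bound\<close> with
    \<open>R' = R + \<epsilon>\<close>. It does not depend on the member of the sequence, so uniform
    convergence to the constant \<open>l\<close> contradicts it.\<close>
  define \<eta> where "\<eta> = (min 1 (r / (2 * (real N + 1)))) ^ N * (\<epsilon> / (max 1 (2 * (R + \<epsilon>))) ^ N)"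
  have \<eta>: "\<eta> > 0" unfolding \<eta>_def using r \<epsilon> by (intro mult_pos_pos divide_pos_pos zero_less_power) auto
  have "\<forall>\<^sub>F n in sequentially. \<forall>x\<in>cball b r. dist (poly (G n) x) (h x) < min \<epsilon> \<eta>"
    using un by (rule uniform_limitD) (use \<eta> \<epsilon> in simp)
  then obtain n where n: "\<forall>x\<in>cball b r. dist (poly (G n) x) (h x) < min \<epsilon> \<eta>"
    using eventually_happens'[OF sequentially_bot] by blast
  have close: "dist (poly (G n) x) l < min \<epsilon> \<eta>" if "x \<in> cball b r" for x
    using bspec[OF n that] hconst[of x] that cU by auto
  have GF: "G n \<in> F" using gz(1) by (simp add: G_def)
  have "\<exists>w\<in>ball b r. \<eta> \<le> cmod (poly (G n) w - l)"
    unfolding \<eta>_def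
  proof (rule poly_diff_lower_bound[OF degF[OF GF] r(1) \<epsilon>])
    show "ball b r \<subseteq> poly (G n) -` ball l \<epsilon>"
      using close by (auto simp: dist_commute)
    \<comment> \<open>From distance \<open>R\<close> on, no member of \<open>F\<close> decreases the
      distance to \<open>b\<close>, so points sent close to \<open>l\<close> lie within
      \<open>R + \<epsilon>\<close> themselves.\<close>
    show "poly (G n) -` ball l \<epsilon> \<subseteq> ball b (R + \<epsilon>)"
    proof
      fix x assume x: "x \<in> poly (G n) -` ball l \<epsilon>"
      have "l \<in> ball b R" using l frontier_K_subset K_subset by blast
      then have "cmod (poly (G n) x - b) < R + \<epsilon>"
        using x norm_triangle_ineq[of "poly (G n) x - l" "l - b"]
        by (simp add: dist_cmod)
      moreover have "cmod (x - b) \<le> cmod (poly (G n) x - b)" if "cmod (x - b) \<ge> R"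
      proof (cases "G n \<in> S")
        case True
        from escapeS[OF this that] show ?thesis using norm_ge_zero[of "x - b"] by linarith
      next
        case False
        then show ?thesis using GF by (simp add: F_def)
      qed
      ultimately show "x \<in> ball b (R + \<epsilon>)" using \<epsilon> by (simp add: dist_cmod) linarith
    qed
    show "preimage_count (G n) W l \<le> N" if "connected W" "W \<subseteq> poly (G n) -` ball l \<epsilon>" for W
      using bm that l GF \<epsilon> unfolding bounded_multiplicity_def F_def by (meson centre_in_ball)
  qed
  then obtain w where w: "w \<in> ball b r" "\<eta> \<le> cmod (poly (G n) w - l)" by blast
  have "dist (poly (G n) w) l < min \<epsilon> \<eta>" by (rule close) (use w(1) in auto)
  with w(2) show False by (simp add: dist_norm)
qed

end

text \<open>\<open>V\<close> stands for the added generators, each of which sends all of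
  \<open>K\<close> into \<open>ball b r\<close>. The larger \<open>ball b r'\<close> inside
  \<open>K\<close> gives Montel's theorem room around \<open>cball b r\<close>, and \<open>R\<close>
  is an escape radius common to \<open>\<Gamma>\<close> and \<open>V\<close>.\<close>

locale perturbation = G: pc_bounded \<Gamma> b R for \<Gamma> b R +
  fixes V :: "complex poly set" and r r' :: real
  assumes V: "V \<noteq> {}" and r: "0 < r" "r < r'" and ball_K: "ball b r' \<subseteq> K_hat (semigroup_generated \<Gamma>)"
    and degV: "\<And>v. v \<in> V \<Longrightarrow> degree v \<ge> 2"
    and escapeV: "\<And>v z. v \<in> V \<Longrightarrow> cmod (z - b) \<ge> R \<Longrightarrow> cmod (poly v z - b) \<ge> 2 * cmod (z - b)"
    and V_K: "\<And>v z. v \<in> V \<Longrightarrow> z \<in> K_hat (semigroup_generated \<Gamma>) \<Longrightarrow> poly v z \<in> ball b r"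
    and critV: "\<And>v. v \<in> V \<Longrightarrow> crit_vals v \<subseteq> ball b r"
begin

abbreviation "H \<equiv> semigroup_generated (\<Gamma> \<union> V)"

lemma ball_r_K: "cball b r \<subseteq> G.K"
  using ball_K r by (auto simp: subset_iff)

lemma G_subset_H: "G.S \<subseteq> H"
  by (rule semigroup_generated_mono) simp

lemma H_invariant: "f \<in> H \<Longrightarrow> z \<in> G.K \<Longrightarrow> poly f z \<in> G.K"
  by (rule poly_semigroup_invariant[of f "\<Gamma> \<union> V"])
    (use G.K_invariant semigroup_generated.generator[of _ \<Gamma>] V_K ball_r_K ball_subset_cball in blast)+

text \<open>The filled set of \<open>\<Gamma>\<close> is bounded and invariant under old and new
  generators, so its points keep bounded orbits.\<close>

lemma K_hat_H: "K_hat H = G.K"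
proof
  show "K_hat H \<subseteq> G.K"
  proof
    fix z assume "z \<in> K_hat H"
    then have "bounded (\<Union>g\<in>H. {poly g z})" by (simp add: K_hat_def)
    then have "bounded (\<Union>g\<in>G.S. {poly g z})"
      by (rule bounded_subset) (use G_subset_H in blast)
    then show "z \<in> G.K" by (simp add: K_hat_def)
  qed
  show "G.K \<subseteq> K_hat H"
  proof
    fix z assume z: "z \<in> G.K"
    have "(\<Union>g\<in>H. {poly g z}) \<subseteq> G.K" using H_invariant[OF _ z] by blast
    then have "bounded (\<Union>g\<in>H. {poly g z})"
      using G.compact_K compact_imp_bounded bounded_subset by blast
    then show "z \<in> K_hat H" by (simp add: K_hat_def)
  qed
qed

text \<open>Critical values of \<open>V\<close> lie in \<open>ball b r\<close> and so in
  \<open>K\<close>; the enlarged semigroup therefore satisfies the same standing assumptions with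
  the same radius.\<close>

sublocale H: pc_bounded "\<Gamma> \<union> V" b R
proof
  show "b \<in> interior (K_hat H)" using G.b_int by (simp add: K_hat_H)
  show "crit_vals h \<subseteq> K_hat H" if "h \<in> \<Gamma> \<union> V" for h
    unfolding K_hat_H using that G.crit[of h] critV[of h] ball_r_K ball_subset_cball[of b r] by blast
qed (use G.nonempty G.R_pos G.deg degV G.escape escapeV in auto)

text \<open>Splits a word at its outermost letter from \<open>V\<close>; the identity stands for an
  empty \<open>g\<close> or \<open>f'\<close>.\<close>

lemma H_words:
  assumes "f \<in> H"
  shows "f \<in> G.S \<or> (\<exists>g\<in>insert [:0, 1:] G.S. \<exists>v\<in>V. \<exists>f'\<in>insert [:0, 1:] H. f = g \<circ>\<^sub>p (v \<circ>\<^sub>p f'))"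
  using assms
proof (induction rule: semigroup_generated_induct_left)
  case (generator h)
  have "h = [:0, 1:] \<circ>\<^sub>p (h \<circ>\<^sub>p [:0, 1:])" by (simp add: pcompose_idR pcompose_id_left)
  then show ?case using generator semigroup_generated.generator by blast
next
  case (compose h f)
  show ?case
  proof (cases "h \<in> \<Gamma>")
    case True
    then have h: "h \<in> G.S" by (rule semigroup_generated.generator)
    from compose.IH show ?thesis
    proof
      assume "f \<in> G.S"
      then show ?thesis using h semigroup_generated.compose by blast
    next
      assume "\<exists>g\<in>insert [:0, 1:] G.S. \<exists>v\<in>V. \<exists>f'\<in>insert [:0, 1:] H. f = g \<circ>\<^sub>p (v \<circ>\<^sub>p f')"
      then obtain g v f' where g: "g \<in> insert [:0, 1:] G.S" and v: "v \<in> V" "f' \<in> insert [:0, 1:] H"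
        and f: "f = g \<circ>\<^sub>p (v \<circ>\<^sub>p f')" by blast
      have "h \<circ>\<^sub>p g \<in> G.S"
        using g h semigroup_generated.compose[OF h] by (auto simp: pcompose_idR)
      moreover have "h \<circ>\<^sub>p f = (h \<circ>\<^sub>p g) \<circ>\<^sub>p (v \<circ>\<^sub>p f')" by (simp only: f pcompose_assoc)
      ultimately show ?thesis using v by blast
    qed
  next
    case False
    then have "h \<in> V" using compose by blast
    moreover have "h \<circ>\<^sub>p f = [:0, 1:] \<circ>\<^sub>p (h \<circ>\<^sub>p f)" by (simp add: pcompose_id_left)
    ultimately show ?thesis using compose by blast
  qed
qed

lemma crit_vals_id: "crit_vals [:0, 1:] = {}"
  by (auto simp: crit_vals_def pderiv_pCons)

text \<open>Whatever \<open>f'\<close> is, its critical values lie in \<open>K\<close>, and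
  \<open>v\<close> sends \<open>K\<close> into \<open>ball b r\<close>.\<close>

lemma crit_vals_after_V:
  assumes "v \<in> V" "f' \<in> insert [:0, 1:] H"
  shows "crit_vals (v \<circ>\<^sub>p f') \<subseteq> ball b r"
proof -
  have "crit_vals f' \<subseteq> G.K" using assms(2) H.critS[unfolded K_hat_H] crit_vals_id by blast
  then have "poly v ` crit_vals f' \<subseteq> ball b r" using V_K[OF assms(1)] by blast
  then show ?thesis using crit_vals_pcompose[of v f'] critV[OF assms(1)] by blast
qed

lemma degree_id_or_S: "g \<in> insert [:0, 1:] G.S \<Longrightarrow> degree g \<ge> 1"
  using G.degS[of g] by auto

lemma degree_after_V:
  assumes "v \<in> V" "f' \<in> insert [:0, 1:] H" shows "degree (v \<circ>\<^sub>p f') \<ge> 1"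
proof -
  have "degree f' \<ge> 1" using assms(2) H.degS[of f'] by auto
  then show ?thesis using degV[OF assms(1)] by (simp add: degree_pcompose Suc_le_eq)
qed

text \<open>A critical value of a word comes either from its part through \<open>V\<close>, and then
  lies in the set \<open>A\<close> of points of \<open>K\<close> at distance at least
  \<open>\<epsilon>0\<close> from the frontier, or from its outer part, and then lies in the old
  postcritical set \<open>P\<close>. Both sets are compact and inside the interior of
  \<open>K\<close>, which belongs to the Fatou set of \<open>H\<close> because the filled set has
  not changed.\<close>

lemma hyperbolic_H:
  assumes hyp: "hyperbolic G.S"
  shows "hyperbolic H"
proof -
  obtain \<epsilon> where \<epsilon>: "\<epsilon> > 0" "bounded_multiplicity G.S (frontier G.K) \<epsilon> 1"
    using G.hyperbolic_bounded_multiplicity[OF hyp] by blast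
  obtain \<epsilon>0 where \<epsilon>0: "\<epsilon>0 > 0"
    "\<And>g z \<zeta>. g \<in> insert [:0, 1:] G.S \<Longrightarrow> z \<in> cball b r \<Longrightarrow> \<zeta> \<in> frontier G.K \<Longrightarrow> \<epsilon>0 \<le> dist (poly g z) \<zeta>"
    using G.orbit_away_from_frontier[OF \<epsilon>(2,1) r ball_K] by metis
  define A where "A = G.K \<inter> (\<Inter>\<zeta>\<in>frontier G.K. - ball \<zeta> \<epsilon>0)"
  define P where "P = Fin -` postcritical_set G.S"
  have "closed A" unfolding A_def by (intro closed_Int G.closed_K closed_INT ballI closed_Compl open_ball)
  moreover have AK: "A \<subseteq> G.K" by (simp add: A_def)
  ultimately have cA: "compact A"
    using G.compact_K bounded_subset compact_imp_bounded by (auto simp: compact_eq_bounded_closed)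
  have PK: "P \<subseteq> G.K" using G.postcritical_subset by (auto simp: P_def)
  have "closed P" unfolding P_def by (rule closed_vimage_Fin) (simp add: postcritical_set_def)
  then have cP: "compact P"
    using PK G.compact_K bounded_subset compact_imp_bounded by (auto simp: compact_eq_bounded_closed)
  have A_int: "A \<subseteq> interior G.K"
  proof
    fix z assume z: "z \<in> A"
    show "z \<in> interior G.K"
    proof (rule ccontr)
      assume "z \<notin> interior G.K"
      then have "z \<in> frontier G.K" using z AK closure_subset by (auto simp: frontier_def)
      then have "z \<notin> ball z \<epsilon>0" using z by (auto simp: A_def)
      then show False using \<epsilon>0(1) by simp
    qed
  qed
  have P_int: "P \<subseteq> interior G.K"
  proof
    fix z assume z: "z \<in> P"
    then have "Fin z \<in> fatou_set G.S" using hyp by (auto simp: hyperbolic_def P_def)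
    then show "z \<in> interior G.K" using K_hat_inter_fatou_set PK z by blast
  qed
  have cv: "crit_vals f \<subseteq> P" if f: "f \<in> G.S" for f
  proof
    fix y assume "y \<in> crit_vals f"
    then have "Fin y \<in> critical_values f" using critical_values_eq[OF G.degS[OF f]] by blast
    then show "y \<in> P" unfolding P_def postcritical_set_def using f closure_subset by fastforce
  qed
  have cvH: "crit_vals f \<subseteq> A \<union> P" if f: "f \<in> H" for f
    using H_words[OF f]
  proof
    assume "\<exists>g\<in>insert [:0, 1:] G.S. \<exists>v\<in>V. \<exists>f'\<in>insert [:0, 1:] H. f = g \<circ>\<^sub>p (v \<circ>\<^sub>p f')"
    then obtain g v f' where g: "g \<in> insert [:0, 1:] G.S" and v: "v \<in> V" "f' \<in> insert [:0, 1:] H"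
      and f: "f = g \<circ>\<^sub>p (v \<circ>\<^sub>p f')" by blast
    have "poly g z \<in> A" if z: "z \<in> ball b r" for z
    proof -
      have zc: "z \<in> cball b r" using z by auto
      have "poly g z \<in> G.K" using g zc ball_r_K G.K_invariant by auto
      moreover have "poly g z \<notin> ball \<zeta> \<epsilon>0" if "\<zeta> \<in> frontier G.K" for \<zeta>
        using \<epsilon>0(2)[OF g zc that] by (simp add: dist_commute)
      ultimately show ?thesis by (auto simp: A_def)
    qed
    then have "poly g ` crit_vals (v \<circ>\<^sub>p f') \<subseteq> A" using crit_vals_after_V[OF v] by blast
    moreover have "crit_vals g \<subseteq> P" using g cv crit_vals_id by blast
    ultimately show ?thesis using crit_vals_pcompose[of g "v \<circ>\<^sub>p f'"] unfolding f by blast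
  qed (use cv in blast)
  define C where "C = insert Infinity (Fin ` (A \<union> P))"
  have "postcritical_set H \<subseteq> C"
    unfolding postcritical_set_def
  proof (rule closure_minimal)
    show "closed C" unfolding C_def
      by (intro closed_insert compact_imp_closed compact_Fin compact_Un cA cP)
    show "(\<Union>g\<in>H. critical_values g) \<subseteq> C"
    proof (rule UN_least)
      fix g assume g: "g \<in> H"
      show "critical_values g \<subseteq> C"
        unfolding critical_values_eq[OF H.degS[OF g]] C_def by (intro insert_mono image_mono cvH[OF g])
    qed
  qed
  moreover have "C \<subseteq> fatou_set H"
  proof -
    have "Infinity \<in> fatou_set H" using H.exterior_fatou by auto
    moreover have "Fin z \<in> fatou_set H" if "z \<in> A \<union> P" for z
      by (rule H.interior_K_fatou) (use that A_int P_int K_hat_H in auto)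
    ultimately show ?thesis by (auto simp: C_def)
  qed
  ultimately show ?thesis by (simp add: hyperbolic_def)
qed

text \<open>A disc about \<open>y\<close> free of critical values has univalent branches. Otherwise
  it meets \<open>K\<close>, whose interior \<open>y\<close> avoids, so \<open>y\<close> is close to
  the frontier of \<open>K\<close>, where the multiplicity bound of the original semigroup is
  available.\<close>

lemma semi_hyperbolic_H:
  assumes hyp: "semi_hyperbolic G.S"
  shows "semi_hyperbolic H"
proof -
  obtain \<epsilon> N where \<epsilon>: "\<epsilon> > 0" and bm: "bounded_multiplicity G.S (frontier G.K) \<epsilon> N"
    using G.semi_hyperbolic_bounded_multiplicity[OF hyp] by blast
  obtain \<epsilon>0 where \<epsilon>0: "\<epsilon>0 > 0"
    "\<And>g z \<zeta>. g \<in> insert [:0, 1:] G.S \<Longrightarrow> z \<in> cball b r \<Longrightarrow> \<zeta> \<in> frontier G.K \<Longrightarrow> \<epsilon>0 \<le> dist (poly g z) \<zeta>"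
    using G.orbit_away_from_frontier[OF bm \<epsilon> r ball_K] by metis
  \<comment> \<open>With half the minimum, the disc of radius \<open>e\<close> about
    \<open>y\<close> lies in the disc of radius \<open>2 * e\<close> about a frontier point, where
    both \<epsilon> and \<open>\<epsilon>0\<close> apply.\<close>
  define e where "e = min \<epsilon> \<epsilon>0 / 2"
  have e: "e > 0" "2 * e \<le> \<epsilon>" "2 * e \<le> \<epsilon>0" using \<epsilon> \<epsilon>0(1) by (auto simp: e_def)
  have main: "preimage_count f W y \<le> max N 1"
    if y: "y \<in> H.X" and f: "f \<in> H" and W: "connected W" "W \<subseteq> poly f -` ball y e" for f W y
  proof (cases "ball y e \<inter> crit_vals f = {}")
    case True
    have deg: "degree f \<ge> 1" using H.degS[OF f] by simp
    have "inj_on (poly f) W"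
      by (rule inj_on_over_simply_connected[OF deg open_ball _ True W]) (simp add: convex_imp_simply_connected)
    moreover have "y \<notin> crit_vals f" using True e(1) centre_in_ball by blast
    ultimately have "preimage_count f W y \<le> 1" by (intro preimage_count_le_1[OF deg])
    then show ?thesis by simp
  next
    case False
    then obtain c where c: "c \<in> ball y e" "c \<in> G.K" using H.critS[OF f] K_hat_H by blast
    have "y \<notin> interior G.K" using y H.X_inter_interior_K K_hat_H by auto
    have "\<exists>y'\<in>frontier G.K. dist y y' < e"
    proof (cases "y \<in> G.K")
      case True
      then have "y \<in> frontier G.K" using \<open>y \<notin> interior G.K\<close> closure_subset by (auto simp: frontier_def)
      then show ?thesis using e(1) by force
    next
      case False
      have "ball y e \<inter> G.K \<noteq> {}" using c by blast
      moreover have "ball y e - G.K \<noteq> {}" using False e(1) centre_in_ball by blast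
      ultimately have "ball y e \<inter> frontier G.K \<noteq> {}"
        by (rule connected_Int_frontier[OF connected_ball])
      then show ?thesis by auto
    qed
    then obtain y' where y': "y' \<in> frontier G.K" "dist y y' < e" by blast
    have sub2: "ball y e \<subseteq> ball y' (2 * e)"
    proof
      fix x assume "x \<in> ball y e"
      then have "dist y x < e" by simp
      then show "x \<in> ball y' (2 * e)" using y'(2) dist_triangle[of y' x y] dist_commute[of y y'] by simp
    qed
    have sub: "ball y e \<subseteq> ball y' \<epsilon>" using sub2 subset_ball[OF e(2), of y'] by blast
    have y\<epsilon>: "y \<in> ball y' \<epsilon>" using sub e(1) centre_in_ball by blast
    have bmD: "preimage_count g T y \<le> N"
      if "g \<in> insert [:0, 1:] G.S" "connected T" "T \<subseteq> poly g -` ball y' \<epsilon>" for g T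
      using bm y'(1) that y\<epsilon> unfolding bounded_multiplicity_def by metis
    from H_words[OF f] show ?thesis
    proof
      assume "f \<in> G.S"
      moreover have "W \<subseteq> poly f -` ball y' \<epsilon>" using W(2) sub by blast
      ultimately have "preimage_count f W y \<le> N" using bmD W(1) by blast
      then show ?thesis by simp
    next
      assume "\<exists>g\<in>insert [:0, 1:] G.S. \<exists>v\<in>V. \<exists>f'\<in>insert [:0, 1:] H. f = g \<circ>\<^sub>p (v \<circ>\<^sub>p f')"
      then obtain g v f' where g: "g \<in> insert [:0, 1:] G.S" and v: "v \<in> V" "f' \<in> insert [:0, 1:] H"
        and feq: "f = g \<circ>\<^sub>p (v \<circ>\<^sub>p f')" by blast
      define u where "u = v \<circ>\<^sub>p f'"
      have du: "degree u \<ge> 1" unfolding u_def by (rule degree_after_V[OF v])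
      have dg: "degree g \<ge> 1" by (rule degree_id_or_S[OF g])
      show ?thesis
      proof (cases "W = {}")
        case True
        then show ?thesis by (simp add: preimage_count_def)
      next
        case False
        define P where "P = poly g -` ball y' (2 * e)"
        have uW: "poly u ` W \<subseteq> P"
          using W(2) sub2 by (auto simp: P_def feq u_def[symmetric] poly_pcompose)
        have cuW: "connected (poly u ` W)"
          by (intro connected_continuous_image continuous_on_poly' W(1))
        have "P \<noteq> {}" using uW False by blast
        then obtain Q where Q: "Q \<in> components P" "poly u ` W \<subseteq> Q"
          using exists_component_superset[OF uW _ cuW] by blast
        have "open P" unfolding P_def by (intro open_poly_vimage open_ball)
        then have "open Q" using Q(1) by (rule open_components)
        have "simply_connected Q"
          using Q(1) unfolding P_def by (rule simply_connected_component_vimage_ball)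
        \<comment> \<open>A critical value of \<open>u\<close> lies in \<open>cball b r\<close>,
          whose image under \<open>g\<close> keeps distance \<open>\<epsilon>0\<close> from
          \<open>y'\<close>; so \<open>Q\<close>, which lies over the disc about \<open>y'\<close>,
          contains none, and \<open>u\<close> is injective on \<open>W\<close>.\<close>
        have dis: "Q \<inter> crit_vals u = {}"
        proof (rule ccontr)
          assume "Q \<inter> crit_vals u \<noteq> {}"
          then obtain x where x: "x \<in> Q" "x \<in> crit_vals u" by blast
          have "x \<in> cball b r" using crit_vals_after_V[OF v] x(2) ball_subset_cball unfolding u_def by blast
          then have "\<epsilon>0 \<le> dist (poly g x) y'" by (rule \<epsilon>0(2)[OF g _ y'(1)])
          moreover have "x \<in> P" using x(1) in_components_subset[OF Q(1)] by blast
          then have "dist (poly g x) y' < 2 * e" by (simp add: P_def dist_commute)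
          ultimately show False using e(3) by linarith
        qed
        have WQ: "W \<subseteq> poly u -` Q" using Q(2) by blast
        have inj: "inj_on (poly u) W"
          by (rule inj_on_over_simply_connected[OF du \<open>open Q\<close> \<open>simply_connected Q\<close> dis W(1) WQ])
        have unram: "poly (pderiv u) x \<noteq> 0" if "x \<in> W" for x
          using dis WQ that unfolding crit_vals_def by blast
        have "preimage_count f W y = preimage_count g (poly u ` W) y"
          unfolding feq u_def[symmetric] by (rule preimage_count_pcompose[OF dg du inj unram])
        also have "\<dots> \<le> N"
        proof (rule bmD[OF g cuW])
          show "poly u ` W \<subseteq> poly g -` ball y' \<epsilon>" using uW subset_ball[OF e(2), of y'] unfolding P_def by blast
        qed
        finally show ?thesis by simp
      qed
    qed
  qed
  \<comment> \<open>Compactness of the planar Julia set gives one spherical radius for all centres.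
    The balls lie over planar discs, so components over them omit infinity.\<close>
  obtain \<delta> where \<delta>: "\<delta> > 0" "\<And>x. x \<in> H.X \<Longrightarrow> ball (Fin x) \<delta> \<subseteq> Fin ` ball x e"
    using ball_subset_Fin_ball[OF H.compact_X e(1)] by metis
  have "covering_degree g W (ball y \<delta>) \<le> max N 1"
    if y: "y \<in> julia_set H" and g: "g \<in> H" and W: "W \<in> components (sphere_map g -` ball y \<delta>)" for y g W
  proof -
    obtain x where x: "y = Fin x" "x \<in> H.X" using y H.julia_eq by auto
    have deg: "degree g \<ge> 1" using H.degS[OF g] by simp
    have sub: "sphere_map g w \<in> Fin ` ball x e" if "w \<in> W" for w
    proof -
      have "w \<in> sphere_map g -` ball y \<delta>" using that in_components_subset[OF W] by blast
      then show ?thesis using \<delta>(2)[OF x(2)] x(1) by blast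
    qed
    have "Infinity \<notin> W"
    proof
      assume "Infinity \<in> W"
      from sub[OF this] deg show False by auto
    qed
    then have "W = Fin ` (Fin -` W)" by (rule sphere_set_eq(1))
    then have "unFin ` W = unFin ` Fin ` (Fin -` W)" by (rule arg_cong)
    then have "Fin -` W = unFin ` W" by (simp only: image_image unFin_Fin image_ident)
    moreover have "connected (unFin ` W)"
      by (intro connected_continuous_image continuous_on_unFin \<open>Infinity \<notin> W\<close> in_components_connected[OF W])
    ultimately have conn: "connected (Fin -` W)" by simp
    have "Fin -` W \<subseteq> poly g -` ball x e"
    proof
      fix w assume "w \<in> Fin -` W"
      then show "w \<in> poly g -` ball x e" using sub[of "Fin w"] by auto
    qed
    then have "preimage_count g (Fin -` W) x \<le> max N 1" by (rule main[OF x(2) g conn])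
    moreover have "covering_degree g W (ball y \<delta>) = sphere_count g W y"
      by (rule covering_degree_eq[OF deg W]) (use \<delta>(1) in simp)
    ultimately show ?thesis by (simp add: x(1) sphere_count_Fin[OF deg])
  qed
  then show ?thesis unfolding semi_hyperbolic_def using \<delta>(1) by metis
qed

end

section \<open>The topology of uniform convergence\<close>

lemma unif_dist_less_imp:
  assumes "unif_dist h h0 < \<delta>" shows "dist (Fin (poly h z)) (Fin (poly h0 z)) < \<delta>"
  using dist_le_unif_dist[of h "Fin z" h0] assms by simp

text \<open>The maximum principle near infinity spares proving that close polynomials have equal degrees.\<close>

lemma locally_uniform_growth:
  assumes "degree h0 \<ge> 1"
  shows "\<exists>\<delta>>0. \<exists>m>0. \<exists>\<rho>>0. \<forall>h. unif_dist h h0 < \<delta> \<longrightarrow> k \<le> degree h \<longrightarrow>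
    (\<forall>z. cmod (z - b) \<ge> \<rho> \<longrightarrow> m * cmod (z - b) ^ k \<le> cmod (poly h z - b))"
proof -
  obtain r0 where r0: "\<And>z. cmod z \<ge> r0 \<Longrightarrow> cmod (poly h0 z) \<ge> cmod b + 2"
    using poly_large[OF assms] by metis
  define \<rho> where "\<rho> = max 1 (r0 + cmod b)"
  have \<rho>: "\<rho> > 0" by (simp add: \<rho>_def)
  have big: "cmod (poly h0 z - b) \<ge> 2" if "cmod (z - b) \<ge> \<rho>" for z
  proof -
    have "cmod (z - b) \<ge> r0 + cmod b" using that by (simp add: \<rho>_def)
    then have "cmod z \<ge> r0" using norm_triangle_ineq4[of z b] by linarith
    then show ?thesis using r0[of z] norm_triangle_ineq2[of "poly h0 z" b] by linarith
  qed
  \<comment> \<open>The comparison is centred at the value of \<open>h\<close>, since only centres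
    in a compact disc are controlled: a value of \<open>h\<close> within 1 of \<open>b\<close> would
    bring the value of \<open>h0\<close> within 2, against \<open>big\<close>.\<close>
  obtain \<delta> where \<delta>: "\<delta> > 0" "\<And>x. x \<in> cball b 1 \<Longrightarrow> ball (Fin x) \<delta> \<subseteq> Fin ` ball x 1"
    using ball_subset_Fin_ball[of "cball b 1" 1] by auto
  have "1 / \<rho> ^ k * cmod (z - b) ^ k \<le> cmod (poly h z - b)"
    if h: "unif_dist h h0 < \<delta>" "k \<le> degree h" and z: "cmod (z - b) \<ge> \<rho>" for h z
  proof -
    have gt: "cmod (poly h x - b) > 1" if x: "cmod (x - b) \<ge> \<rho>" for x
    proof (rule ccontr)
      assume le1: "\<not> cmod (poly h x - b) > 1"
      then have "poly h x \<in> cball b 1" by (simp add: dist_cmod)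
      moreover have "Fin (poly h0 x) \<in> ball (Fin (poly h x)) \<delta>"
        using unif_dist_less_imp[OF h(1), of x] by simp
      ultimately have "Fin (poly h0 x) \<in> Fin ` ball (poly h x) 1" using \<delta>(2) by blast
      then have "dist (poly h x) (poly h0 x) < 1" by auto
      then have "cmod (poly h0 x - b) < 2"
        using le1 norm_triangle_ineq[of "poly h0 x - poly h x" "poly h x - b"]
        by (simp add: dist_cmod)
      then show False using big[OF x] by simp
    qed
    have "1 * (cmod (z - b) / \<rho>) ^ k \<le> cmod (poly h z - b)"
    proof (rule poly_exterior_lower_bound[OF \<rho> zero_less_one h(2) _ _ z])
      show "poly h x \<noteq> b" if "cmod (x - b) \<ge> \<rho>" for x using gt[OF that] by auto
      show "1 \<le> cmod (poly h x - b)" if "cmod (x - b) = \<rho>" for x using gt[of x] that by simp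
    qed
    then show ?thesis by (simp add: power_divide)
  qed
  moreover have "1 / \<rho> ^ k > 0" using \<rho> by simp
  ultimately show ?thesis using \<delta>(1) \<rho> by metis
qed

lemma Poly_ge2_limitin_iff:
  "limitin Poly_ge2_topology f l sequentially \<longleftrightarrow>
    l \<in> Poly_ge2 \<and> (\<forall>\<epsilon>>0. \<forall>\<^sub>F n in sequentially. f n \<in> Poly_ge2 \<and> unif_dist (f n) l < \<epsilon>)"
  by (rule Poly_ge2.limitin_metric)

text \<open>Constants valid near each member become uniform by sequential compactness: the
  counterexamples violate the bound with constant \<open>1 / (n + 1)\<close> at distance at least
  \<open>n + 1\<close>, and the constants at a limit in \<open>\<Gamma>\<close> beat both.\<close>

lemma compact_uniform_growth:
  assumes comp: "compactin Poly_ge2_topology \<Gamma>" and k: "\<And>h. h \<in> \<Gamma> \<Longrightarrow> k \<le> degree h"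
  shows "\<exists>m>0. \<exists>\<rho>>0. \<forall>h\<in>\<Gamma>. \<forall>z. cmod (z - b) \<ge> \<rho> \<longrightarrow> m * cmod (z - b) ^ k \<le> cmod (poly h z - b)"
proof (rule ccontr)
  assume neg: "\<not> ?thesis"
  have "\<exists>h z. h \<in> \<Gamma> \<and> cmod (z - b) \<ge> Suc n \<and> \<not> inverse (Suc n) * cmod (z - b) ^ k \<le> cmod (poly h z - b)" for n
  proof -
    have "inverse (real (Suc n)) > 0" "real (Suc n) > 0" by simp_all
    with neg show ?thesis by meson
  qed
  then obtain h z where hz: "\<And>n. h n \<in> \<Gamma>" "\<And>n. cmod (z n - b) \<ge> Suc n"
    "\<And>n. \<not> inverse (Suc n) * cmod (z n - b) ^ k \<le> cmod (poly (h n) (z n) - b)"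
    by metis
  have "range h \<subseteq> \<Gamma>" using hz(1) by blast
  then obtain l s where l: "l \<in> \<Gamma>" and s: "strict_mono (s :: nat \<Rightarrow> nat)"
    and lim: "limitin Poly_ge2_topology (h \<circ> s) l sequentially"
    using comp unfolding Poly_ge2.compactin_sequentially by metis
  have "l \<in> Poly_ge2" using lim unfolding Poly_ge2_limitin_iff by blast
  then have "degree l \<ge> 1" by (simp add: Poly_ge2_def)
  then obtain \<delta> m \<rho> where \<delta>: "\<delta> > 0" "m > 0" "\<rho> > 0"
    and grow: "\<And>h z. unif_dist h l < \<delta> \<Longrightarrow> k \<le> degree h \<Longrightarrow> cmod (z - b) \<ge> \<rho>
      \<Longrightarrow> m * cmod (z - b) ^ k \<le> cmod (poly h z - b)"
    using locally_uniform_growth[of l k b] by metis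
  have e1: "\<forall>\<^sub>F n in sequentially. unif_dist (h (s n)) l < \<delta>"
    using lim \<delta>(1) unfolding Poly_ge2_limitin_iff by (auto elim!: eventually_mono)
  obtain n1 where n1: "inverse (Suc n1) < m" using reals_Archimedean[OF \<delta>(2)] by blast
  obtain n2 where n2: "\<rho> < real n2" using reals_Archimedean2 by blast
  obtain n where n: "unif_dist (h (s n)) l < \<delta>" "n \<ge> n1" "n \<ge> n2"
    using eventually_happens'[OF sequentially_bot eventually_conj[OF e1 eventually_ge_at_top[of "max n1 n2"]]]
    by auto
  have sn: "s n \<ge> n" using s by (rule seq_suble)
  have "inverse (real (Suc (s n))) \<le> inverse (real (Suc n1))" using n sn by (intro le_imp_inverse_le) auto
  then have inv: "inverse (Suc (s n)) \<le> m" using n1 by linarith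
  have "\<rho> \<le> cmod (z (s n) - b)" using hz(2)[of "s n"] n2 n sn by linarith
  from grow[OF n(1) k[OF hz(1)] this]
  have "m * cmod (z (s n) - b) ^ k \<le> cmod (poly (h (s n)) (z (s n)) - b)" .
  moreover have "inverse (Suc (s n)) * cmod (z (s n) - b) ^ k \<le> m * cmod (z (s n) - b) ^ k"
    using inv by (intro mult_right_mono) auto
  ultimately show False using hz(3)[of "s n"] by linarith
qed

section \<open>Polynomials given by their coefficients at \<open>b\<close>\<close>

definition poly_at :: "complex \<Rightarrow> nat \<Rightarrow> (nat \<Rightarrow> complex) \<Rightarrow> complex poly" where
  "poly_at b d c = [:b:] + (\<Sum>j\<le>d. monom (c j) j) \<circ>\<^sub>p [:- b, 1:]"

lemma poly_poly_at: "poly (poly_at b d c) z = b + (\<Sum>j\<le>d. c j * (z - b) ^ j)"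
  by (simp add: poly_at_def poly_pcompose poly_sum poly_monom)

lemma coeff_sum_monom: "coeff (\<Sum>j\<le>d. monom (c j) j) i = (if i \<le> d then c i else 0)"
  by (simp add: coeff_sum)

lemma degree_poly_at:
  assumes "c d \<noteq> 0" shows "degree (poly_at b d c) = d"
proof -
  define q where "q = (\<Sum>j\<le>d. monom (c j) j)"
  have "degree q = d"
    by (rule antisym) (use assms in \<open>auto intro!: degree_le le_degree simp: q_def coeff_sum_monom\<close>)
  then have "degree (q \<circ>\<^sub>p [:- b, 1:]) = d" by (simp add: degree_pcompose)
  moreover have "poly_at b d c = q \<circ>\<^sub>p [:- b, 1:] - [:- b:]"
    by (simp add: poly_at_def q_def)
  ultimately show ?thesis by (simp only: degree_minus_const)
qed

text \<open>Cauchy's estimate on the unit circle: the \<open>n\<close>-th derivative at 0 is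
  \<open>n!\<close> times the coefficient.\<close>

lemma norm_coeff_le:
  fixes p :: "complex poly"
  assumes "\<And>u. cmod u = 1 \<Longrightarrow> cmod (poly p u) \<le> B"
  shows "cmod (coeff p n) \<le> B"
proof -
  have "(deriv ^^ n) (poly p) = poly ((pderiv ^^ n) p)" for n
  proof (induction n)
    case (Suc n)
    have "deriv (poly q) = poly (pderiv q)" for q :: "complex poly"
      using DERIV_imp_deriv[OF poly_DERIV] by blast
    then show ?case using Suc by simp
  qed simp
  moreover have "coeff ((pderiv ^^ n) q) 0 = fact n * coeff q n" for q :: "complex poly"
  proof (induction n arbitrary: q)
    case (Suc n)
    have "coeff ((pderiv ^^ Suc n) q) 0 = coeff ((pderiv ^^ n) (pderiv q)) 0"
      by (simp only: funpow_Suc_right o_apply)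
    also have "\<dots> = fact n * coeff (pderiv q) n" by (rule Suc)
    also have "\<dots> = fact (Suc n) * coeff q (Suc n)" by (simp add: coeff_pderiv)
    finally show ?case .
  qed simp
  ultimately have "(deriv ^^ n) (poly p) 0 = fact n * coeff p n" by (simp add: poly_0_coeff_0)
  moreover have "cmod ((deriv ^^ n) (poly p) 0) \<le> fact n * B / 1 ^ n"
    by (rule Cauchy_inequality) (use assms in \<open>auto intro: holomorphic_on_poly continuous_on_poly'\<close>)
  ultimately have "fact n * cmod (coeff p n) \<le> fact n * B" by (simp add: norm_mult)
  then show ?thesis by simp
qed

lemma poly_at_lower_bound:
  assumes d: "d \<ge> 1" and \<alpha>: "\<alpha> \<le> cmod (c d)" and C: "\<And>j. j < d \<Longrightarrow> cmod (c j) \<le> C" "0 \<le> C"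
    and z: "cmod (z - b) \<ge> 1"
  shows "cmod (z - b) ^ (d - 1) * (\<alpha> * cmod (z - b) - d * C) \<le> cmod (poly (poly_at b d c) z - b)"
proof -
  define x where "x = cmod (z - b)"
  have x: "x \<ge> 1" using z by (simp add: x_def)
  have "poly (poly_at b d c) z - b = c d * (z - b) ^ d + (\<Sum>j<d. c j * (z - b) ^ j)"
    by (simp add: poly_poly_at lessThan_Suc_atMost[symmetric])
  then have "cmod (c d * (z - b) ^ d) - cmod (\<Sum>j<d. c j * (z - b) ^ j) \<le> cmod (poly (poly_at b d c) z - b)"
    using norm_diff_ineq[of "c d * (z - b) ^ d" "\<Sum>j<d. c j * (z - b) ^ j"] by simp
  moreover have "cmod (\<Sum>j<d. c j * (z - b) ^ j) \<le> (\<Sum>j<d. C * x ^ (d - 1))"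
  proof (rule sum_norm_le)
    fix j assume "j \<in> {..<d}"
    then have "j < d" by simp
    have "x ^ j \<le> x ^ (d - 1)" using \<open>j < d\<close> x by (intro power_increasing) auto
    then show "cmod (c j * (z - b) ^ j) \<le> C * x ^ (d - 1)"
      using C(1)[OF \<open>j < d\<close>] C(2) x by (simp add: norm_mult norm_power x_def[symmetric] mult_mono)
  qed
  moreover have "\<alpha> * x ^ d \<le> cmod (c d * (z - b) ^ d)"
    using \<alpha> x by (simp add: norm_mult norm_power x_def[symmetric] mult_right_mono)
  moreover have "x ^ d = x ^ (d - 1) * x" using d by (simp add: power_eq_if)
  then have "x ^ (d - 1) * (\<alpha> * x - d * C) = \<alpha> * x ^ d - (\<Sum>j<d. C * x ^ (d - 1))"
    by (simp add: algebra_simps)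
  ultimately show ?thesis unfolding x_def[symmetric] by linarith
qed

text \<open>On a large disc the values are close because the coefficients are. Outside it the
  leading coefficients, bounded below by \<alpha>, bring all values uniformly near infinity.\<close>

lemma poly_at_tendsto:
  assumes d: "d \<ge> 2" and c: "\<And>j. j \<le> d \<Longrightarrow> (\<lambda>n. c n j) \<longlonglongrightarrow> l j"
    and \<alpha>: "\<alpha> > 0" "\<And>n. \<alpha> \<le> cmod (c n d)" "\<alpha> \<le> cmod (l d)"
    and C: "\<And>n j. j \<le> d \<Longrightarrow> cmod (c n j) \<le> C" "\<And>j. j \<le> d \<Longrightarrow> cmod (l j) \<le> C"
    and \<epsilon>: "\<epsilon> > 0"
  shows "\<forall>\<^sub>F n in sequentially. unif_dist (poly_at b d (c n)) (poly_at b d l) < \<epsilon>"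
proof -
  define p where "p = (\<lambda>n. poly_at b d (c n))"
  define q where "q = poly_at b d l"
  have C0: "C \<ge> 0" using C(2)[of 0] norm_ge_zero[of "l 0"] by linarith
  have degp: "degree (p n) = d" for n
    unfolding p_def by (rule degree_poly_at) (use \<alpha>(1) \<alpha>(2)[of n] in auto)
  have degq: "degree q = d"
    unfolding q_def by (rule degree_poly_at) (use \<alpha> in auto)
  obtain M where M: "\<And>w. cmod w \<ge> M \<Longrightarrow> Fin w \<in> ball Infinity (\<epsilon> / 4)"
    using Infinity_nbhd[of "ball Infinity (\<epsilon> / 4)"] \<epsilon> by auto
  define \<rho> where "\<rho> = max 1 ((\<bar>M\<bar> + cmod b + d * C) / \<alpha>)"
  have far: "cmod (poly (poly_at b d e) z) \<ge> M"
    if "\<alpha> \<le> cmod (e d)" "\<And>j. j \<le> d \<Longrightarrow> cmod (e j) \<le> C" "cmod (z - b) \<ge> \<rho>" for e z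
  proof -
    define x where "x = cmod (z - b)"
    have x: "x \<ge> 1" "x \<ge> (\<bar>M\<bar> + cmod b + d * C) / \<alpha>" using that(3) by (auto simp: x_def \<rho>_def)
    then have y: "\<alpha> * x - d * C \<ge> \<bar>M\<bar> + cmod b" using \<alpha>(1) by (simp add: field_simps)
    have "x ^ (d - 1) * (\<alpha> * x - d * C) \<le> cmod (poly (poly_at b d e) z - b)"
      unfolding x_def by (rule poly_at_lower_bound) (use that d C0 x in \<open>auto simp: x_def\<close>)
    moreover have "1 * (\<alpha> * x - d * C) \<le> x ^ (d - 1) * (\<alpha> * x - d * C)"
      using x(1) y norm_ge_zero[of b] by (intro mult_right_mono one_le_power) linarith+
    ultimately have "1 * (\<alpha> * x - d * C) \<le> cmod (poly (poly_at b d e) z - b)" by (rule order_trans[rotated])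
    then have "\<bar>M\<bar> + cmod b \<le> cmod (poly (poly_at b d e) z - b)" using y by simp
    then show ?thesis
      using norm_triangle_ineq4[of "poly (poly_at b d e) z" b] abs_ge_self[of M] by linarith
  qed
  have far_dist: "dist (Fin (poly (p n) z)) (Fin (poly q z)) < \<epsilon> / 2" if "cmod (z - b) \<ge> \<rho>" for n z
  proof -
    have "dist Infinity (Fin (poly (p n) z)) < \<epsilon> / 4" "dist Infinity (Fin (poly q z)) < \<epsilon> / 4"
      using M[of "poly (p n) z"] M[of "poly q z"] far[of "c n" z] far[of l z] that \<alpha> C
      by (auto simp: p_def q_def)
    then show ?thesis
      using dist_triangle3[of "Fin (poly (p n) z)" "Fin (poly q z)" Infinity] by linarith
  qed
  have "compact (poly q ` cball b \<rho>)"
    by (intro compact_continuous_image continuous_on_poly' compact_cball)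
  then obtain \<delta> where \<delta>: "\<delta> > 0"
    "\<And>x y. x \<in> poly q ` cball b \<rho> \<Longrightarrow> dist x y < \<delta> \<Longrightarrow> dist (Fin x) (Fin y) < \<epsilon> / 2"
    using Fin_ball_subset_ball[of "poly q ` cball b \<rho>" "\<epsilon> / 2"] \<epsilon> by (metis half_gt_zero)
  have "(\<lambda>n. \<Sum>j\<le>d. cmod (c n j - l j) * \<rho> ^ j) \<longlonglongrightarrow> (\<Sum>j\<le>d. cmod (l j - l j) * \<rho> ^ j)"
    by (intro tendsto_sum tendsto_mult tendsto_norm tendsto_diff tendsto_const) (use c in auto)
  then have "(\<lambda>n. \<Sum>j\<le>d. cmod (c n j - l j) * \<rho> ^ j) \<longlonglongrightarrow> 0" by simp
  then have "\<forall>\<^sub>F n in sequentially. (\<Sum>j\<le>d. cmod (c n j - l j) * \<rho> ^ j) < \<delta>"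
    using \<delta>(1) by (rule order_tendstoD)
  then show ?thesis
  proof eventually_elim
    case (elim n)
    have near: "dist (Fin (poly (p n) z)) (Fin (poly q z)) < \<epsilon> / 2" if z: "cmod (z - b) \<le> \<rho>" for z
    proof -
      have "poly (p n) z - poly q z = (\<Sum>j\<le>d. (c n j - l j) * (z - b) ^ j)"
        by (simp add: p_def q_def poly_poly_at sum_subtractf[symmetric] left_diff_distrib)
      also have "cmod \<dots> \<le> (\<Sum>j\<le>d. cmod (c n j - l j) * \<rho> ^ j)"
        by (rule sum_norm_le) (use z in \<open>auto simp: norm_mult norm_power intro!: mult_left_mono power_mono\<close>)
      finally have "dist (poly q z) (poly (p n) z) < \<delta>" using elim by (simp add: dist_cmod)
      moreover have "poly q z \<in> poly q ` cball b \<rho>" using z by (simp add: dist_cmod)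
      ultimately show ?thesis using \<delta>(2) by (simp add: dist_commute)
    qed
    have "unif_dist (p n) q \<le> \<epsilon> / 2"
      unfolding unif_dist_def
    proof (rule cSUP_least)
      fix x
      show "dist (sphere_map (p n) x) (sphere_map q x) \<le> \<epsilon> / 2"
      proof (cases x)
        case (Fin z)
        then show ?thesis using near[of z] far_dist[of z n] by (cases "cmod (z - b) \<le> \<rho>") auto
      next
        case Infinity
        then show ?thesis using degp[of n] degq d \<epsilon> by simp
      qed
    qed simp
    then show ?case using \<epsilon> by (simp add: p_def q_def)
  qed
qed

text \<open>A closed ball in the space of coefficients at \<open>b\<close>, centred at those of
  \<open>g_a\<close>, so that compactness reduces to Bolzano-Weierstrass in finitely many
  coordinates.\<close>

definition coeff_ball :: "complex \<Rightarrow> nat \<Rightarrow> complex \<Rightarrow> real \<Rightarrow> complex poly set" where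
  "coeff_ball b d a \<eta> = {poly_at b d c | c. cmod (c d - a) \<le> \<eta> \<and> (\<forall>j<d. cmod (c j) \<le> \<eta>)}"

context
  fixes b a :: complex and d :: nat and \<eta> :: real
  assumes d: "d \<ge> 2" and a: "a \<noteq> 0" and \<eta>: "0 < \<eta>" "\<eta> \<le> cmod a / 2"
begin

lemma coeff_ball_lead:
  assumes "cmod (x - a) \<le> \<eta>" shows "cmod a / 2 \<le> cmod x" "cmod x \<le> 3 / 2 * cmod a"
  using assms \<eta>(2) norm_triangle_ineq2[of a x] norm_triangle_sub[of x a]
  by (simp_all add: norm_minus_commute)

lemma coeff_ball_subset: "coeff_ball b d a \<eta> \<subseteq> Poly_ge2"
proof
  fix v assume "v \<in> coeff_ball b d a \<eta>"
  then obtain c where c: "v = poly_at b d c" "cmod (c d - a) \<le> \<eta>" unfolding coeff_ball_def by blast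
  then have "c d \<noteq> 0" using coeff_ball_lead(1)[OF c(2)] a by auto
  then show "v \<in> Poly_ge2" using degree_poly_at[of c d b] d by (simp add: c(1) Poly_ge2_def)
qed

lemma compactin_coeff_ball: "compactin Poly_ge2_topology (coeff_ball b d a \<eta>)"
  unfolding Poly_ge2.compactin_sequentially
proof (intro conjI allI impI coeff_ball_subset)
  fix \<sigma> :: "nat \<Rightarrow> complex poly" assume \<sigma>: "range \<sigma> \<subseteq> coeff_ball b d a \<eta>"
  have "\<exists>c. \<sigma> n = poly_at b d c \<and> cmod (c d - a) \<le> \<eta> \<and> (\<forall>j<d. cmod (c j) \<le> \<eta>)" for n
  proof -
    have "\<sigma> n \<in> coeff_ball b d a \<eta>" using \<sigma> by blast
    then show ?thesis unfolding coeff_ball_def by blast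
  qed
  then obtain c where c: "\<And>n. \<sigma> n = poly_at b d (c n)" "\<And>n. cmod (c n d - a) \<le> \<eta>"
    "\<And>n j. j < d \<Longrightarrow> cmod (c n j) \<le> \<eta>"
    by metis
  define C where "C = 3 / 2 * cmod a"
  have cC: "cmod (c n j) \<le> C" if "j \<le> d" for n j
  proof (cases "j = d")
    case True
    then show ?thesis using coeff_ball_lead(2)[OF c(2)[of n]] by (simp add: C_def)
  next
    case False
    then have "cmod (c n j) \<le> \<eta>" using that by (intro c(3)) simp
    then show ?thesis using \<eta>(2) norm_ge_zero[of a] unfolding C_def by linarith
  qed
  obtain s l where s: "strict_mono (s :: nat \<Rightarrow> nat)" and l: "\<And>j. j < Suc d \<Longrightarrow> (\<lambda>n. c (s n) j) \<longlonglongrightarrow> l j"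
    using convergent_subsequence_finitely_many[of "Suc d" c C] cC by (metis less_Suc_eq_le)
  have "(\<lambda>n. cmod (c (s n) d - a)) \<longlonglongrightarrow> cmod (l d - a)" by (intro tendsto_norm tendsto_diff tendsto_const l) simp
  then have ld: "cmod (l d - a) \<le> \<eta>"
    by (rule tendsto_upperbound) (use c(2) in \<open>auto intro!: always_eventually\<close>)
  have lj: "cmod (l j) \<le> \<eta>" if "j < d" for j
  proof -
    have "(\<lambda>n. cmod (c (s n) j)) \<longlonglongrightarrow> cmod (l j)" by (intro tendsto_norm l) (use that in simp)
    then show ?thesis
      by (rule tendsto_upperbound) (use c(3) that in \<open>auto intro!: always_eventually\<close>)
  qed
  have lC: "cmod (l j) \<le> C" if "j \<le> d" for j
  proof (cases "j = d")
    case True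
    then show ?thesis using coeff_ball_lead(2)[OF ld] by (simp add: C_def)
  next
    case False
    then have "cmod (l j) \<le> \<eta>" using that by (intro lj) simp
    then show ?thesis using \<eta>(2) norm_ge_zero[of a] unfolding C_def by linarith
  qed
  have inV: "poly_at b d l \<in> coeff_ball b d a \<eta>" using ld lj unfolding coeff_ball_def by blast
  have "limitin Poly_ge2_topology (\<sigma> \<circ> s) (poly_at b d l) sequentially"
    unfolding Poly_ge2_limitin_iff
  proof (intro conjI allI impI)
    show "poly_at b d l \<in> Poly_ge2" using inV coeff_ball_subset by blast
    fix \<epsilon> :: real assume "\<epsilon> > 0"
    have "\<forall>\<^sub>F n in sequentially. unif_dist (poly_at b d (c (s n))) (poly_at b d l) < \<epsilon>"
    proof (rule poly_at_tendsto[where \<alpha> = "cmod a / 2" and C = C])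
      show "(\<lambda>n. c (s n) j) \<longlonglongrightarrow> l j" if "j \<le> d" for j using l that by simp
      show "cmod a / 2 \<le> cmod (c (s n) d)" for n by (rule coeff_ball_lead(1)[OF c(2)])
      show "cmod a / 2 \<le> cmod (l d)" by (rule coeff_ball_lead(1)[OF ld])
    qed (use d a cC lC \<open>\<epsilon> > 0\<close> in auto)
    moreover have "(\<sigma> \<circ> s) n \<in> Poly_ge2" for n using \<sigma> coeff_ball_subset by auto
    ultimately show "\<forall>\<^sub>F n in sequentially. (\<sigma> \<circ> s) n \<in> Poly_ge2 \<and> unif_dist ((\<sigma> \<circ> s) n) (poly_at b d l) < \<epsilon>"
      by (simp add: c(1))
  qed
  then show "\<exists>l r. l \<in> coeff_ball b d a \<eta> \<and> strict_mono r \<and> limitin Poly_ge2_topology (\<sigma> \<circ> r) l sequentially"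
    using inV s by blast
qed

text \<open>Uniform spherical closeness gives Euclidean closeness on a fixed disc, and Cauchy's
  estimates then bound the coefficients. A degree above \<open>d\<close> is excluded first, because
  growth of order \<open>d + 1\<close> would show on the circle of radius \<open>x\<close>.\<close>

lemma coeff_ball_nbhd:
  "smult a ([:- b, 1:] ^ d) + [:b:] \<in> Poly_ge2_topology interior_of coeff_ball b d a \<eta>"
proof -
  define g where "g = smult a ([:- b, 1:] ^ d) + [:b:]"
  have gz: "poly g z = b + a * (z - b) ^ d" for z by (simp add: g_def)
  have "degree g = d"
  proof -
    have "degree (smult a ([:- b, 1:] ^ d)) = d" using a by (simp add: degree_power_eq)
    moreover have "g = smult a ([:- b, 1:] ^ d) - [:- b:]" by (simp add: g_def)
    ultimately show ?thesis by (simp only: degree_minus_const)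
  qed
  then have gP: "g \<in> Poly_ge2" and g1: "degree g \<ge> 1" using d by (auto simp: Poly_ge2_def)
  obtain \<delta>1 m \<rho> where \<delta>1: "\<delta>1 > 0" "m > 0" "\<rho> > 0"
    and grow: "\<And>h z. unif_dist h g < \<delta>1 \<Longrightarrow> Suc d \<le> degree h \<Longrightarrow> cmod (z - b) \<ge> \<rho>
      \<Longrightarrow> m * cmod (z - b) ^ Suc d \<le> cmod (poly h z - b)"
    using locally_uniform_growth[OF g1, of "Suc d" b] by metis
  \<comment> \<open>\<open>m * x \<ge> |a| + 2\<close> makes \<open>m * x ^ (d + 1)\<close> exceed
    \<open>|a| * x ^ d + 1\<close>, which bounds any nearby polynomial minus \<open>b\<close> on
    this circle.\<close>
  define x where "x = max (max 1 \<rho>) ((cmod a + 2) / m)"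
  have x12: "x \<ge> 1" "x \<ge> \<rho>" and "(cmod a + 2) / m \<le> x" by (auto simp: x_def)
  then have "m * x \<ge> cmod a + 2" using \<delta>1(2) by (simp add: divide_le_eq mult.commute)
  note x = x12 this
  \<comment> \<open>The 1 serves the comparison of degrees, \<eta> the estimate of
    coefficients.\<close>
  define \<kappa> where "\<kappa> = min 1 \<eta>"
  have "compact (poly g ` cball b x)" by (intro compact_continuous_image continuous_on_poly' compact_cball)
  moreover have "\<kappa> > 0" using \<eta> by (simp add: \<kappa>_def)
  ultimately obtain \<delta>2 where \<delta>2: "\<delta>2 > 0"
    "\<And>y. y \<in> poly g ` cball b x \<Longrightarrow> ball (Fin y) \<delta>2 \<subseteq> Fin ` ball y \<kappa>"
    using ball_subset_Fin_ball by metis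
  have V: "v \<in> coeff_ball b d a \<eta>" if v: "unif_dist v g < min \<delta>1 \<delta>2" for v
  proof -
    have close: "cmod (poly v z - poly g z) < \<kappa>" if "cmod (z - b) \<le> x" for z
    proof -
      have "Fin (poly v z) \<in> ball (Fin (poly g z)) \<delta>2"
        using unif_dist_less_imp[of v g \<delta>2 z] v by (simp add: dist_commute)
      moreover have "poly g z \<in> poly g ` cball b x" using that by (simp add: dist_cmod)
      ultimately have "Fin (poly v z) \<in> Fin ` ball (poly g z) \<kappa>" using \<delta>2(2) by blast
      then show ?thesis by (auto simp: dist_cmod)
    qed
    have degv: "degree v \<le> d"
    proof (rule ccontr)
      assume "\<not> ?thesis"
      define z where "z = b + complex_of_real x"
      have zb: "cmod (z - b) = x" using x by (simp add: z_def)
      have "m * x ^ Suc d \<le> cmod (poly v z - b)"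
        using grow[of v z] v x \<open>\<not> degree v \<le> d\<close> by (simp add: zb)
      moreover have "cmod (poly v z - b) \<le> cmod (poly v z - poly g z) + cmod (poly g z - b)"
        using norm_triangle_ineq[of "poly v z - poly g z" "poly g z - b"] by simp
      moreover have "cmod (poly g z - b) = cmod a * x ^ d" by (simp add: gz norm_mult norm_power zb)
      moreover have "cmod (poly v z - poly g z) < 1" using close[of z] zb by (simp add: \<kappa>_def)
      moreover have "(cmod a + 2) * x ^ d \<le> m * x * x ^ d" using x by (intro mult_right_mono) auto
      moreover have "1 \<le> x ^ d" using x by simp
      moreover have "m * x ^ Suc d = m * x * x ^ d" by simp
      moreover have "(cmod a + 2) * x ^ d = cmod a * x ^ d + 2 * x ^ d" by (simp add: algebra_simps)
      ultimately show False by linarith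
    qed
    define w where "w = (v - [:b:]) \<circ>\<^sub>p [:b, 1:]"
    have pw: "poly w u = poly v (b + u) - b" for u by (simp add: w_def poly_pcompose)
    have "degree w \<le> d" using degv by (simp add: w_def degree_pcompose degree_minus_const)
    then have wsum: "w = (\<Sum>j\<le>d. monom (coeff w j) j)"
      by (intro poly_eqI) (auto simp: coeff_sum_monom coeff_eq_0)
    have "v = poly_at b d (coeff w)"
    proof (rule poly_eq_poly_eq_iff[THEN iffD1], rule ext)
      fix z
      have "poly (poly_at b d (coeff w)) z = b + poly w (z - b)"
        unfolding poly_at_def wsum[symmetric] by (simp add: poly_pcompose)
      then show "poly v z = poly (poly_at b d (coeff w)) z" by (simp add: pw)
    qed
    moreover have est: "cmod (coeff (w - monom a d) j) \<le> \<eta>" for j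
    proof (rule norm_coeff_le)
      fix u :: complex assume u: "cmod u = 1"
      have "poly (w - monom a d) u = poly v (b + u) - poly g (b + u)" by (simp add: pw gz poly_monom)
      then show "cmod (poly (w - monom a d) u) \<le> \<eta>" using close[of "b + u"] u x by (simp add: \<kappa>_def)
    qed
    moreover have "cmod (coeff w d - a) \<le> \<eta>" using est[of d] by simp
    moreover have "cmod (coeff w j) \<le> \<eta>" if "j < d" for j using est[of j] that by simp
    ultimately show ?thesis unfolding coeff_ball_def by blast
  qed
  have "Poly_ge2.mball g (min \<delta>1 \<delta>2) \<subseteq> coeff_ball b d a \<eta>"
    using V Poly_ge2.commute by (auto simp: Poly_ge2.mball_def)
  moreover have "openin Poly_ge2_topology (Poly_ge2.mball g (min \<delta>1 \<delta>2))" by (rule Poly_ge2.openin_mball)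
  moreover have "g \<in> Poly_ge2.mball g (min \<delta>1 \<delta>2)" using gP \<delta>1(1) \<delta>2(1) by simp
  ultimately have "g \<in> Poly_ge2_topology interior_of coeff_ball b d a \<eta>"
    unfolding interior_of_def by blast
  then show ?thesis by (simp only: g_def)
qed

end

section \<open>The separating annulus\<close>

text \<open>The letter applied first decides the fate of the annulus: after one from
  \<open>\<Gamma>\<close> every continuation stays beyond \<rho>, after one from \<open>V\<close>
  every continuation stays in the invariant set \<open>K\<close>. This is the alternative needed for
  normality. Elements of \<open>\<Gamma>\<close> supply Julia points on the inner side, elements of
  \<open>V\<close> on the outer side.\<close>

lemma perturbation_separating_annulus:
  assumes H: "perturbation \<Gamma> b \<rho> V r r'" and t: "0 < t" "2 * t \<le> \<rho>"
    and \<Gamma>t: "escaping \<Gamma> b t"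
    and far: "\<And>h z. h \<in> \<Gamma> \<Longrightarrow> cmod (z - b) \<ge> t \<Longrightarrow> cmod (poly h z - b) \<ge> \<rho>"
    and near: "\<And>v z. v \<in> V \<Longrightarrow> cmod (z - b) \<le> 2 * t \<Longrightarrow> poly v z \<in> ball b r"
  shows "semigroup_generated (\<Gamma> \<union> V) \<in> class_G_dis"
    and "min_generators (\<Gamma> \<union> V) \<subseteq> \<Gamma>"
proof -
  interpret P: perturbation \<Gamma> b \<rho> V r r' by (rule H)
  interpret T: escaping \<Gamma> b t by (rule \<Gamma>t)
  have \<rho>: "\<rho> > 0" using t by simp
  have rK: "z \<in> P.G.K" if "z \<in> ball b r" for z using that P.ball_r_K by auto
  have KR: "cmod (z - b) \<le> \<rho>" if "z \<in> P.G.K" for z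
    using subsetD[OF P.G.K_subset that] by (simp add: dist_cmod)
  have bK: "b \<in> P.G.K" using P.G.b_int interior_subset by blast
  \<comment> \<open>\<open>t\<close> is an escape radius for \<open>h\<close> alone, which confines
    its Julia set; the set is nonempty because \<open>b\<close> has a bounded orbit.\<close>
  have inside_pt: "julia_set (semigroup_generated {h}) \<noteq> {}"
    "julia_set (semigroup_generated {h}) \<subseteq> Fin ` cball b t" if h: "h \<in> \<Gamma>" for h
  proof -
    interpret h: escaping "{h}" b t
      by unfold_locales (use h T.R_pos T.deg T.escape in auto)
    have "h.S \<subseteq> P.G.S" by (rule semigroup_generated_mono) (use h in simp)
    then have "(\<Union>g\<in>h.S. {poly g b}) \<subseteq> (\<Union>g\<in>P.G.S. {poly g b})" by (rule UN_mono) simp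
    moreover have "bounded (\<Union>g\<in>P.G.S. {poly g b})" using bK by (simp add: K_hat_def)
    ultimately have "bounded (\<Union>g\<in>h.S. {poly g b})" by (rule bounded_subset[rotated])
    then have "h.K \<noteq> {}" by (auto simp: K_hat_def)
    then show "julia_set h.S \<noteq> {}" using h.K_nonempty_imp_X_nonempty by (simp add: h.julia_eq)
    show "julia_set h.S \<subseteq> Fin ` cball b t"
      unfolding h.julia_eq by (rule image_mono[OF h.X_subset])
  qed
  \<comment> \<open>All iterates of \<open>v\<close> map \<open>ball b (2 * t)\<close> into
    \<open>ball b r\<close>, so this ball contains no Julia point of \<open>v\<close>, while the
    bounded orbit of \<open>b\<close> shows that Julia points exist.\<close>
  have outside_pt: "\<exists>z. Fin z \<in> julia_set (semigroup_generated {v}) \<and> cmod (z - b) \<ge> 2 * t" if v: "v \<in> V" for v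
  proof -
    interpret v: escaping "{v}" b \<rho>
      by unfold_locales (use v \<rho> P.degV P.escapeV in auto)
    have inv: "poly f z \<in> ball b r" if f: "f \<in> v.S" and z: "z \<in> ball b (2 * t)" for f z
      using f
    proof (induction rule: semigroup_generated_induct_left)
      case (generator h)
      then show ?case using near[OF v, of z] z by (auto simp: dist_cmod)
    next
      case (compose h f)
      then have "h = v" by simp
      have "poly v (poly f z) \<in> ball b r" by (rule P.V_K[OF v rK[OF compose.IH]])
      then show ?case by (simp only: \<open>h = v\<close> poly_pcompose)
    qed
    have "cmod (poly f b - b) \<le> \<rho>" if "f \<in> v.S" for f
      using KR[OF rK[OF inv[OF that, of b]]] t by simp
    then have "v.K \<noteq> {}" using v.K_iff by blast
    then obtain z where z: "z \<in> v.X" using v.K_nonempty_imp_X_nonempty by blast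
    have "\<not> cmod (z - b) < 2 * t"
    proof
      assume lt: "cmod (z - b) < 2 * t"
      have "Fin z \<in> fatou_set v.S"
      proof (rule Fin_in_fatou_set[of "ball b (2 * t)" z 1 v.S b r])
        show "(\<forall>z\<in>ball b (2 * t). cmod (poly f z - b) \<le> r) \<or> (\<forall>z\<in>ball b (2 * t). 1 \<le> cmod (poly f z - b))"
          if "f \<in> v.S" for f
          using inv[OF that] by (auto simp: dist_cmod less_imp_le)
      qed (use lt in \<open>auto simp: dist_cmod\<close>)
      with z show False by (simp add: v.X_def julia_set_def)
    qed
    then show ?thesis using z by (auto simp: v.X_def not_less)
  qed
  have sub: "julia_set (semigroup_generated {h}) \<subseteq> julia_set P.H" if "h \<in> \<Gamma> \<union> V" for h
    by (intro julia_set_mono semigroup_generated_mono) (use that in simp)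
  define U where "U = {z. t < cmod (z - b) \<and> cmod (z - b) < 2 * t}"
  have "open U" unfolding U_def
    by (intro open_Collect_conj open_Collect_less continuous_intros)
  have gap: "\<not> (t < cmod (z - b) \<and> cmod (z - b) < 2 * t)" if z: "z \<in> P.H.X" for z
  proof
    assume zU: "t < cmod (z - b) \<and> cmod (z - b) < 2 * t"
    have "Fin z \<in> fatou_set P.H"
    proof (rule Fin_in_fatou_set[OF \<open>open U\<close> _ \<rho>, of z _ b \<rho>])
      show "z \<in> U" using zU by (simp add: U_def)
      fix f assume "f \<in> P.H"
      then show "(\<forall>z\<in>U. cmod (poly f z - b) \<le> \<rho>) \<or> (\<forall>z\<in>U. \<rho> \<le> cmod (poly f z - b))"
      proof (induction rule: semigroup_generated_induct_right)
        case (generator h)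
        show ?case
        proof (cases "h \<in> \<Gamma>")
          case True
          have "\<rho> \<le> cmod (poly h z - b)" if "z \<in> U" for z
            by (rule far[OF True]) (use that in \<open>simp add: U_def\<close>)
          then show ?thesis by blast
        next
          case False
          then have "h \<in> V" using generator by blast
          have "cmod (poly h z - b) \<le> \<rho>" if "z \<in> U" for z
            by (rule KR, rule rK, rule near[OF \<open>h \<in> V\<close>]) (use that in \<open>simp add: U_def\<close>)
          then show ?thesis by blast
        qed
      next
        case (compose h f)
        show ?case
        proof (cases "h \<in> \<Gamma>")
          case True
          have "\<rho> \<le> cmod (poly (f \<circ>\<^sub>p h) z - b)" if "z \<in> U" for z
          proof -
            have 1: "\<rho> \<le> cmod (poly h z - b)"
              by (rule far[OF True]) (use that in \<open>simp add: U_def\<close>)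
            from P.H.escapeS[OF compose(2) 1] 1 \<rho> show ?thesis
              unfolding poly_pcompose by linarith
          qed
          then show ?thesis by blast
        next
          case False
          then have "h \<in> V" using compose by blast
          have "cmod (poly (f \<circ>\<^sub>p h) z - b) \<le> \<rho>" if "z \<in> U" for z
          proof -
            have "poly h z \<in> P.G.K"
              by (rule rK, rule near[OF \<open>h \<in> V\<close>]) (use that in \<open>simp add: U_def\<close>)
            then show ?thesis unfolding poly_pcompose by (rule KR[OF P.H_invariant[OF compose(2)]])
          qed
          then show ?thesis by blast
        qed
      qed
    qed
    with z show False by (simp add: P.H.X_def julia_set_def)
  qed
  obtain h0 where h0: "h0 \<in> \<Gamma>" using P.G.nonempty by blast
  obtain x where x: "Fin x \<in> julia_set (semigroup_generated {h0})" "cmod (x - b) \<le> t"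
    using inside_pt[OF h0] by (force simp: dist_cmod)
  have xX: "x \<in> P.H.X" using x sub[of h0] h0 by (auto simp: P.H.X_def)
  obtain v0 where v0: "v0 \<in> V" using P.V by blast
  obtain y where y: "Fin y \<in> julia_set (semigroup_generated {v0})" "cmod (y - b) \<ge> 2 * t"
    using outside_pt[OF v0] by blast
  have yX: "y \<in> P.H.X" using y sub[of v0] v0 by (auto simp: P.H.X_def)
  have "\<not> connected (julia_set P.H)"
  proof
    assume "connected (julia_set P.H)"
    then have conn_Fin: "connected (Fin ` P.H.X)" by (simp only: P.H.julia_eq)
    have "Infinity \<notin> Fin ` P.H.X" by auto
    from connected_continuous_image[OF continuous_on_unFin[OF this] conn_Fin]
    have "connected (unFin ` (Fin ` P.H.X))" .
    then have conn: "connected P.H.X" by (simp only: image_image unFin_Fin image_ident)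
    have "ball b (3 / 2 * t) \<inter> P.H.X = {} \<or> - cball b (3 / 2 * t) \<inter> P.H.X = {}"
    proof (rule connectedD[OF conn])
      show "P.H.X \<subseteq> ball b (3 / 2 * t) \<union> - cball b (3 / 2 * t)"
      proof
        fix z assume "z \<in> P.H.X"
        then have "cmod (z - b) \<le> t \<or> 2 * t \<le> cmod (z - b)" using gap[of z] by linarith
        then have "cmod (z - b) < 3 / 2 * t \<or> \<not> cmod (z - b) \<le> 3 / 2 * t" using t by linarith
        then show "z \<in> ball b (3 / 2 * t) \<union> - cball b (3 / 2 * t)" by (auto simp: dist_cmod)
      qed
    qed (auto simp: open_Compl)
    moreover have "x \<in> ball b (3 / 2 * t)" using x(2) t by (simp add: dist_cmod)
    moreover have "y \<in> - cball b (3 / 2 * t)" using y(2) t by (simp add: dist_cmod)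
    ultimately show False using xX yX by blast
  qed
  then show "P.H \<in> class_G_dis" using P.H.in_class_G by (simp add: class_G_dis_def)
  \<comment> \<open>The Julia point \<open>x\<close> on the inner side pins the minimal component to
    \<open>cball b t\<close>, whereas every element of \<open>V\<close> has a Julia point at
    distance at least \<open>2 * t\<close>.\<close>
  have Jmin: "J_min P.H \<subseteq> Fin ` cball b t"
    by (rule P.H.J_min_subset[of t "2 * t" x]) (use gap t xX x in auto)
  show "min_generators (\<Gamma> \<union> V) \<subseteq> \<Gamma>"
  proof
    fix h assume "h \<in> min_generators (\<Gamma> \<union> V)"
    then have h: "h \<in> \<Gamma> \<union> V" "julia_set (semigroup_generated {h}) \<subseteq> J_min P.H"
      by (auto simp: min_generators_def)
    show "h \<in> \<Gamma>"
    proof (rule ccontr)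
      assume "h \<notin> \<Gamma>"
      then have "h \<in> V" using h by blast
      then obtain z where z: "Fin z \<in> julia_set (semigroup_generated {h})" "cmod (z - b) \<ge> 2 * t"
        using outside_pt by blast
      then have "Fin z \<in> Fin ` cball b t" using h(2) Jmin by blast
      then have "cmod (z - b) \<le> t" by (auto simp: dist_cmod)
      then show False using z(2) t by linarith
    qed
  qed
qed

text \<open>A critical point \<open>z\<close> of \<open>h\<close> is also critical for every
  \<open>g \<circ> h\<close>, with critical value \<open>g(y)\<close>; so the whole orbit of
  \<open>y\<close> lies in the bounded planar postcritical set.\<close>

lemma crit_vals_in_K_hat:
  assumes G: "G = semigroup_generated \<Gamma>" "G \<in> class_G" and h: "h \<in> \<Gamma>"
  shows "crit_vals h \<subseteq> K_hat G"
proof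
  fix y assume y: "y \<in> crit_vals h"
  obtain z where z: "y = poly h z" "poly (pderiv h) z = 0" using y by (auto simp: crit_vals_def)
  have hG: "h \<in> G" unfolding G(1) by (rule semigroup_generated.generator[OF h])
  have deg: "degree g \<ge> 2" if "g \<in> G" for g using G(2) that by (simp add: class_G_def)
  have "poly g y \<in> planar_postcritical_set G" if g: "g \<in> G" for g
  proof -
    have gh: "g \<circ>\<^sub>p h \<in> G" using g hG unfolding G(1) by (rule semigroup_generated.compose)
    have "poly (pderiv (g \<circ>\<^sub>p h)) z = 0" using z(2) by (simp add: pderiv_pcompose)
    moreover have "poly (g \<circ>\<^sub>p h) z = poly g y" by (simp add: poly_pcompose z(1))
    ultimately have "poly g y \<in> crit_vals (g \<circ>\<^sub>p h)" unfolding crit_vals_def by force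
    then have "Fin (poly g y) \<in> critical_values (g \<circ>\<^sub>p h)"
      using critical_values_eq[OF deg[OF gh]] by blast
    then have "Fin (poly g y) \<in> (\<Union>g\<in>G. critical_values g)" using gh by blast
    then have "Fin (poly g y) \<in> postcritical_set G"
      unfolding postcritical_set_def using closure_subset by (rule subsetD[rotated])
    then show ?thesis by (simp add: planar_postcritical_set_def)
  qed
  then have "(\<Union>g\<in>G. {poly g y}) \<subseteq> planar_postcritical_set G" by blast
  moreover have "bounded (planar_postcritical_set G)" using G(2) by (simp add: class_G_def)
  ultimately show "y \<in> K_hat G" unfolding K_hat_def using bounded_subset by blast
qed

section \<open>Size and critical points of polynomials near \<open>g_a\<close>\<close>

lemma poly_at_small:
  assumes "\<And>j. j < d \<Longrightarrow> cmod (c j) \<le> \<eta>" "0 \<le> \<eta>" "cmod (z - b) \<le> s" "1 \<le> s"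
  shows "cmod (poly (poly_at b d c) z - b) \<le> cmod (c d) * s ^ d + d * \<eta> * s ^ d"
proof -
  have "poly (poly_at b d c) z - b = c d * (z - b) ^ d + (\<Sum>j<d. c j * (z - b) ^ j)"
    by (simp add: poly_poly_at lessThan_Suc_atMost[symmetric])
  then have "cmod (poly (poly_at b d c) z - b)
      \<le> cmod (c d * (z - b) ^ d) + cmod (\<Sum>j<d. c j * (z - b) ^ j)"
    by (simp add: norm_triangle_ineq)
  moreover have "cmod (c d * (z - b) ^ d) \<le> cmod (c d) * s ^ d"
    using assms(3) by (auto simp: norm_mult norm_power intro!: mult_left_mono power_mono)
  moreover have "cmod (\<Sum>j<d. c j * (z - b) ^ j) \<le> (\<Sum>j<d. \<eta> * s ^ d)"
  proof (rule sum_norm_le)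
    fix j assume "j \<in> {..<d}"
    then have j: "j < d" by simp
    have "cmod (z - b) ^ j \<le> s ^ j" using assms(3) by (intro power_mono) auto
    also have "s ^ j \<le> s ^ d" using assms(4) j by (intro power_increasing) auto
    finally show "cmod (c j * (z - b) ^ j) \<le> \<eta> * s ^ d"
      unfolding norm_mult norm_power using assms(1)[OF j] assms(2) by (intro mult_mono) auto
  qed
  ultimately show ?thesis by simp
qed

text \<open>At distance at least 1 from \<open>b\<close> the leading term of the derivative
  dominates all others together. Critical points therefore fall into a disc on which the perturbed
  polynomial stays close to \<open>b\<close>.\<close>

lemma crit_point_poly_at:
  assumes d: "d \<ge> 1" and c: "\<And>j. j < d \<Longrightarrow> cmod (c j) \<le> \<eta>" "0 \<le> \<eta>" "d * \<eta> < cmod (c d)"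
    and z: "poly (pderiv (poly_at b d c)) z = 0"
  shows "cmod (z - b) < 1"
proof (rule ccontr)
  assume "\<not> ?thesis"
  then have x1: "cmod (z - b) \<ge> 1" by simp
  define x where "x = cmod (z - b)"
  have "((\<lambda>z. b + (\<Sum>j\<le>d. c j * (z - b) ^ j)) has_field_derivative
      (\<Sum>j\<le>d. c j * (of_nat j * (z - b) ^ (j - 1)))) (at z)"
    by (auto intro!: derivative_eq_intros simp: mult_ac)
  moreover have "poly (poly_at b d c) = (\<lambda>z. b + (\<Sum>j\<le>d. c j * (z - b) ^ j))"
    by (rule ext) (rule poly_poly_at)
  ultimately have "(\<Sum>j\<le>d. c j * (of_nat j * (z - b) ^ (j - 1))) = 0"
    using DERIV_unique[OF poly_DERIV[of "poly_at b d c" z]] z by metis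
  then have "c d * (of_nat d * (z - b) ^ (d - 1)) = - (\<Sum>j<d. c j * (of_nat j * (z - b) ^ (j - 1)))"
    by (simp add: lessThan_Suc_atMost[symmetric] eq_neg_iff_add_eq_0 add.commute)
  then have "cmod (c d * (of_nat d * (z - b) ^ (d - 1))) = cmod (\<Sum>j<d. c j * (of_nat j * (z - b) ^ (j - 1)))"
    by (metis norm_minus_cancel)
  also have "\<dots> \<le> (\<Sum>j<d. \<eta> * (d * x ^ (d - 1)))"
  proof (rule sum_norm_le)
    fix j assume "j \<in> {..<d}"
    then have j: "j < d" by simp
    have "x ^ (j - 1) \<le> x ^ (d - 1)" using x1 j by (intro power_increasing) (auto simp: x_def)
    then have le: "real j * x ^ (j - 1) \<le> d * x ^ (d - 1)" using j by (intro mult_mono) (auto simp: x_def)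
    show "cmod (c j * (of_nat j * (z - b) ^ (j - 1))) \<le> \<eta> * (d * x ^ (d - 1))"
      unfolding norm_mult norm_power norm_of_nat x_def[symmetric]
      by (rule mult_mono[OF c(1)[OF j] le c(2)]) (simp add: x_def)
  qed
  also have "\<dots> = (d * \<eta>) * (d * x ^ (d - 1))" by simp
  finally have "cmod (c d) * (d * x ^ (d - 1)) \<le> (d * \<eta>) * (d * x ^ (d - 1))"
    by (simp add: norm_mult norm_power x_def)
  moreover have "0 < d * x ^ (d - 1)"
    using d x1 unfolding x_def by (intro mult_pos_pos zero_less_power) auto
  ultimately have "cmod (c d) \<le> d * \<eta>" by (simp only: mult_le_cancel_right_pos)
  with c(3) show False by simp
qed

theorem proposition2p58:
  fixes G \<Gamma> :: "complex poly set" and b :: complex and d :: nat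
  assumes "\<Gamma> \<noteq> {}"
    and "compactin Poly_ge2_topology \<Gamma>"
    and "G = semigroup_generated \<Gamma>"
    and "G \<in> class_G"
    and "interior (K_hat G) \<noteq> {}"
    and "b \<in> interior (K_hat G)"
    and "d \<ge> 2"
    and "\<forall>h\<in>\<Gamma>. (d, degree h) \<noteq> (2, 2)"
  shows "\<exists>c>0. \<forall>a::complex. 0 < cmod a \<and> cmod a < c \<longrightarrow>
    (\<exists>V. compactin Poly_ge2_topology V \<and>
         smult a ([:- b, 1:] ^ d) + [:b:] \<in> Poly_ge2_topology interior_of V \<and>
         (\<forall>V'. V' \<subseteq> V \<and> V' \<noteq> {} \<longrightarrow>
            semigroup_generated (\<Gamma> \<union> V') \<in> class_G_dis \<and>
            K_hat (semigroup_generated (\<Gamma> \<union> V')) = K_hat G \<and>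
            min_generators (\<Gamma> \<union> V') \<subseteq> \<Gamma>) \<and>
         (semi_hyperbolic G \<longrightarrow>
            (\<forall>V'. V' \<subseteq> V \<and> V' \<noteq> {} \<longrightarrow> semi_hyperbolic (semigroup_generated (\<Gamma> \<union> V')))) \<and>
         (hyperbolic G \<longrightarrow>
            (\<forall>V'. V' \<subseteq> V \<and> V' \<noteq> {} \<longrightarrow> hyperbolic (semigroup_generated (\<Gamma> \<union> V')))))"
proof -
  note G = assms(3)
  \<comment> \<open>A common lower bound for the degrees in \<open>\<Gamma>\<close>; the excluded
    pair allows 3 when \<open>d = 2\<close>.\<close>
  define k where "k = (if d = 2 then 3 else 2 :: nat)"
  have deg2: "degree h \<ge> 2" if "h \<in> \<Gamma>" for h
    using assms(4) semigroup_generated.generator[OF that] by (simp add: class_G_def G)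
  have kdeg: "k \<le> degree h" if "h \<in> \<Gamma>" for h
    using deg2[OF that] assms(8) that by (auto simp: k_def)
  \<comment> \<open>The degree condition as an inequality of exponents; it leaves one spare power of
    \<open>t\<close> in \<open>key\<close>.\<close>
  have kd: "d + 1 \<le> k * (d - 1)" and k2: "2 \<le> k" using assms(7) by (auto simp: k_def)
  obtain m \<rho>0 where m: "m > 0" and \<rho>0: "\<rho>0 > 0"
    and grow: "\<And>h z. h \<in> \<Gamma> \<Longrightarrow> cmod (z - b) \<ge> \<rho>0 \<Longrightarrow> m * cmod (z - b) ^ k \<le> cmod (poly h z - b)"
    using compact_uniform_growth[OF assms(2) kdeg] by metis
  obtain r' where r': "r' > 0" "ball b r' \<subseteq> K_hat G" using assms(6) by (meson mem_interior)
  define r where "r = r' / 2"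
  have r: "0 < r" "r < r'" using r'(1) by (auto simp: r_def)
  \<comment> \<open>Chosen so that \<open>|a| * m ^ (d - 1) * t ^ (d + 1) = C * t\<close> for the
    \<open>t\<close> below.\<close>
  define C where "C = r * m ^ (d - 1) / (4 * 2 ^ d)"
  have C: "C > 0" using r m by (simp add: C_def)
  \<comment> \<open>For \<open>t \<ge> T\<close> the four entries give \<open>t \<ge> 1\<close>,
    \<open>t \<ge> \<rho>0\<close>, \<open>m * t \<ge> 2\<close> and
    \<open>C * t \<ge> 8\<close>.\<close>
  define T where "T = max (max 1 \<rho>0) (max (2 / m) (8 / C))"
  have T: "T \<ge> 1" "T \<ge> \<rho>0" "2 / m \<le> T" "8 / C \<le> T" by (auto simp: T_def)
  \<comment> \<open>\<open>|a| < c0\<close> says exactly that the radius \<open>t\<close> chosen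
    below exceeds \<open>T\<close>.\<close>
  define c0 where "c0 = r / (4 * (2 * T) ^ d)"
  have c0: "c0 > 0" unfolding c0_def using r T(1) by (intro divide_pos_pos mult_pos_pos zero_less_power) auto
  have "\<exists>V. compactin Poly_ge2_topology V \<and>
         smult a ([:- b, 1:] ^ d) + [:b:] \<in> Poly_ge2_topology interior_of V \<and>
         (\<forall>V'. V' \<subseteq> V \<and> V' \<noteq> {} \<longrightarrow>
            semigroup_generated (\<Gamma> \<union> V') \<in> class_G_dis \<and>
            K_hat (semigroup_generated (\<Gamma> \<union> V')) = K_hat G \<and>
            min_generators (\<Gamma> \<union> V') \<subseteq> \<Gamma>) \<and>
         (semi_hyperbolic G \<longrightarrow>
            (\<forall>V'. V' \<subseteq> V \<and> V' \<noteq> {} \<longrightarrow> semi_hyperbolic (semigroup_generated (\<Gamma> \<union> V')))) \<and>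
         (hyperbolic G \<longrightarrow>
            (\<forall>V'. V' \<subseteq> V \<and> V' \<noteq> {} \<longrightarrow> hyperbolic (semigroup_generated (\<Gamma> \<union> V'))))"
    if a: "0 < cmod a" "cmod a < c0" for a
  proof -
    \<comment> \<open>Solves \<open>|a| (2t)^d = r / 4\<close>. The factor 4 leaves room to perturb
      the coefficients while the disc of radius \<open>2 * t\<close> is still sent into
      \<open>ball b r\<close>.\<close>
    define t where "t = root d (r / (4 * cmod a)) / 2"
    have d0: "d > 0" "d \<noteq> 0" using assms(7) by auto
    have q0: "0 \<le> r / (4 * cmod a)" using r by simp
    have tpow: "(2 * t) ^ d = r / (4 * cmod a)"
      using real_root_pow_pos2[OF d0(1) q0] by (simp add: t_def)
    have t0: "0 \<le> t" using q0 d0 by (simp add: t_def real_root_ge_zero)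
    have apow: "cmod a * (2 * t) ^ d = r / 4" unfolding tpow using a(1) by simp
    have Tt: "T \<le> t"
    proof -
      have p: "0 < (2 * T) ^ d" using T(1) by (intro zero_less_power) auto
      have p4: "0 < 4 * (2 * T) ^ d" using p by (rule mult_pos_pos[OF zero_less_numeral])
      have "cmod a * (4 * (2 * T) ^ d) < r"
        using a(2) unfolding c0_def by (simp only: pos_less_divide_eq[OF p4])
      moreover have "(2 * T) ^ d * (4 * cmod a) = cmod a * (4 * (2 * T) ^ d)" by (simp only: mult_ac)
      moreover have "0 < 4 * cmod a" using a(1) by simp
      ultimately have "(2 * T) ^ d < r / (4 * cmod a)" by (simp only: pos_less_divide_eq)
      then have "(2 * T) ^ d < (2 * t) ^ d" by (simp only: tpow)
      then have "2 * T < 2 * t" by (rule power_less_imp_less_base) (use t0 in simp)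
      then show ?thesis by simp
    qed
    have t1: "1 \<le> t" "\<rho>0 \<le> t" using T Tt by auto
    have mt: "2 \<le> m * t"
    proof -
      have "2 / m \<le> t" using T(3) Tt by linarith
      then show ?thesis using m by (simp add: divide_le_eq mult.commute)
    qed
    have Ct: "8 \<le> C * t"
    proof -
      have "8 / C \<le> t" using T(4) Tt by linarith
      then show ?thesis using C by (simp add: divide_le_eq mult.commute)
    qed
    \<comment> \<open>One step of \<open>\<Gamma>\<close> from distance at least \<open>t\<close>
      reaches at least this distance.\<close>
    define \<rho> where "\<rho> = m * t ^ k"
    have grow2: "2 * x \<le> m * x ^ k" if "t \<le> x" for x
    proof -
      have x1: "1 \<le> x" using that t1 by linarith
      have "m * t \<le> m * x" using that m by (intro mult_left_mono) auto
      then have "2 \<le> m * x" using mt by linarith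
      moreover have "x ^ 1 \<le> x ^ (k - 1)" using x1 k2 by (intro power_increasing) auto
      ultimately have "2 * x \<le> (m * x) * x ^ (k - 1)" using x1 by (intro mult_mono) auto
      also have "(m * x) * x ^ (k - 1) = m * (x * x ^ (k - 1))" by simp
      also have "x * x ^ (k - 1) = x ^ k" using k2 by (simp add: power_eq_if)
      finally show ?thesis .
    qed
    have \<rho>2: "2 * t \<le> \<rho>" unfolding \<rho>_def by (rule grow2) simp
    have \<rho>t: "t \<le> \<rho>" "1 \<le> \<rho>" "0 < \<rho>" using \<rho>2 t1 by auto
    \<comment> \<open>The 8 pays for three factors of 2: the leading coefficient may drop to
      \<open>|a| / 2\<close>, the lower terms may take half of what remains, and the distance to
      \<open>b\<close> has to double.\<close>
    have key: "8 \<le> cmod a * \<rho> ^ (d - 1)"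
    proof -
      have "t ^ (d + 1) \<le> t ^ (k * (d - 1))" using kd t1 by (intro power_increasing) auto
      then have "cmod a * (m ^ (d - 1) * t ^ (d + 1)) \<le> cmod a * (m ^ (d - 1) * t ^ (k * (d - 1)))"
        using m by (intro mult_left_mono) auto
      also have "m ^ (d - 1) * t ^ (k * (d - 1)) = \<rho> ^ (d - 1)"
        by (simp add: \<rho>_def power_mult_distrib power_mult)
      finally have "cmod a * (m ^ (d - 1) * t ^ (d + 1)) \<le> cmod a * \<rho> ^ (d - 1)" .
      moreover have "cmod a * (m ^ (d - 1) * t ^ (d + 1)) = C * t"
      proof -
        have "cmod a * t ^ d = r / (4 * 2 ^ d)" using apow by (simp add: power_mult_distrib field_simps)
        then have "cmod a * t ^ d * (m ^ (d - 1) * t) = C * t" by (simp add: C_def)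
        then show ?thesis by (simp add: mult_ac)
      qed
      ultimately show ?thesis using Ct by linarith
    qed
    \<comment> \<open>The first entry gives \<open>d * \<eta> \<le> |a| / 4\<close>, used for escape
      and for critical points; the second keeps the lower terms within \<open>r / 8\<close> on the
      disc of radius \<open>2 * t\<close>.\<close>
    define \<eta> where "\<eta> = min (cmod a / (4 * d)) (r / (8 * d * (2 * t) ^ d))"
    have tp: "(2 * t) ^ d > 0" using t1 by (intro zero_less_power) auto
    have \<eta>0: "0 < \<eta>" using a(1) r(1) d0 tp by (simp add: \<eta>_def)
    have d\<eta>: "d * \<eta> \<le> cmod a / 4"
    proof -
      have "\<eta> \<le> cmod a / (4 * d)" by (simp add: \<eta>_def)
      then have "d * \<eta> \<le> d * (cmod a / (4 * d))" by (intro mult_left_mono) auto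
      then show ?thesis using d0 by simp
    qed
    have d\<eta>t: "d * \<eta> * (2 * t) ^ d \<le> r / 8"
    proof -
      have "\<eta> \<le> r / (8 * d * (2 * t) ^ d)" by (simp add: \<eta>_def)
      then have "(d * (2 * t) ^ d) * \<eta> \<le> (d * (2 * t) ^ d) * (r / (8 * d * (2 * t) ^ d))"
        using tp by (intro mult_left_mono) auto
      also have "\<dots> = r / 8"
      proof -
        have "x * (r / (8 * x)) = r / 8" if "x > 0" for x :: real using that by simp
        moreover have "0 < real d * (2 * t) ^ d" using d0 tp by (intro mult_pos_pos) auto
        ultimately have "real d * (2 * t) ^ d * (r / (8 * (real d * (2 * t) ^ d))) = r / 8" .
        then show ?thesis by (simp only: mult.assoc of_nat_mult of_nat_numeral)
      qed
      finally show ?thesis by (simp add: mult_ac)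
    qed
    have \<eta>2: "\<eta> \<le> cmod a / 2"
    proof -
      have "1 * \<eta> \<le> d * \<eta>" using d0 \<eta>0 by (intro mult_right_mono) auto
      then show ?thesis using d\<eta> norm_ge_zero[of a] by linarith
    qed
    have a0: "a \<noteq> 0" using a(1) by auto
    define V where "V = coeff_ball b d a \<eta>"
    note cb = assms(7) a0 \<eta>0 \<eta>2
    have esc: "escaping \<Gamma> b t"
    proof
      fix h z assume h: "h \<in> \<Gamma>" and z: "t \<le> cmod (z - b)"
      have "\<rho>0 \<le> cmod (z - b)" using z t1 by linarith
      from grow[OF h this] grow2[OF z]
      show "2 * cmod (z - b) \<le> cmod (poly h z - b)" by linarith
    qed (use assms(1) t1 deg2 in auto)
    interpret T: escaping \<Gamma> b t by (rule esc)
    have pcb: "pc_bounded \<Gamma> b \<rho>"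
    proof
      show "cmod (poly h z - b) \<ge> 2 * cmod (z - b)" if "h \<in> \<Gamma>" "\<rho> \<le> cmod (z - b)" for h z
        using T.escape[OF that(1)] that(2) \<rho>t by simp
      show "b \<in> interior T.K" using assms(6) by (simp only: G)
      show "crit_vals h \<subseteq> T.K" if "h \<in> \<Gamma>" for h
        using crit_vals_in_K_hat[OF G assms(4) that] by (simp only: G)
    qed (use assms(1) \<rho>t deg2 in auto)
    have near: "poly v z \<in> ball b r" if v: "v \<in> V" and z: "cmod (z - b) \<le> 2 * t" for v z
    proof -
      obtain c where c: "v = poly_at b d c" "cmod (c d - a) \<le> \<eta>" "\<And>j. j < d \<Longrightarrow> cmod (c j) \<le> \<eta>"
        using v unfolding V_def coeff_ball_def by blast
      have "cmod (poly v z - b) \<le> cmod (c d) * (2 * t) ^ d + d * \<eta> * (2 * t) ^ d"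
        unfolding c(1) by (rule poly_at_small) (use c(3) \<eta>0 z t1 in auto)
      also have "cmod (c d) * (2 * t) ^ d \<le> 3 / 2 * cmod a * (2 * t) ^ d"
        using coeff_ball_lead(2)[OF cb c(2)] tp by (intro mult_right_mono) auto
      also have "\<dots> = 3 / 2 * (r / 4)" by (simp only: mult.assoc apow)
      finally have "cmod (poly v z - b) < r" using d\<eta>t r(1) by linarith
      then show ?thesis by (simp add: dist_cmod)
    qed
    have escV: "2 * cmod (z - b) \<le> cmod (poly v z - b)" if v: "v \<in> V" and z: "\<rho> \<le> cmod (z - b)" for v z
    proof -
      obtain c where c: "v = poly_at b d c" "cmod (c d - a) \<le> \<eta>" "\<And>j. j < d \<Longrightarrow> cmod (c j) \<le> \<eta>"
        using v unfolding V_def coeff_ball_def by blast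
      define x where "x = cmod (z - b)"
      have x: "1 \<le> x" "\<rho> \<le> x" using z \<rho>t by (auto simp: x_def)
      have "x ^ (d - 1) * (cmod a / 2 * x - d * \<eta>) \<le> cmod (poly v z - b)"
        unfolding c(1) x_def
        by (rule poly_at_lower_bound)
           (use d0 coeff_ball_lead(1)[OF cb c(2)] c(3) \<eta>0 x in \<open>auto simp: x_def\<close>)
      moreover have "\<rho> ^ (d - 1) * (cmod a / 4 * x) \<le> x ^ (d - 1) * (cmod a / 2 * x - d * \<eta>)"
      proof (rule mult_mono)
        show "\<rho> ^ (d - 1) \<le> x ^ (d - 1)" using x \<rho>t by (intro power_mono) auto
        have "cmod a / 4 * 1 \<le> cmod a / 4 * x" using x by (intro mult_left_mono) auto
        then show "cmod a / 4 * x \<le> cmod a / 2 * x - d * \<eta>"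
          using d\<eta> by (simp add: mult.commute[of x])
      qed (use x in auto)
      moreover have "2 * x \<le> \<rho> ^ (d - 1) * (cmod a / 4 * x)"
      proof -
        have "8 * (x / 4) \<le> (cmod a * \<rho> ^ (d - 1)) * (x / 4)"
          using key x by (intro mult_right_mono) auto
        then show ?thesis by (simp add: mult_ac)
      qed
      ultimately show ?thesis unfolding x_def[symmetric] by linarith
    qed
    have critV: "crit_vals v \<subseteq> ball b r" if v: "v \<in> V" for v
    proof
      fix y assume "y \<in> crit_vals v"
      then obtain z where z: "y = poly v z" "poly (pderiv v) z = 0" by (auto simp: crit_vals_def)
      obtain c where c: "v = poly_at b d c" "cmod (c d - a) \<le> \<eta>" "\<And>j. j < d \<Longrightarrow> cmod (c j) \<le> \<eta>"
        using v unfolding V_def coeff_ball_def by blast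
      have "d * \<eta> < cmod (c d)" using coeff_ball_lead(1)[OF cb c(2)] d\<eta> a(1) by linarith
      then have "cmod (z - b) < 1"
        using crit_point_poly_at[of d c \<eta> b z] d0 c(3) \<eta>0 z(2) by (simp add: c(1))
      then show "y \<in> ball b r" unfolding z(1) by (intro near[OF v]) (use t1 in linarith)
    qed
    have pert: "perturbation \<Gamma> b \<rho> V' r r'" if V': "V' \<subseteq> V" "V' \<noteq> {}" for V'
    proof -
      interpret pc: pc_bounded \<Gamma> b \<rho> by (rule pcb)
      show ?thesis
      proof
        show "ball b r' \<subseteq> T.K" using r'(2) by (simp only: G)
        show "degree v \<ge> 2" if "v \<in> V'" for v
          using coeff_ball_subset[OF cb] that V'(1) by (auto simp: V_def Poly_ge2_def)
        show "poly v z \<in> ball b r" if "v \<in> V'" "z \<in> T.K" for v z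
        proof (rule near)
          \<comment> \<open>\<open>t\<close> is already an escape radius of \<open>\<Gamma>\<close>,
            so the filled set lies in \<open>ball b t\<close>.\<close>
          show "cmod (z - b) \<le> 2 * t" using subsetD[OF T.K_subset that(2)] t1 by (simp add: dist_cmod)
        qed (use that V' in auto)
        show "crit_vals v \<subseteq> ball b r" if "v \<in> V'" for v
          by (rule critV) (use that V'(1) in blast)
        show "2 * cmod (z - b) \<le> cmod (poly v z - b)" if "v \<in> V'" "\<rho> \<le> cmod (z - b)" for v z
          by (rule escV[OF _ that(2)]) (use that V'(1) in blast)
      qed (use r V' in auto)
    qed
    have far: "\<rho> \<le> cmod (poly h z - b)" if h: "h \<in> \<Gamma>" and z: "t \<le> cmod (z - b)" for h z
    proof -
      have "m * t ^ k \<le> m * cmod (z - b) ^ k" using z t0 m by (intro mult_left_mono power_mono) auto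
      moreover have "\<rho>0 \<le> cmod (z - b)" using z t1 by linarith
      ultimately show ?thesis using grow[OF h] unfolding \<rho>_def by force
    qed
    have dis: "semigroup_generated (\<Gamma> \<union> V') \<in> class_G_dis" "min_generators (\<Gamma> \<union> V') \<subseteq> \<Gamma>"
      if V': "V' \<subseteq> V" "V' \<noteq> {}" for V'
    proof -
      have "0 < t" using t1 by simp
      note * = pert[OF V'] this \<rho>2 esc far
      have near': "poly v z \<in> ball b r" if "v \<in> V'" "cmod (z - b) \<le> 2 * t" for v z
        using near that V' by blast
      show "semigroup_generated (\<Gamma> \<union> V') \<in> class_G_dis"
        by (rule perturbation_separating_annulus(1)[OF * near'])
      show "min_generators (\<Gamma> \<union> V') \<subseteq> \<Gamma>"
        by (rule perturbation_separating_annulus(2)[OF * near'])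
    qed
    show ?thesis
    proof (intro exI[of _ V] conjI allI impI)
      show "compactin Poly_ge2_topology V" unfolding V_def by (rule compactin_coeff_ball[OF cb])
      show "smult a ([:- b, 1:] ^ d) + [:b:] \<in> Poly_ge2_topology interior_of V"
        unfolding V_def by (rule coeff_ball_nbhd[OF cb])
      fix V' assume "V' \<subseteq> V \<and> V' \<noteq> {}"
      then have V': "V' \<subseteq> V" "V' \<noteq> {}" by auto
      show "semigroup_generated (\<Gamma> \<union> V') \<in> class_G_dis" by (rule dis(1)[OF V'])
      show "min_generators (\<Gamma> \<union> V') \<subseteq> \<Gamma>" by (rule dis(2)[OF V'])
      show "K_hat (semigroup_generated (\<Gamma> \<union> V')) = K_hat G"
        unfolding G by (rule perturbation.K_hat_H[OF pert[OF V']])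
    next
      fix V' assume "semi_hyperbolic G" "V' \<subseteq> V \<and> V' \<noteq> {}"
      then show "semi_hyperbolic (semigroup_generated (\<Gamma> \<union> V'))"
        unfolding G by (intro perturbation.semi_hyperbolic_H[OF pert]) auto
    next
      fix V' assume "hyperbolic G" "V' \<subseteq> V \<and> V' \<noteq> {}"
      then show "hyperbolic (semigroup_generated (\<Gamma> \<union> V'))"
        unfolding G by (intro perturbation.hyperbolic_H[OF pert]) auto
    qed
  qed
  then show ?thesis using c0 by (intro exI[of _ c0]) simp
qed

end
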